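(* Let $M$ be a $C^{2,1}$ manifold endowed with a time oriented $C^{1,1}$ Lorentzian metric $g$ and corresponding locally Lipschitz Levi-Civita connection. Convex normal subsets of $M$ are causally simple.
   Context: $C^{k,1}$ means $C^{k,1}_{loc}$. $M$ is an $n$-dimensional paracompact connected $C^{2,1}$ manifold, with $g$ of signature $(-,+,\dots,+)$ and time oriented by a global continuous timelike vector field. A non-vanishing vector $v$ is causal if $g(v,v)\le0$ and timelike if $g(v,v)<0$. Geodesics are the non-stationary solutions of $\ddot x^\mu=-\Gamma^\mu_{\alpha\beta}(x)\dot x^\alpha\dot x^\beta$, with $\Gamma$ the Christoffel symbols; $\gamma_v$ is the unique solution with initial velocity $v$, $\Omega_q\subset T_qM$ is the set of $v\in T_qM$ for which $\gamma_v$ is defined at least on $[0,1]$, and $\exp_qv:=\gamma_v(1)$; $\exp v:=(\pi(v),\gamma_v(1))$. An open set $C\subset M$ is convex normal if for each $q\in C$ there is an open star-shaped ($v\in N_q$, $s\in[0,1]$ imply $sv\in N_q$) set $N_q\subset\Omega_q$ such that $\exp_q\colon N_q\to C$ is a homeomorphism, locally Lipschitz with locally Lipschitz inverse. For $S\subset M$, $J^+_S\subset S\times S$ is the set of pairs $(x,y)$ such that either there is a future directed $C^1$ causal curve from $x$ to $y$ contained in $S$, or $x=y\in S$. A subset $A\subset B$ is causally convex in $B\subset M$ if every $C^1$ causal curve contained in $B$ and joining two points of $A$ is necessarily contained in $A$. An open subset $B$ is strongly causal if every point of $B$ admits arbitrarily small open neighborhoods which are causally convex in $B$. An open subset $S$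 of $M$ is causally simple if it is strongly causal and $J^+_S\subset S\times S$ is closed in the product topology. *)

theory Defs
  imports "HOL-Analysis.Analysis"
begin

section \<open>Regularity classes in Euclidean space\<close>

definition locally_lipschitz_on ::
    "('a::metric_space \<Rightarrow> 'b::metric_space) \<Rightarrow> 'a set \<Rightarrow> bool" where
  "locally_lipschitz_on f S \<longleftrightarrow>
     (\<forall>x\<in>S. \<exists>r>0. \<exists>L. L-lipschitz_on (cball x r \<inter> S) f)"

text \<open>The class \<open>C\<^sup>k\<^sup>,\<^sup>1\<close>, in its local version, on an open set \<open>S\<close>: all directional
  derivatives up to order \<open>k\<close> exist and those of order \<open>k\<close> are locally Lipschitz.\<close>

fun Ck1_on ::
    "nat \<Rightarrow> ('a::euclidean_space \<Rightarrow> 'b::real_normed_vector) \<Rightarrow> 'a set \<Rightarrow> bool" where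
  "Ck1_on 0 f S \<longleftrightarrow> locally_lipschitz_on f S"
| "Ck1_on (Suc k) f S \<longleftrightarrow>
     (\<forall>x\<in>S. f differentiable (at x)) \<and>
     (\<forall>v. Ck1_on k (\<lambda>x. frechet_derivative f (at x) v) S)"


section \<open>Manifolds\<close>

definition paracompact_space :: "'a topology \<Rightarrow> bool" where
  "paracompact_space X \<longleftrightarrow>
     (\<forall>\<U>. (\<forall>U\<in>\<U>. openin X U) \<and> \<Union>\<U> = topspace X \<longrightarrow>
        (\<exists>\<V>. (\<forall>V\<in>\<V>. openin X V) \<and> \<Union>\<V> = topspace X \<and>
             (\<forall>V\<in>\<V>. \<exists>U\<in>\<U>. V \<subseteq> U) \<and> locally_finite_in X \<V>))"

text \<open>A chart is a domain together with a coordinate map; the values of the coordinate map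
  outside the domain are irrelevant.\<close>

type_synonym ('m, 'n) chart = "'m set \<times> ('m \<Rightarrow> real ^ 'n)"

abbreviation chart_inv :: "('m, 'n) chart \<Rightarrow> real ^ 'n \<Rightarrow> 'm" where
  "chart_inv c \<equiv> inv_into (fst c) (snd c)"

definition is_chart :: "('m::topological_space, 'n::finite) chart \<Rightarrow> bool" where
  "is_chart c \<longleftrightarrow>
     open (fst c) \<and> open (snd c ` fst c) \<and>
     homeomorphism (fst c) (snd c ` fst c) (snd c) (chart_inv c)"

abbreviation transition ::
    "('m, 'n) chart \<Rightarrow> ('m, 'n) chart \<Rightarrow> real ^ 'n \<Rightarrow> real ^ 'n" where
  "transition c d \<equiv> snd d \<circ> chart_inv c"

text \<open>The underlying point set of the manifold is the whole type \<open>'m\<close>, its dimension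
  is \<open>CARD('n)\<close>.\<close>

definition C21_atlas :: "('m::topological_space, 'n::finite) chart set \<Rightarrow> bool" where
  "C21_atlas A \<longleftrightarrow>
     (\<forall>c\<in>A. is_chart c) \<and> (\<Union>c\<in>A. fst c) = UNIV \<and>
     (\<forall>c\<in>A. \<forall>d\<in>A. Ck1_on 2 (transition c d) (snd c ` (fst c \<inter> fst d)))"


section \<open>Tangent vectors\<close>

text \<open>A tangent vector at \<open>q\<close> is the family of its components in the charts around \<open>q\<close>,
  subject to the contravariant transformation law. The components in the remaining
  (irrelevant) charts are set to zero, so that equality is equality of tangent vectors
  and \<open>\<lambda>_. 0\<close> is the zero vector. The product topology on the function type \<open>tvec\<close>
  induces on each tangent space its usual topology, because all components depend
  linearly and bijectively on those in any one chart around \<open>q\<close>.\<close>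

type_synonym ('m, 'n) tvec = "('m, 'n) chart \<Rightarrow> real ^ 'n"

definition tangent_space ::
    "('m, 'n::finite) chart set \<Rightarrow> 'm \<Rightarrow> ('m, 'n) tvec set" where
  "tangent_space A q =
     {v. (\<forall>c\<in>A. \<forall>d\<in>A. q \<in> fst c \<and> q \<in> fst d \<longrightarrow>
            v d = frechet_derivative (transition c d) (at (snd c q)) (v c)) \<and>
         (\<forall>c. c \<notin> A \<or> q \<notin> fst c \<longrightarrow> v c = 0)}"

text \<open>The tangent vector at \<open>q\<close> whose components in the chart \<open>c\<close> are \<open>u\<close>.\<close>

definition coord_vec ::
    "('m, 'n::finite) chart set \<Rightarrow> ('m, 'n) chart \<Rightarrow> 'm \<Rightarrow> real ^ 'n \<Rightarrow> ('m, 'n) tvec" where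
  "coord_vec A c q u =
     (\<lambda>d. if d \<in> A \<and> q \<in> fst d
          then frechet_derivative (transition c d) (at (snd c q)) u else 0)"


section \<open>Lorentzian metrics\<close>

type_synonym ('m, 'n) metric_field = "'m \<Rightarrow> ('m, 'n) tvec \<Rightarrow> ('m, 'n) tvec \<Rightarrow> real"

text \<open>Signature \<open>(-,+,\<dots>,+)\<close> is expressed by an orthonormal family indexed by \<open>'n\<close>; such
  a family is automatically a basis, its cardinality being the dimension.\<close>

definition lorentzian_form ::
    "('m, 'n::finite) chart set \<Rightarrow> 'm \<Rightarrow> (('m, 'n) tvec \<Rightarrow> ('m, 'n) tvec \<Rightarrow> real) \<Rightarrow> bool" where
  "lorentzian_form A q b \<longleftrightarrow>
     (\<forall>v\<in>tangent_space A q. \<forall>w\<in>tangent_space A q. b v w = b w v) \<and>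
     (\<forall>u\<in>tangent_space A q. \<forall>v\<in>tangent_space A q. \<forall>w\<in>tangent_space A q. \<forall>r s.
        b (\<lambda>c. r *\<^sub>R u c + s *\<^sub>R v c) w = r * b u w + s * b v w) \<and>
     (\<exists>(k::'n) e. (\<forall>i. e i \<in> tangent_space A q) \<and>
        (\<forall>i j. b (e i) (e j) = (if i \<noteq> j then 0 else if i = k then -1 else 1)))"

definition metric_coeff ::
    "('m, 'n::finite) chart set \<Rightarrow> ('m, 'n) metric_field \<Rightarrow> ('m, 'n) chart
       \<Rightarrow> real ^ 'n \<Rightarrow> 'n \<Rightarrow> 'n \<Rightarrow> real" where
  "metric_coeff A g c x i j =
     g (chart_inv c x) (coord_vec A c (chart_inv c x) (axis i 1))
                       (coord_vec A c (chart_inv c x) (axis j 1))"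

definition C11_lorentzian_metric ::
    "('m, 'n::finite) chart set \<Rightarrow> ('m, 'n) metric_field \<Rightarrow> bool" where
  "C11_lorentzian_metric A g \<longleftrightarrow>
     (\<forall>q. lorentzian_form A q (g q)) \<and>
     (\<forall>c\<in>A. \<forall>i j. Ck1_on 1 (\<lambda>x. metric_coeff A g c x i j) (snd c ` fst c))"

definition causal_vec :: "('m, 'n::finite) metric_field \<Rightarrow> 'm \<Rightarrow> ('m, 'n) tvec \<Rightarrow> bool" where
  "causal_vec g q v \<longleftrightarrow> v \<noteq> (\<lambda>_. 0) \<and> g q v v \<le> 0"

definition timelike_vec :: "('m, 'n::finite) metric_field \<Rightarrow> 'm \<Rightarrow> ('m, 'n) tvec \<Rightarrow> bool" where
  "timelike_vec g q v \<longleftrightarrow> v \<noteq> (\<lambda>_. 0) \<and> g q v v < 0"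

definition time_orientation ::
    "('m::topological_space, 'n::finite) chart set \<Rightarrow> ('m, 'n) metric_field
       \<Rightarrow> ('m \<Rightarrow> ('m, 'n) tvec) \<Rightarrow> bool" where
  "time_orientation A g T \<longleftrightarrow>
     (\<forall>q. T q \<in> tangent_space A q \<and> timelike_vec g q (T q)) \<and>
     (\<forall>c\<in>A. continuous_on (fst c) (\<lambda>q. T q c))"


section \<open>Curves and geodesics\<close>

text \<open>Curves are parametrised by the unit interval, with one-sided derivatives at the
  end points.\<close>

definition velocity ::
    "('m, 'n::finite) chart set \<Rightarrow> (real \<Rightarrow> 'm) \<Rightarrow> real \<Rightarrow> ('m, 'n) tvec" where
  "velocity A \<gamma> t =
     (\<lambda>c. if c \<in> A \<and> \<gamma> t \<in> fst c
          then vector_derivative (snd c \<circ> \<gamma>) (at t within {0..1}) else 0)"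

definition C1_curve ::
    "('m::topological_space, 'n::finite) chart set \<Rightarrow> (real \<Rightarrow> 'm) \<Rightarrow> bool" where
  "C1_curve A \<gamma> \<longleftrightarrow>
     path \<gamma> \<and>
     (\<forall>c\<in>A. (\<forall>t\<in>{0..1}. \<gamma> t \<in> fst c \<longrightarrow> (snd c \<circ> \<gamma>) differentiable (at t within {0..1})) \<and>
            continuous_on {t\<in>{0..1}. \<gamma> t \<in> fst c} (\<lambda>t. velocity A \<gamma> t c))"

text \<open>The Christoffel symbol with upper index \<open>k\<close> and lower indices \<open>i\<close>, \<open>j\<close>.\<close>

definition christoffel ::
    "('m, 'n::finite) chart set \<Rightarrow> ('m, 'n) metric_field \<Rightarrow> ('m, 'n) chart
       \<Rightarrow> real ^ 'n \<Rightarrow> 'n \<Rightarrow> 'n \<Rightarrow> 'n \<Rightarrow> real" where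
  "christoffel A g c x k i j =
     (let G = (\<chi> a b. metric_coeff A g c x a b);
          dG = (\<lambda>l a b. frechet_derivative (\<lambda>y. metric_coeff A g c y a b) (at x) (axis l 1))
      in (\<Sum>l\<in>UNIV. matrix_inv G $ k $ l * (dG i l j + dG j l i - dG l i j)) / 2)"

text \<open>Solutions on the unit interval of the geodesic equation; stationary ones are included.\<close>

definition geodesic_solution ::
    "('m::topological_space, 'n::finite) chart set \<Rightarrow> ('m, 'n) metric_field
       \<Rightarrow> (real \<Rightarrow> 'm) \<Rightarrow> bool" where
  "geodesic_solution A g \<gamma> \<longleftrightarrow>
     path \<gamma> \<and>
     (\<forall>c\<in>A. \<forall>t\<in>{0..1}. \<gamma> t \<in> fst c \<longrightarrow>
        (snd c \<circ> \<gamma>) differentiable (at t within {0..1}) \<and>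
        ((\<lambda>s. velocity A \<gamma> s c) has_vector_derivative
           (\<chi> k. - (\<Sum>i\<in>UNIV. \<Sum>j\<in>UNIV. christoffel A g c (snd c (\<gamma> t)) k i j
                       * velocity A \<gamma> t c $ i * velocity A \<gamma> t c $ j)))
          (at t within {0..1}))"

definition exp_domain ::
    "('m::topological_space, 'n::finite) chart set \<Rightarrow> ('m, 'n) metric_field
       \<Rightarrow> 'm \<Rightarrow> ('m, 'n) tvec set" where
  "exp_domain A g q =
     {v \<in> tangent_space A q.
        \<exists>\<gamma>. geodesic_solution A g \<gamma> \<and> \<gamma> 0 = q \<and> velocity A \<gamma> 0 = v}"

definition exp_map ::
    "('m::topological_space, 'n::finite) chart set \<Rightarrow> ('m, 'n) metric_field
       \<Rightarrow> 'm \<Rightarrow> ('m, 'n) tvec \<Rightarrow> 'm" where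
  "exp_map A g q v =
     (THE p. \<exists>\<gamma>. geodesic_solution A g \<gamma> \<and> \<gamma> 0 = q \<and> velocity A \<gamma> 0 = v \<and> \<gamma> 1 = p)"


section \<open>Convex normal sets\<close>

text \<open>Local Lipschitz continuity of maps between (subsets of) a tangent space and the
  manifold is understood in coordinates.\<close>

definition loc_lipschitz_from_tangent ::
    "('m, 'n::finite) chart set \<Rightarrow> 'm \<Rightarrow> ('m, 'n) tvec set \<Rightarrow> (('m, 'n) tvec \<Rightarrow> 'm) \<Rightarrow> bool" where
  "loc_lipschitz_from_tangent A q N f \<longleftrightarrow>
     (\<forall>c\<in>A. \<forall>d\<in>A. q \<in> fst c \<longrightarrow>
        locally_lipschitz_on (\<lambda>u. snd d (f (coord_vec A c q u)))
          {u. coord_vec A c q u \<in> N \<and> f (coord_vec A c q u) \<in> fst d})"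

definition loc_lipschitz_to_tangent ::
    "('m, 'n::finite) chart set \<Rightarrow> 'm \<Rightarrow> 'm set \<Rightarrow> ('m \<Rightarrow> ('m, 'n) tvec) \<Rightarrow> bool" where
  "loc_lipschitz_to_tangent A q C h \<longleftrightarrow>
     (\<forall>c\<in>A. \<forall>d\<in>A. q \<in> fst c \<longrightarrow>
        locally_lipschitz_on (\<lambda>x. h (chart_inv d x) c) (snd d ` (C \<inter> fst d)))"

definition convex_normal ::
    "('m::topological_space, 'n::finite) chart set \<Rightarrow> ('m, 'n) metric_field
       \<Rightarrow> 'm set \<Rightarrow> bool" where
  "convex_normal A g C \<longleftrightarrow>
     open C \<and>
     (\<forall>q\<in>C. \<exists>N h.
        openin (top_of_set (tangent_space A q)) N \<and>
        (\<forall>v\<in>N. \<forall>s\<in>{0..1}. (\<lambda>c. s *\<^sub>R v c) \<in> N) \<and>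
        N \<subseteq> exp_domain A g q \<and>
        homeomorphism N C (exp_map A g q) h \<and>
        loc_lipschitz_from_tangent A q N (exp_map A g q) \<and>
        loc_lipschitz_to_tangent A q C h)"


section \<open>Causality\<close>

definition causal_curve ::
    "('m::topological_space, 'n::finite) chart set \<Rightarrow> ('m, 'n) metric_field
       \<Rightarrow> (real \<Rightarrow> 'm) \<Rightarrow> bool" where
  "causal_curve A g \<gamma> \<longleftrightarrow>
     C1_curve A \<gamma> \<and> (\<forall>t\<in>{0..1}. causal_vec g (\<gamma> t) (velocity A \<gamma> t))"

text \<open>A causal vector \<open>v\<close> lies in the same half-cone as the timelike vector \<open>T\<close>
  iff \<open>g(T,v) < 0\<close>, the signature being \<open>(-,+,\<dots>,+)\<close>.\<close>

definition future_causal_curve ::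
    "('m::topological_space, 'n::finite) chart set \<Rightarrow> ('m, 'n) metric_field
       \<Rightarrow> ('m \<Rightarrow> ('m, 'n) tvec) \<Rightarrow> (real \<Rightarrow> 'm) \<Rightarrow> bool" where
  "future_causal_curve A g T \<gamma> \<longleftrightarrow>
     causal_curve A g \<gamma> \<and> (\<forall>t\<in>{0..1}. g (\<gamma> t) (T (\<gamma> t)) (velocity A \<gamma> t) < 0)"

definition causal_future ::
    "('m::topological_space, 'n::finite) chart set \<Rightarrow> ('m, 'n) metric_field
       \<Rightarrow> ('m \<Rightarrow> ('m, 'n) tvec) \<Rightarrow> 'm set \<Rightarrow> ('m \<times> 'm) set" where
  "causal_future A g T S =
     {(x, y). (\<exists>\<gamma>. future_causal_curve A g T \<gamma> \<and> pathstart \<gamma> = x \<and> pathfinish \<gamma> = y \<and>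
                  path_image \<gamma> \<subseteq> S) \<or>
              (x = y \<and> x \<in> S)}"

definition causally_convex_in ::
    "('m::topological_space, 'n::finite) chart set \<Rightarrow> ('m, 'n) metric_field
       \<Rightarrow> 'm set \<Rightarrow> 'm set \<Rightarrow> bool" where
  "causally_convex_in A g V B \<longleftrightarrow>
     V \<subseteq> B \<and>
     (\<forall>\<gamma>. causal_curve A g \<gamma> \<and> path_image \<gamma> \<subseteq> B \<and> pathstart \<gamma> \<in> V \<and> pathfinish \<gamma> \<in> V
          \<longrightarrow> path_image \<gamma> \<subseteq> V)"

definition strongly_causal ::
    "('m::topological_space, 'n::finite) chart set \<Rightarrow> ('m, 'n) metric_field
       \<Rightarrow> 'm set \<Rightarrow> bool" where
  "strongly_causal A g B \<longleftrightarrow>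
     open B \<and>
     (\<forall>p\<in>B. \<forall>U. open U \<and> p \<in> U \<longrightarrow>
        (\<exists>V. open V \<and> p \<in> V \<and> V \<subseteq> U \<and> causally_convex_in A g V B))"

definition causally_simple ::
    "('m::topological_space, 'n::finite) chart set \<Rightarrow> ('m, 'n) metric_field
       \<Rightarrow> ('m \<Rightarrow> ('m, 'n) tvec) \<Rightarrow> 'm set \<Rightarrow> bool" where
  "causally_simple A g T S \<longleftrightarrow>
     open S \<and> strongly_causal A g S \<and>
     closedin (top_of_set (S \<times> S)) (causal_future A g T S)"

end

theory Submission
  imports Defs
begin

text \<open>
  Let \<open>q\<close> be a point of the convex normal set \<open>C\<close>. The heart of the matter is that a future causal curve
  in \<open>C\<close> which starts in the chronological future of \<open>q\<close>, the \<open>exp\<^sub>q\<close>-image of the open future cone,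
  stays in it (\<open>future_timelike_invariant\<close>). For a smooth metric this follows from the Gauss lemma: the
  function \<open>E\<^sub>q(y) = g(exp\<^sub>q\<^sup>-\<^sup>1 y, exp\<^sub>q\<^sup>-\<^sup>1 y)\<close> has derivative \<open>2 g(P, \<cdot>)\<close>, where \<open>P\<close> is the end velocity of
  the geodesic from \<open>q\<close> to \<open>y\<close>, and two future causal vectors, one of them timelike, have a negative
  product.

  For a \<open>C\<^sup>1\<^sup>,\<^sup>1\<close> metric the exponential map is only Lipschitz, but \<open>E\<^sub>q\<close> is still differentiable. Compare
  the geodesics from \<open>q\<close> to \<open>y\<close> and to a nearby point \<open>y'\<close>. Their initial velocities differ by
  \<open>O(\<bar>y - y'\<bar>)\<close> because \<open>exp\<^sub>q\<^sup>-\<^sup>1\<close> is locally Lipschitz, hence by a Gronwall estimate (\<open>ode_comparison\<close>) they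
  remain that close in position and velocity. The Lagrangian \<open>g(v, v)\<close> has a locally Lipschitz derivative,
  so its first-order Taylor formula along the geodesics has an error \<open>O(\<bar>y - y'\<bar>\<^sup>2)\<close>, and by the
  Euler-Lagrange equation the first-order term integrates to the boundary term \<open>2 g(P, y' - y)\<close>
  (\<open>first_variation\<close>, \<open>gauss_lemma\<close>).

  Causal simplicity is deduced from properties of \<open>exp\<^sub>q\<close> for one fixed \<open>q\<close> at a time. Geodesics in \<open>C\<close>
  between two points are unique, so a geodesic from \<open>x\<close> to \<open>y\<close> can be read from either end: \<open>exp\<^sub>x\<^sup>-\<^sup>1 y\<close> is in
  the closed future cone if and only if \<open>exp\<^sub>y\<^sup>-\<^sup>1 x\<close> is in the closed past cone (\<open>cone_dual\<close>). If \<open>(x, y)\<close> is a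
  limit of causally related pairs and \<open>z\<close> is in the chronological past of \<open>x\<close>, then \<open>y\<close> is a limit of
  points in the chronological future of \<open>z\<close>; letting \<open>z\<close> tend to \<open>x\<close> and using continuity of \<open>exp\<^sub>y\<^sup>-\<^sup>1\<close>
  shows that \<open>exp\<^sub>y\<^sup>-\<^sup>1 x\<close> is in the closed past cone. The geodesic from \<open>x\<close> to \<open>y\<close> is thus causal or
  constant, and \<open>J\<^sup>+\<close> is closed (\<open>closure_causal_future_cone\<close>). For strong causality, chronological diamonds
  between \<open>exp\<^sub>p (- \<epsilon> T)\<close> and \<open>exp\<^sub>p (\<epsilon> T)\<close> are open and causally convex by the invariance statement, and they
  are arbitrarily small because \<open>J\<^sup>+\<close> is closed and antisymmetric on \<open>C\<close> (\<open>small_diamond\<close>).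
\<close>


section \<open>Locally Lipschitz maps\<close>

lemma locally_lipschitz_onE:
  assumes "locally_lipschitz_on f S" "x \<in> S"
  obtains r L where "r > 0" "L \<ge> 0"
    "\<And>y z. y \<in> S \<Longrightarrow> z \<in> S \<Longrightarrow> dist y x \<le> r \<Longrightarrow> dist z x \<le> r \<Longrightarrow> dist (f y) (f z) \<le> L * dist y z"
proof -
  obtain r L where "r > 0" and L: "L-lipschitz_on (cball x r \<inter> S) f"
    using assms unfolding locally_lipschitz_on_def by blast
  moreover have "L \<ge> 0"
    using L by (rule lipschitz_on_nonneg)
  ultimately show thesis
    by (intro that[of r L]) (auto simp: dist_commute intro!: lipschitz_onD[OF L])
qed

lemma locally_lipschitz_onI:
  assumes "\<And>x. x \<in> S \<Longrightarrow> \<exists>r>0. \<exists>L\<ge>0. \<forall>y\<in>S. \<forall>z\<in>S. dist y x \<le> r \<longrightarrow> dist z x \<le> r \<longrightarrow>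
              dist (f y) (f z) \<le> L * dist y z"
  shows "locally_lipschitz_on f S"
  unfolding locally_lipschitz_on_def
proof
  fix x assume "x \<in> S"
  then obtain r L where "r > 0" "L \<ge> 0" and
    *: "\<forall>y\<in>S. \<forall>z\<in>S. dist y x \<le> r \<longrightarrow> dist z x \<le> r \<longrightarrow> dist (f y) (f z) \<le> L * dist y z"
    using assms by blast
  have "L-lipschitz_on (cball x r \<inter> S) f"
    using * \<open>L \<ge> 0\<close> by (intro lipschitz_onI) (auto simp: dist_commute)
  then show "\<exists>r>0. \<exists>L. L-lipschitz_on (cball x r \<inter> S) f"
    using \<open>r > 0\<close> by blast
qed

lemma locally_lipschitz_on_cong:
  "(\<And>x. x \<in> S \<Longrightarrow> f x = h x) \<Longrightarrow> locally_lipschitz_on f S \<longleftrightarrow> locally_lipschitz_on h S"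
  unfolding locally_lipschitz_on_def
  by (intro ball_cong ex_cong1 conj_cong refl lipschitz_on_cong) auto

lemma locally_lipschitz_imp_continuous_on:
  assumes "locally_lipschitz_on f S"
  shows "continuous_on S f"
  unfolding continuous_on_iff
proof (intro ballI allI impI)
  fix x and e :: real assume "x \<in> S" "e > 0"
  obtain r L where r: "r > 0" "L \<ge> 0"
    and L: "\<And>y z. y \<in> S \<Longrightarrow> z \<in> S \<Longrightarrow> dist y x \<le> r \<Longrightarrow> dist z x \<le> r \<Longrightarrow> dist (f y) (f z) \<le> L * dist y z"
    using locally_lipschitz_onE[OF assms \<open>x \<in> S\<close>] by blast
  show "\<exists>d>0. \<forall>x'\<in>S. dist x' x < d \<longrightarrow> dist (f x') (f x) < e"
  proof (intro exI[of _ "min r (e / (L + 1))"] conjI ballI impI)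
    show "0 < min r (e / (L + 1))"
      using r \<open>e > 0\<close> by auto
    fix y assume "y \<in> S" and y: "dist y x < min r (e / (L + 1))"
    then have "dist (f y) (f x) \<le> L * dist y x"
      using r \<open>x \<in> S\<close> by (intro L) auto
    also have "\<dots> \<le> (L + 1) * dist y x"
      by (simp add: algebra_simps)
    also have "\<dots> < e"
      using y r by (simp add: field_simps)
    finally show "dist (f y) (f x) < e" .
  qed
qed

lemma locally_lipschitz_const: "locally_lipschitz_on (\<lambda>x. c) S"
  unfolding locally_lipschitz_on_def
  using lipschitz_on_constant zero_less_one by blast

lemma (in bounded_linear) locally_lipschitz: "locally_lipschitz_on f S"
  unfolding locally_lipschitz_on_def
  by (metis lipschitz_boundE zero_less_one)

lemma locally_lipschitz_pair:
  assumes "locally_lipschitz_on f S" "locally_lipschitz_on h S"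
  shows "locally_lipschitz_on (\<lambda>x. (f x, h x)) S"
  unfolding locally_lipschitz_on_def
proof
  fix x assume "x \<in> S"
  obtain r L where r: "r > 0" "L-lipschitz_on (cball x r \<inter> S) f"
    using assms \<open>x \<in> S\<close> unfolding locally_lipschitz_on_def by blast
  obtain r' L' where r': "r' > 0" "L'-lipschitz_on (cball x r' \<inter> S) h"
    using assms \<open>x \<in> S\<close> unfolding locally_lipschitz_on_def by blast
  have "(sqrt (L^2+L'^2))-lipschitz_on (cball x (min r r') \<inter> S) (\<lambda>x. (f x, h x))"
    by (intro lipschitz_on_Pair lipschitz_on_subset[OF r(2)] lipschitz_on_subset[OF r'(2)]) auto
  then show "\<exists>r>0. \<exists>L. L-lipschitz_on (cball x r \<inter> S) (\<lambda>x. (f x, h x))"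
    using r(1) r'(1) by (intro exI[of _ "min r r'"]) auto
qed

lemma locally_lipschitz_compose:
  assumes f: "locally_lipschitz_on f S" and h: "locally_lipschitz_on h T" and "f ` S \<subseteq> T"
  shows "locally_lipschitz_on (\<lambda>x. h (f x)) S"
proof (rule locally_lipschitz_onI)
  fix x assume "x \<in> S"
  obtain r L where r: "r > 0" "L \<ge> 0"
    and L: "\<And>y z. y \<in> S \<Longrightarrow> z \<in> S \<Longrightarrow> dist y x \<le> r \<Longrightarrow> dist z x \<le> r \<Longrightarrow> dist (f y) (f z) \<le> L * dist y z"
    using locally_lipschitz_onE[OF f \<open>x \<in> S\<close>] by blast
  have "f x \<in> T" using assms \<open>x \<in> S\<close> by auto
  obtain r' L' where r': "r' > 0" "L' \<ge> 0"
    and L': "\<And>y z. y \<in> T \<Longrightarrow> z \<in> T \<Longrightarrow> dist y (f x) \<le> r' \<Longrightarrow> dist z (f x) \<le> r' \<Longrightarrow>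
               dist (h y) (h z) \<le> L' * dist y z"
    using locally_lipschitz_onE[OF h \<open>f x \<in> T\<close>] by blast
  define d where "d = min r (r' / (L + 1))"
  have close: "dist (f y) (f x) \<le> r'" if "y \<in> S" "dist y x \<le> d" for y
  proof -
    have "dist (f y) (f x) \<le> L * dist y x"
      using that r \<open>x \<in> S\<close> by (intro L) (auto simp: d_def)
    also have "\<dots> \<le> (L + 1) * dist y x"
      by (simp add: algebra_simps)
    also have "\<dots> \<le> r'"
      using that r by (simp add: d_def field_simps)
    finally show ?thesis .
  qed
  show "\<exists>r>0. \<exists>L\<ge>0. \<forall>y\<in>S. \<forall>z\<in>S. dist y x \<le> r \<longrightarrow> dist z x \<le> r \<longrightarrow>
          dist (h (f y)) (h (f z)) \<le> L * dist y z"
  proof (intro exI conjI ballI impI)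
    show "d > 0" using r r' by (simp add: d_def)
    show "L' * L \<ge> 0" using r r' by simp
    fix y z assume yz: "y \<in> S" "z \<in> S" "dist y x \<le> d" "dist z x \<le> d"
    have "dist (h (f y)) (h (f z)) \<le> L' * dist (f y) (f z)"
      using yz assms(3) close by (intro L') auto
    also have "\<dots> \<le> L' * (L * dist y z)"
      using yz r' by (intro mult_left_mono L) (auto simp: d_def)
    finally show "dist (h (f y)) (h (f z)) \<le> L' * L * dist y z"
      by (simp add: mult.assoc)
  qed
qed

lemma (in bounded_bilinear) locally_lipschitz_prod:
  "locally_lipschitz_on (\<lambda>p. prod (fst p) (snd p)) UNIV"
proof (rule locally_lipschitz_onI)
  fix p :: "'a \<times> 'b"
  obtain K where K: "K > 0" "\<And>a b. norm (prod a b) \<le> norm a * norm b * K"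
    using pos_bounded by blast
  define M where "M = norm p + 1"
  show "\<exists>r>0. \<exists>L\<ge>0. \<forall>y\<in>UNIV. \<forall>z\<in>UNIV. dist y p \<le> r \<longrightarrow> dist z p \<le> r \<longrightarrow>
          dist (prod (fst y) (snd y)) (prod (fst z) (snd z)) \<le> L * dist y z"
  proof (intro exI conjI ballI impI)
    show "(0::real) < 1" by simp
    show "2 * (K * M) \<ge> 0" using K by (auto simp: M_def)
    fix y z assume "dist y p \<le> 1" "dist z p \<le> 1"
    then have "norm y \<le> M" "norm z \<le> M"
      using norm_triangle_ineq2[of y p] norm_triangle_ineq2[of z p]
      by (auto simp: M_def dist_norm)
    then have M: "norm (snd y) \<le> M" "norm (fst z) \<le> M"
      using norm_snd_le[of "snd y" "fst y"] norm_fst_le[of "fst z" "snd z"] by simp_all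
    have d: "norm (fst y - fst z) \<le> dist y z" "norm (snd y - snd z) \<le> dist y z"
      using norm_fst_le[of "fst (y - z)" "snd (y - z)"] norm_snd_le[of "snd (y - z)" "fst (y - z)"]
      by (simp_all add: dist_norm flip: fst_diff snd_diff)
    have "prod (fst y) (snd y) - prod (fst z) (snd z)
            = prod (fst y - fst z) (snd y) + prod (fst z) (snd y - snd z)"
      by (simp add: diff_left diff_right)
    then have "dist (prod (fst y) (snd y)) (prod (fst z) (snd z))
       \<le> norm (prod (fst y - fst z) (snd y)) + norm (prod (fst z) (snd y - snd z))"
      by (metis dist_norm norm_triangle_ineq)
    also have "\<dots> \<le> norm (fst y - fst z) * norm (snd y) * K + norm (fst z) * norm (snd y - snd z) * K"
      by (intro add_mono K)
    also have "\<dots> \<le> dist y z * M * K + M * dist y z * K"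
      using K M d order_trans[OF norm_ge_zero M(1)]
      by (intro add_mono mult_right_mono mult_mono) auto
    finally show "dist (prod (fst y) (snd y)) (prod (fst z) (snd z)) \<le> 2 * (K * M) * dist y z"
      by (simp add: algebra_simps)
  qed
qed

lemma (in bounded_bilinear) locally_lipschitz_bilinear:
  assumes "locally_lipschitz_on f S" "locally_lipschitz_on h S"
  shows "locally_lipschitz_on (\<lambda>x. prod (f x) (h x)) S"
  using locally_lipschitz_compose[OF locally_lipschitz_pair[OF assms] locally_lipschitz_prod] by simp

lemmas locally_lipschitz_mult =
  bounded_bilinear.locally_lipschitz_bilinear[OF bounded_bilinear_mult]
lemmas locally_lipschitz_scaleR =
  bounded_bilinear.locally_lipschitz_bilinear[OF bounded_bilinear_scaleR]

lemma locally_lipschitz_add: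
  fixes f h :: "'a::metric_space \<Rightarrow> 'b::real_normed_vector"
  assumes "locally_lipschitz_on f S" "locally_lipschitz_on h S"
  shows "locally_lipschitz_on (\<lambda>x. f x + h x) S"
proof -
  have "bounded_linear (\<lambda>p::'b \<times> 'b. fst p + snd p)"
    by (intro bounded_linear_add bounded_linear_fst bounded_linear_snd)
  from locally_lipschitz_compose[OF locally_lipschitz_pair[OF assms] bounded_linear.locally_lipschitz[OF this]]
  show ?thesis by auto
qed

lemma locally_lipschitz_minus:
  fixes f :: "'a::metric_space \<Rightarrow> 'b::real_normed_vector"
  assumes "locally_lipschitz_on f S"
  shows "locally_lipschitz_on (\<lambda>x. - f x) S"
  using locally_lipschitz_compose[OF assms bounded_linear.locally_lipschitz[OF bounded_linear_minus[OF bounded_linear_ident]]]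
  by auto

lemma locally_lipschitz_diff:
  fixes f h :: "'a::metric_space \<Rightarrow> 'b::real_normed_vector"
  assumes "locally_lipschitz_on f S" "locally_lipschitz_on h S"
  shows "locally_lipschitz_on (\<lambda>x. f x - h x) S"
  using locally_lipschitz_add[OF assms(1) locally_lipschitz_minus[OF assms(2)]] by simp

lemma locally_lipschitz_sum:
  fixes f :: "'i \<Rightarrow> 'a::metric_space \<Rightarrow> 'b::real_normed_vector"
  assumes "\<And>i. i \<in> I \<Longrightarrow> locally_lipschitz_on (f i) S"
  shows "locally_lipschitz_on (\<lambda>x. \<Sum>i\<in>I. f i x) S"
  using assms
  by (induction I rule: infinite_finite_induct)
     (auto intro: locally_lipschitz_add locally_lipschitz_const)

lemma locally_lipschitz_prod_fun:
  fixes f :: "'i \<Rightarrow> 'a::metric_space \<Rightarrow> real"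
  assumes "\<And>i. i \<in> I \<Longrightarrow> locally_lipschitz_on (f i) S"
  shows "locally_lipschitz_on (\<lambda>x. \<Prod>i\<in>I. f i x) S"
  using assms
  by (induction I rule: infinite_finite_induct)
     (auto intro: locally_lipschitz_mult locally_lipschitz_const)

lemma locally_lipschitz_inverse:
  "locally_lipschitz_on (inverse :: real \<Rightarrow> real) (- {0})"
proof (rule locally_lipschitz_onI)
  fix x :: real assume "x \<in> - {0}"
  then have "x \<noteq> 0" by simp
  define r where "r = \<bar>x\<bar> / 2"
  show "\<exists>r>0. \<exists>L\<ge>0. \<forall>y\<in>- {0}. \<forall>z\<in>- {0}. dist y x \<le> r \<longrightarrow> dist z x \<le> r \<longrightarrow>
            dist (inverse y) (inverse z) \<le> L * dist y z"
  proof (intro exI conjI ballI impI)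
    show "r > 0" using \<open>x \<noteq> 0\<close> by (simp add: r_def)
    show "inverse (r * r) \<ge> 0" using \<open>x \<noteq> 0\<close> by (simp add: r_def)
    fix y z :: real assume yz: "y \<in> - {0}" "z \<in> - {0}" "dist y x \<le> r" "dist z x \<le> r"
    then have r: "\<bar>y\<bar> \<ge> r" "\<bar>z\<bar> \<ge> r" unfolding r_def dist_real_def by (auto simp: abs_if split: if_splits)
    have "inverse y - inverse z = (z - y) * inverse (y * z)"
      using yz by (simp add: field_simps)
    then have "dist (inverse y) (inverse z) = dist y z * inverse (\<bar>y\<bar> * \<bar>z\<bar>)"
      by (simp add: dist_real_def abs_mult abs_minus_commute)
    also have "\<dots> \<le> dist y z * inverse (r * r)"
      using \<open>r > 0\<close> r by (intro mult_left_mono le_imp_inverse_le mult_mono) auto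
    finally show "dist (inverse y) (inverse z) \<le> inverse (r * r) * dist y z"
      by (simp add: mult.commute)
  qed
qed

lemma locally_lipschitz_divide:
  fixes f h :: "'a::metric_space \<Rightarrow> real"
  assumes "locally_lipschitz_on f S" "locally_lipschitz_on h S" "\<And>x. x \<in> S \<Longrightarrow> h x \<noteq> 0"
  shows "locally_lipschitz_on (\<lambda>x. f x / h x) S"
  unfolding divide_inverse
  by (intro locally_lipschitz_mult assms(1) locally_lipschitz_compose[OF assms(2) locally_lipschitz_inverse])
     (use assms(3) in auto)

lemma vec_axis_expansion: "u = (\<Sum>i\<in>UNIV. u $ i *\<^sub>R axis i 1)" for u :: "real ^ 'n"
  using basis_expansion[of u] by (simp add: scalar_mult_eq_scaleR)

lemma linear_axis_expansion:
  fixes D :: "real ^ 'n \<Rightarrow> 'b::real_vector"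
  assumes "linear D"
  shows "D u = (\<Sum>i\<in>UNIV. u $ i *\<^sub>R D (axis i 1))"
proof -
  have "D u = D (\<Sum>i\<in>UNIV. u $ i *\<^sub>R axis i 1)"
    by (rule arg_cong[OF vec_axis_expansion])
  then show ?thesis by (simp only: linear_sum[OF assms] linear_scale[OF assms])
qed

lemma locally_lipschitz_vec_lambda:
  fixes f :: "'a::metric_space \<Rightarrow> 'n::finite \<Rightarrow> real"
  assumes "\<And>i. locally_lipschitz_on (\<lambda>x. f x i) S"
  shows "locally_lipschitz_on (\<lambda>x. \<chi> i. f x i) S"
proof -
  have "(\<chi> i. f x i) = (\<Sum>i\<in>UNIV. f x i *\<^sub>R axis i 1)" for x
    using vec_axis_expansion[of "\<chi> i. f x i"] by simp
  then show ?thesis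
    by (simp add: locally_lipschitz_sum locally_lipschitz_scaleR assms locally_lipschitz_const)
qed

lemma locally_lipschitz_vec_nth:
  fixes f :: "'a::metric_space \<Rightarrow> real ^ 'n"
  assumes "locally_lipschitz_on f S"
  shows "locally_lipschitz_on (\<lambda>x. f x $ i) S"
  using locally_lipschitz_compose[OF assms bounded_linear.locally_lipschitz[OF bounded_linear_vec_nth] subset_UNIV] .

lemma locally_lipschitz_fst: "locally_lipschitz_on f S \<Longrightarrow> locally_lipschitz_on (\<lambda>x. fst (f x :: 'b::real_normed_vector \<times> 'c::real_normed_vector)) S"
  using locally_lipschitz_compose[OF _ bounded_linear.locally_lipschitz[OF bounded_linear_fst]] by blast

lemma locally_lipschitz_snd: "locally_lipschitz_on f S \<Longrightarrow> locally_lipschitz_on (\<lambda>x. snd (f x :: 'b::real_normed_vector \<times> 'c::real_normed_vector)) S"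
  using locally_lipschitz_compose[OF _ bounded_linear.locally_lipschitz[OF bounded_linear_snd]] by blast

lemma locally_lipschitz_det:
  fixes M :: "'a::metric_space \<Rightarrow> real ^ 'n ^ 'n"
  assumes "\<And>i j. locally_lipschitz_on (\<lambda>x. M x $ i $ j) S"
  shows "locally_lipschitz_on (\<lambda>x. det (M x)) S"
  unfolding det_def
  by (intro locally_lipschitz_sum locally_lipschitz_mult locally_lipschitz_prod_fun
      locally_lipschitz_const assms)

lemma matrix_inv_right_of_det:
  fixes M :: "real ^ 'n ^ 'n"
  assumes "det M \<noteq> 0"
  shows "M ** matrix_inv M = mat 1"
  using assms invertible_det_nz[of M] unfolding invertible_def matrix_inv_def
  by (metis (mono_tags, lifting) someI_ex)

text \<open>Cramer's rule writes the entries of the inverse as rational functions of the entries, which is how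
  local Lipschitz continuity passes from the metric coefficients to the Christoffel symbols.\<close>

lemma matrix_inv_cramer:
  fixes M :: "real ^ 'n ^ 'n"
  assumes "det M \<noteq> 0"
  shows "matrix_inv M $ k $ l = det (\<chi> i j. if j = k then axis l 1 $ i else M $ i $ j) / det M"
proof -
  have "M *v (matrix_inv M *v axis l 1) = axis l 1"
    by (simp add: matrix_vector_mul_assoc matrix_inv_right_of_det[OF assms])
  then have "matrix_inv M *v axis l 1 = (\<chi> k. det (\<chi> i j. if j = k then axis l 1 $ i else M $ i $ j) / det M)"
    using cramer[OF assms] by blast
  moreover have "(matrix_inv M *v axis l 1) $ k = matrix_inv M $ k $ l"
    by (simp add: matrix_vector_mult_basis column_def)
  ultimately show ?thesis by simp
qed

lemma locally_lipschitz_matrix_inv: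
  fixes M :: "'a::metric_space \<Rightarrow> real ^ 'n ^ 'n"
  assumes "\<And>i j. locally_lipschitz_on (\<lambda>x. M x $ i $ j) S" "\<And>x. x \<in> S \<Longrightarrow> det (M x) \<noteq> 0"
  shows "locally_lipschitz_on (\<lambda>x. matrix_inv (M x) $ k $ l) S"
proof -
  have "locally_lipschitz_on (\<lambda>x. det (\<chi> i j. if j = k then axis l 1 $ i else M x $ i $ j) / det (M x)) S"
  proof (intro locally_lipschitz_divide locally_lipschitz_det assms)
    show "locally_lipschitz_on (\<lambda>x. (\<chi> i j. if j = k then axis l 1 $ i else M x $ i $ j) $ i $ j) S"
      for i j
      using assms(1) by (cases "j = k") (auto intro: locally_lipschitz_const)
  qed
  then show ?thesis
    by (subst locally_lipschitz_on_cong) (auto simp: matrix_inv_cramer assms(2))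
qed


section \<open>Maps with locally Lipschitz derivatives\<close>

lemma has_frechet_derivative:
  "f differentiable (at x) \<Longrightarrow> (f has_derivative frechet_derivative f (at x)) (at x)"
  by (simp add: frechet_derivative_works)

lemma norm_linear_le_sum_Basis:
  fixes D :: "'a::euclidean_space \<Rightarrow> 'b::real_normed_vector"
  assumes "linear D" and "\<And>b. b \<in> Basis \<Longrightarrow> norm (D b) \<le> B b"
  shows "norm (D u) \<le> (\<Sum>b\<in>Basis. B b) * norm u"
proof -
  have "D u = D (\<Sum>b\<in>Basis. (u \<bullet> b) *\<^sub>R b)"
    by (simp add: euclidean_representation)
  also have "\<dots> = (\<Sum>b\<in>Basis. (u \<bullet> b) *\<^sub>R D b)"
    by (simp add: linear_sum[OF assms(1)] linear_scale[OF assms(1)])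
  finally have "norm (D u) \<le> (\<Sum>b\<in>Basis. norm ((u \<bullet> b) *\<^sub>R D b))"
    by (simp only: norm_sum)
  also have "\<dots> \<le> (\<Sum>b\<in>Basis. norm u * B b)"
    by (intro sum_mono) (auto intro!: mult_mono assms(2) simp: Basis_le_norm)
  also have "\<dots> = (\<Sum>b\<in>Basis. B b) * norm u"
    by (simp add: sum_distrib_left mult.commute)
  finally show ?thesis .
qed

lemma derivative_lipschitz_near:
  fixes f :: "'a::euclidean_space \<Rightarrow> 'b::real_normed_vector"
  assumes f: "Ck1_on 1 f S" and S: "open S" "x \<in> S"
  obtains r K where "r > 0" "K \<ge> 0" "cball x r \<subseteq> S"
    "\<And>y z u. y \<in> cball x r \<Longrightarrow> z \<in> cball x r \<Longrightarrow>
       norm (frechet_derivative f (at y) u - frechet_derivative f (at z) u) \<le> K * dist y z * norm u"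
proof -
  have diff: "\<And>y. y \<in> S \<Longrightarrow> f differentiable (at y)"
    and ll: "\<And>v. locally_lipschitz_on (\<lambda>x. frechet_derivative f (at x) v) S"
    using f by (auto simp: One_nat_def)
  have "\<exists>r L. r > 0 \<and> L \<ge> 0 \<and> (\<forall>y\<in>S. \<forall>z\<in>S. dist y x \<le> r \<longrightarrow> dist z x \<le> r \<longrightarrow>
      dist (frechet_derivative f (at y) b) (frechet_derivative f (at z) b) \<le> L * dist y z)" for b
    using locally_lipschitz_onE[OF ll[of b] S(2)] by metis
  then obtain R L where RL: "\<And>b. R b > 0" "\<And>b. L b \<ge> 0" and
    L: "\<And>b y z. y \<in> S \<Longrightarrow> z \<in> S \<Longrightarrow> dist y x \<le> R b \<Longrightarrow> dist z x \<le> R b \<Longrightarrow>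
      dist (frechet_derivative f (at y) b) (frechet_derivative f (at z) b) \<le> L b * dist y z"
    by metis
  obtain r0 where r0: "r0 > 0" "cball x r0 \<subseteq> S"
    using S open_contains_cball by blast
  define r where "r = Min (insert r0 (R ` Basis))"
  have r: "r > 0" "r \<le> r0" "\<And>b. b \<in> Basis \<Longrightarrow> r \<le> R b"
    using RL r0 by (auto simp: r_def intro!: min.coboundedI2 Min_le)
  have sub: "cball x r \<subseteq> S"
    using r r0 by auto
  show thesis
  proof (rule that[OF r(1) _ sub])
    show "(\<Sum>b\<in>Basis. L b) \<ge> 0" by (simp add: RL sum_nonneg)
    fix y z u assume yz: "y \<in> cball x r" "z \<in> cball x r"
    let ?D = "\<lambda>u. frechet_derivative f (at y) u - frechet_derivative f (at z) u"
    have yzS: "y \<in> S" "z \<in> S" using yz sub by auto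
    have "linear ?D"
      by (intro linear_compose_sub linear_frechet_derivative diff yzS)
    moreover have "norm (?D b) \<le> L b * dist y z" if "b \<in> Basis" for b
      using L[OF yzS, of b] yz r(3)[OF that] by (auto simp: dist_norm dist_commute norm_minus_commute)
    ultimately have "norm (?D u) \<le> (\<Sum>b\<in>Basis. L b * dist y z) * norm u"
      by (rule norm_linear_le_sum_Basis)
    then show "norm (?D u) \<le> (\<Sum>b\<in>Basis. L b) * dist y z * norm u"
      by (simp add: sum_distrib_right)
  qed
qed

text \<open>A Lipschitz derivative turns first-order Taylor expansions into expansions with a quadratic
  remainder that is uniform in the base point; this uniformity is what survives integration along
  a geodesic.\<close>

lemma Ck1_quadratic_remainder:
  fixes f :: "'a::euclidean_space \<Rightarrow> 'b::real_normed_vector"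
  assumes f: "Ck1_on 1 f S" and S: "open S" "x \<in> S"
  obtains r K where "r > 0" "K \<ge> 0" "cball x r \<subseteq> S"
    "\<And>y z. y \<in> cball x r \<Longrightarrow> z \<in> cball x r \<Longrightarrow>
       norm (f z - f y - frechet_derivative f (at y) (z - y)) \<le> K * (norm (z - y))\<^sup>2"
proof -
  have diff: "\<And>y. y \<in> S \<Longrightarrow> f differentiable (at y)"
    using f by (auto simp: One_nat_def)
  obtain r K where r: "r > 0" "K \<ge> 0" "cball x r \<subseteq> S" and
    K: "\<And>y z u. y \<in> cball x r \<Longrightarrow> z \<in> cball x r \<Longrightarrow>
       norm (frechet_derivative f (at y) u - frechet_derivative f (at z) u) \<le> K * dist y z * norm u"
    using derivative_lipschitz_near[OF f S] by metis
  show thesis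
  proof (rule that[OF r])
    fix y z assume yz: "y \<in> cball x r" "z \<in> cball x r"
    let ?C = "closed_segment y z"
    have sub: "?C \<subseteq> cball x r"
      using yz by (simp add: closed_segment_subset)
    have "norm (f z - f y - frechet_derivative f (at y) (z - y)) \<le> norm (z - y) * (K * norm (z - y))"
    proof (rule differentiable_bound_linearization[where S = ?C and f' = "\<lambda>w. frechet_derivative f (at w)"])
      show "y + t *\<^sub>R (z - y) \<in> ?C" if "t \<in> {0..1}" for t
        using that by (auto simp: closed_segment_def algebra_simps intro!: exI[of _ t])
      show "(f has_derivative frechet_derivative f (at w)) (at w within ?C)" if "w \<in> ?C" for w
        using that sub r(3) by (intro has_derivative_at_withinI[OF has_frechet_derivative[OF diff]]) auto
      fix w assume w: "w \<in> ?C"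
      show "onorm (frechet_derivative f (at w) - frechet_derivative f (at y)) \<le> K * norm (z - y)"
      proof (rule onorm_le)
        fix u
        have "norm ((frechet_derivative f (at w) - frechet_derivative f (at y)) u) \<le> K * dist w y * norm u"
          using K[of w y u] w sub yz by (auto simp: fun_diff_def)
        also have "\<dots> \<le> K * norm (z - y) * norm u"
          using w r(2) segment_bound1[of w y z]
          by (intro mult_right_mono mult_left_mono) (auto simp: dist_norm norm_minus_commute)
        finally show "norm ((frechet_derivative f (at w) - frechet_derivative f (at y)) u) \<le> K * norm (z - y) * norm u" .
      qed
    qed auto
    then show "norm (f z - f y - frechet_derivative f (at y) (z - y)) \<le> K * (norm (z - y))\<^sup>2"
      by (simp add: power2_eq_square algebra_simps)
  qed
qed

lemma Ck1_imp_locally_lipschitz: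
  fixes f :: "'a::euclidean_space \<Rightarrow> 'b::real_normed_vector"
  assumes f: "Ck1_on 1 f S" and S: "open S"
  shows "locally_lipschitz_on f S"
proof (rule locally_lipschitz_onI)
  fix x assume x: "x \<in> S"
  have diff: "\<And>y. y \<in> S \<Longrightarrow> f differentiable (at y)"
    using f by (auto simp: One_nat_def)
  obtain r K where r: "r > 0" "K \<ge> 0" "cball x r \<subseteq> S" and
    K: "\<And>y z u. y \<in> cball x r \<Longrightarrow> z \<in> cball x r \<Longrightarrow>
       norm (frechet_derivative f (at y) u - frechet_derivative f (at z) u) \<le> K * dist y z * norm u"
    using derivative_lipschitz_near[OF f S x] by metis
  obtain B where B: "B \<ge> 0" "\<And>u. norm (frechet_derivative f (at x) u) \<le> B * norm u"
    using has_derivative_bounded_linear[OF has_frechet_derivative[OF diff[OF x]]]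
      bounded_linear.nonneg_bounded by (metis mult.commute)
  show "\<exists>r>0. \<exists>L\<ge>0. \<forall>y\<in>S. \<forall>z\<in>S. dist y x \<le> r \<longrightarrow> dist z x \<le> r \<longrightarrow> dist (f y) (f z) \<le> L * dist y z"
  proof (intro exI conjI ballI impI)
    show "r > 0" by fact
    show "K * r + B \<ge> 0" using r B by simp
    fix y z assume "dist y x \<le> r" "dist z x \<le> r"
    then have yz: "y \<in> cball x r" "z \<in> cball x r" by (auto simp: dist_commute)
    have "norm (f y - f z) \<le> (K * r + B) * norm (y - z)"
    proof (rule differentiable_bound[where S = "cball x r" and f' = "\<lambda>w. frechet_derivative f (at w)"])
      show "(f has_derivative frechet_derivative f (at w)) (at w within cball x r)" if "w \<in> cball x r" for w
        using that r(3) by (intro has_derivative_at_withinI[OF has_frechet_derivative[OF diff]]) auto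
      fix w assume w: "w \<in> cball x r"
      show "onorm (frechet_derivative f (at w)) \<le> K * r + B"
      proof (rule onorm_le)
        fix u
        have "norm (frechet_derivative f (at w) u)
            \<le> norm (frechet_derivative f (at w) u - frechet_derivative f (at x) u) + norm (frechet_derivative f (at x) u)"
          by (metis diff_add_cancel norm_triangle_ineq)
        also have "\<dots> \<le> K * dist w x * norm u + B * norm u"
          using w r by (intro add_mono K B) auto
        also have "\<dots> \<le> K * r * norm u + B * norm u"
          using w r by (intro add_mono mult_right_mono mult_left_mono) (auto simp: dist_commute)
        finally show "norm (frechet_derivative f (at w) u) \<le> (K * r + B) * norm u"
          by (simp add: algebra_simps)
      qed
    qed (use yz in auto)
    then show "dist (f y) (f z) \<le> (K * r + B) * dist y z"
      by (simp add: dist_norm)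
  qed
qed


section \<open>Comparison of solutions of an autonomous ordinary differential equation\<close>

lemma first_time_at_least:
  fixes f :: "real \<Rightarrow> real"
  assumes f: "continuous_on {a..b} f" and s: "s \<in> {a..b}" "r \<le> f s"
  obtains m where "m \<in> {a..b}" "r \<le> f m" "\<And>u. a \<le> u \<Longrightarrow> u < m \<Longrightarrow> f u < r"
proof -
  define X where "X = {u \<in> {a..b}. r \<le> f u}"
  have "closed X"
    unfolding X_def using continuous_closed_preimage[OF f closed_atLeastAtMost closed_atLeast[of r]]
    by (simp add: vimage_def Int_def)
  moreover have "bounded X"
    by (rule bounded_subset[of "{a..b}"]) (auto simp: X_def)
  ultimately have "compact X"
    by (simp add: compact_eq_bounded_closed)
  then obtain m where m: "m \<in> X" "\<And>u. u \<in> X \<Longrightarrow> m \<le> u"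
    using compact_attains_inf[of X] s by (auto simp: X_def)
  show thesis
  proof (rule that)
    show "m \<in> {a..b}" "r \<le> f m" using m(1) by (auto simp: X_def)
    fix u assume u: "a \<le> u" "u < m"
    then have "u \<notin> X" using m(2)[of u] by auto
    then show "f u < r" using u \<open>m \<in> {a..b}\<close> by (auto simp: X_def)
  qed
qed

text \<open>The squared distance of the two solutions, divided by \<open>exp (2 K t)\<close>, is nonincreasing as long as
  the second solution has not left the set on which the field is Lipschitz.\<close>

lemma gronwall_while_inside:
  fixes z1 z2 :: "real \<Rightarrow> 'a::real_inner"
  assumes F: "K-lipschitz_on B F"
    and z1: "\<And>t. t \<in> {a..b} \<Longrightarrow> (z1 has_vector_derivative F (z1 t)) (at t within {a..b})"
    and z2: "\<And>t. t \<in> {a..b} \<Longrightarrow> (z2 has_vector_derivative F (z2 t)) (at t within {a..b})"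
    and in1: "\<And>t. t \<in> {a..b} \<Longrightarrow> z1 t \<in> B"
    and in2: "\<And>t. a \<le> t \<Longrightarrow> t < b \<Longrightarrow> z2 t \<in> B"
    and ab: "a \<le> b"
  shows "dist (z2 b) (z1 b) \<le> dist (z2 a) (z1 a) * exp (K * (b - a))"
proof (cases "a = b")
  case True then show ?thesis by simp
next
  case False
  with ab have "a < b" by simp
  define w where "w t = z2 t - z1 t" for t
  define p where "p t = (w t \<bullet> w t) * exp (- 2 * K * t)" for t
  have w: "(w has_vector_derivative (F (z2 t) - F (z1 t))) (at t within {a..b})" if "t \<in> {a..b}" for t
    unfolding w_def using that by (intro has_vector_derivative_diff z1 z2)
  have "continuous_on {a..b} w"
    by (rule continuous_on_vector_derivative) (rule w)
  then have cont: "continuous_on {a..b} p"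
    unfolding p_def by (intro continuous_intros)
  have "p b \<le> p a"
  proof (rule DERIV_nonpos_imp_decreasing_open[OF ab _ cont])
    fix t assume t: "a < t" "t < b"
    then have "(w has_vector_derivative (F (z2 t) - F (z1 t))) (at t)"
      using w[of t] by (simp add: at_within_Icc_at)
    then have dw: "(w has_derivative (\<lambda>h. h *\<^sub>R (F (z2 t) - F (z1 t)))) (at t)"
      by (simp add: has_vector_derivative_def)
    have "((\<lambda>t. w t \<bullet> w t) has_derivative (\<lambda>h. w t \<bullet> (h *\<^sub>R (F (z2 t) - F (z1 t))) + (h *\<^sub>R (F (z2 t) - F (z1 t))) \<bullet> w t)) (at t)"
      by (rule has_derivative_inner[OF dw dw])
    then have "((\<lambda>t. w t \<bullet> w t) has_real_derivative 2 * (w t \<bullet> (F (z2 t) - F (z1 t)))) (at t)"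
      by (auto simp: has_field_derivative_def inner_commute algebra_simps elim!: has_derivative_eq_rhs)
    then have "(p has_real_derivative
        (2 * (w t \<bullet> (F (z2 t) - F (z1 t))) - 2 * K * (w t \<bullet> w t)) * exp (- 2 * K * t)) (at t)"
      unfolding p_def by (auto intro!: derivative_eq_intros simp: algebra_simps)
    moreover have "w t \<bullet> (F (z2 t) - F (z1 t)) \<le> K * (w t \<bullet> w t)"
    proof -
      have "w t \<bullet> (F (z2 t) - F (z1 t)) \<le> norm (w t) * norm (F (z2 t) - F (z1 t))"
        by (rule norm_cauchy_schwarz)
      also have "\<dots> \<le> norm (w t) * (K * norm (w t))"
        using lipschitz_onD[OF F in2 in1, of t t] t
        by (intro mult_left_mono) (auto simp: w_def dist_norm)
      finally show ?thesis by (simp add: dot_square_norm power2_eq_square algebra_simps)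
    qed
    ultimately show "\<exists>y. (p has_real_derivative y) (at t) \<and> y \<le> 0"
      by (intro exI conjI) (auto intro!: mult_nonpos_nonneg)
  qed
  then have "(w b \<bullet> w b) * exp (- 2 * K * b) * exp (2 * K * b) \<le> (w a \<bullet> w a) * exp (- 2 * K * a) * exp (2 * K * b)"
    unfolding p_def by (intro mult_right_mono) auto
  moreover have "exp (- 2 * K * b) * exp (2 * K * b) = 1"
    "exp (- 2 * K * a) * exp (2 * K * b) = exp (K * (b - a)) ^ 2"
    by (simp_all add: mult_exp_exp exp_double[symmetric] algebra_simps flip: exp_minus)
  ultimately have "(w b \<bullet> w b) * 1 \<le> (w a \<bullet> w a) * (exp (K * (b - a)))\<^sup>2"
    by (simp only: mult.assoc)
  then have "(norm (w b))\<^sup>2 \<le> (norm (w a) * exp (K * (b - a)))\<^sup>2"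
    by (simp add: dot_square_norm power_mult_distrib)
  then have "norm (w b) \<le> norm (w a) * exp (K * (b - a))"
    by (rule power2_le_imp_le) simp
  then show ?thesis by (simp add: w_def dist_norm)
qed

text \<open>Only the first solution is assumed to stay in the ball. At the first time when the distance of the
  solutions reached \<open>r\<close>, the Gronwall estimate up to that time would contradict the smallness of the
  initial distance, so the second solution cannot leave the larger ball.\<close>

lemma ode_comparison:
  fixes z1 z2 :: "real \<Rightarrow> 'a::real_inner"
  assumes F: "K-lipschitz_on (cball p (2 * r)) F"
    and z1: "\<And>t. t \<in> {a..b} \<Longrightarrow> (z1 has_vector_derivative F (z1 t)) (at t within {a..b})"
    and z2: "\<And>t. t \<in> {a..b} \<Longrightarrow> (z2 has_vector_derivative F (z2 t)) (at t within {a..b})"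
    and in1: "\<And>t. t \<in> {a..b} \<Longrightarrow> z1 t \<in> cball p r"
    and small: "dist (z2 a) (z1 a) * exp (K * (b - a)) < r"
    and t: "t \<in> {a..b}"
  shows "dist (z2 t) (z1 t) \<le> dist (z2 a) (z1 a) * exp (K * (b - a))"
proof -
  have K: "K \<ge> 0" using F by (rule lipschitz_on_nonneg)
  let ?d = "\<lambda>t. dist (z2 t) (z1 t)"
  have cont: "continuous_on {a..b} ?d"
    by (intro continuous_intros continuous_on_vector_derivative[OF z1] continuous_on_vector_derivative[OF z2])
  have "0 \<le> ?d a * exp (K * (b - a))" by simp
  then have r: "r > 0" using small by linarith
  have bound: "?d s \<le> ?d a * exp (K * (b - a))" if s: "s \<in> {a..b}" and ins: "\<And>u. a \<le> u \<Longrightarrow> u < s \<Longrightarrow> ?d u < r" for s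
  proof -
    have "?d s \<le> ?d a * exp (K * (s - a))"
    proof (rule gronwall_while_inside[OF F])
      show "z1 t \<in> cball p (2 * r)" if "t \<in> {a..s}" for t
        using in1[of t] that s r by auto
      show "z2 t \<in> cball p (2 * r)" if "a \<le> t" "t < s" for t
        using in1[of t] ins[OF that] that s dist_triangle[of p "z2 t" "z1 t"] by (auto simp: dist_commute)
      show "(z1 has_vector_derivative F (z1 t)) (at t within {a..s})" if "t \<in> {a..s}" for t
        using that s by (intro has_vector_derivative_within_subset[OF z1]) auto
      show "(z2 has_vector_derivative F (z2 t)) (at t within {a..s})" if "t \<in> {a..s}" for t
        using that s by (intro has_vector_derivative_within_subset[OF z2]) auto
    qed (use s in auto)
    also have "\<dots> \<le> ?d a * exp (K * (b - a))"
      using s K by (intro mult_left_mono) (auto intro!: mult_left_mono)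
    finally show ?thesis .
  qed
  have "?d s < r" if "s \<in> {a..b}" for s
  proof (rule ccontr)
    assume "\<not> ?d s < r"
    then obtain m where m: "m \<in> {a..b}" "r \<le> ?d m" "\<And>u. a \<le> u \<Longrightarrow> u < m \<Longrightarrow> ?d u < r"
      using first_time_at_least[OF cont \<open>s \<in> {a..b}\<close>] by (metis linorder_not_less)
    have "?d m \<le> ?d a * exp (K * (b - a))"
      using m(1,3) by (rule bound)
    with small m(2) show False by simp
  qed
  then show ?thesis using t by (intro bound) auto
qed


section \<open>Minkowski space\<close>

text \<open>The form \<open>a \<bullet> b - 2 * (a $ k * b $ k)\<close> is the Minkowski product with time axis \<open>k\<close>.
  Splitting off the time components, the Cauchy-Schwarz inequality for the space components shows
  that the product is dominated by \<open>a $ k * b $ k\<close>.\<close>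

lemma minkowski_product_sign:
  fixes a b :: "real ^ 'n"
  assumes a: "a \<bullet> a < 2 * (a $ k * a $ k)" and b: "b \<bullet> b \<le> 2 * (b $ k * b $ k)" and "b \<noteq> 0"
  shows "(a \<bullet> b - 2 * (a $ k * b $ k)) * (a $ k * b $ k) < 0"
proof -
  define a' b' where "a' = a - axis k (a $ k)" and "b' = b - axis k (b $ k)"
  have split: "(x - axis k (x $ k)) \<bullet> (y - axis k (y $ k)) = x \<bullet> y - x $ k * y $ k" for x y :: "real ^ 'n"
    by (simp add: inner_diff_left inner_diff_right inner_axis inner_axis')
  have "(norm a')\<^sup>2 < \<bar>a $ k\<bar>\<^sup>2" "(norm b')\<^sup>2 \<le> \<bar>b $ k\<bar>\<^sup>2"
    using a b split[of a a] split[of b b]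
    unfolding a'_def b'_def power2_norm_eq_inner power2_abs by (simp_all add: power2_eq_square)
  then have na: "norm a' < \<bar>a $ k\<bar>" and nb: "norm b' \<le> \<bar>b $ k\<bar>"
    using power2_less_imp_less power2_le_imp_le abs_ge_zero by blast+
  have "b $ k \<noteq> 0"
  proof
    assume "b $ k = 0"
    then have "b \<bullet> b \<le> 0" using b by simp
    then show False using \<open>b \<noteq> 0\<close> by (metis inner_eq_zero_iff inner_ge_zero order_antisym)
  qed
  define p where "p = a $ k * b $ k"
  have "\<bar>a' \<bullet> b'\<bar> \<le> norm a' * norm b'"
    by (rule Cauchy_Schwarz_ineq2)
  also have "\<dots> \<le> norm a' * \<bar>b $ k\<bar>"
    using nb by (intro mult_left_mono) auto
  also have "\<dots> < \<bar>p\<bar>"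
    using na \<open>b $ k \<noteq> 0\<close> by (simp add: p_def abs_mult)
  finally have *: "\<bar>a' \<bullet> b'\<bar> < \<bar>p\<bar>" .
  have "a \<bullet> b - 2 * (a $ k * b $ k) = a' \<bullet> b' - p"
    using split[of a b] by (simp add: a'_def b'_def p_def)
  moreover have "(a' \<bullet> b' - p) * p < 0"
    using * by (auto simp: mult_less_0_iff abs_if split: if_splits)
  ultimately show ?thesis by (simp add: p_def)
qed


section \<open>Charts and tangent vectors\<close>

locale spacetime =
  fixes A :: "('m::t2_space, 'n::finite) chart set"
    and g :: "('m, 'n) metric_field"
  assumes atlas: "C21_atlas A" and metric: "C11_lorentzian_metric A g"
begin

abbreviation "TM \<equiv> tangent_space A"

abbreviation "trans_deriv c d x \<equiv> frechet_derivative (transition c d) (at x)"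

lemma chart: "c \<in> A \<Longrightarrow> is_chart c"
  using atlas by (auto simp: C21_atlas_def)

lemma chart_at: obtains c where "c \<in> A" "q \<in> fst c"
  using atlas unfolding C21_atlas_def by blast

lemma chart_open: "c \<in> A \<Longrightarrow> open (fst c)" "c \<in> A \<Longrightarrow> open (snd c ` fst c)"
  using chart by (auto simp: is_chart_def)

lemma chart_inv_coord [simp]: "c \<in> A \<Longrightarrow> q \<in> fst c \<Longrightarrow> chart_inv c (snd c q) = q"
  using chart unfolding is_chart_def by (blast dest: homeomorphism_apply1)

lemma chart_continuous: "c \<in> A \<Longrightarrow> continuous_on (fst c) (snd c)"
  using chart by (auto simp: is_chart_def homeomorphism_def)

lemma chart_inv_continuous: "c \<in> A \<Longrightarrow> continuous_on (snd c ` fst c) (chart_inv c)"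
  using chart by (auto simp: is_chart_def homeomorphism_def)

lemma chart_overlap_open:
  assumes "c \<in> A" "d \<in> A"
  shows "open (snd c ` (fst c \<inter> fst d))"
proof -
  have "snd c ` (fst c \<inter> fst d) = snd c ` fst c \<inter> chart_inv c -` fst d"
    using assms by auto
  then show ?thesis
    using continuous_open_preimage[OF chart_inv_continuous[OF assms(1)] chart_open(2)[OF assms(1)] chart_open(1)[OF assms(2)]]
    by simp
qed

lemma transition_Ck1:
  assumes "c \<in> A" "d \<in> A"
  shows "Ck1_on 1 (transition c d) (snd c ` (fst c \<inter> fst d))"
    and "Ck1_on 1 (\<lambda>x. trans_deriv c d x u) (snd c ` (fst c \<inter> fst d))"
proof -
  have C: "Ck1_on (Suc 1) (transition c d) (snd c ` (fst c \<inter> fst d))"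
    using atlas assms unfolding C21_atlas_def by (metis Suc_1)
  then show 1: "Ck1_on 1 (\<lambda>x. trans_deriv c d x u) (snd c ` (fst c \<inter> fst d))" for u
    by (simp only: Ck1_on.simps)
  show "Ck1_on 1 (transition c d) (snd c ` (fst c \<inter> fst d))"
    unfolding One_nat_def Ck1_on.simps
    using C Ck1_imp_locally_lipschitz[OF 1 chart_overlap_open[OF assms]]
    by (auto simp only: Ck1_on.simps(2) Ck1_on.simps(1))
qed

lemma transition_has_derivative:
  assumes "c \<in> A" "d \<in> A" "q \<in> fst c" "q \<in> fst d"
  shows "(transition c d has_derivative trans_deriv c d (snd c q)) (at (snd c q))"
  using transition_Ck1(1)[OF assms(1,2)] assms(3,4)
  by (intro has_frechet_derivative) (auto simp: One_nat_def)

lemma trans_deriv_linear: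
  assumes "c \<in> A" "d \<in> A" "q \<in> fst c" "q \<in> fst d"
  shows "linear (trans_deriv c d (snd c q))"
  using transition_has_derivative[OF assms] has_derivative_linear by blast

text \<open>The chain rule makes the transformation law of tangent vectors consistent, so that a vector may be
  prescribed by its components in any one chart.\<close>

lemma trans_deriv_compose:
  assumes "c \<in> A" "d \<in> A" "e \<in> A" "q \<in> fst c" "q \<in> fst d" "q \<in> fst e"
  shows "trans_deriv d e (snd d q) (trans_deriv c d (snd c q) u) = trans_deriv c e (snd c q) u"
proof -
  let ?U = "snd c ` (fst c \<inter> fst d) \<inter> snd c ` (fst c \<inter> fst e)"
  have "(transition d e has_derivative trans_deriv d e (snd d q)) (at (transition c d (snd c q)))"
    using transition_has_derivative[OF assms(2,3,5,6)] assms by simp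
  from has_derivative_compose[OF transition_has_derivative[OF assms(1,2,4,5)] this]
  have "((\<lambda>x. transition d e (transition c d x)) has_derivative
      (\<lambda>u. trans_deriv d e (snd d q) (trans_deriv c d (snd c q) u))) (at (snd c q))" .
  moreover have "open ?U"
    by (intro open_Int chart_overlap_open assms)
  moreover have "snd c q \<in> ?U" using assms by auto
  moreover have "transition d e (transition c d x) = transition c e x" if "x \<in> ?U" for x
  proof -
    obtain y where y: "x = snd c y" "y \<in> fst c" "y \<in> fst d" using \<open>x \<in> ?U\<close> by auto
    then show ?thesis using assms by simp
  qed
  ultimately have "(transition c e has_derivative
      (\<lambda>u. trans_deriv d e (snd d q) (trans_deriv c d (snd c q) u))) (at (snd c q))"
    by (rule has_derivative_transform_within_open)
  from has_derivative_unique[OF this transition_has_derivative[OF assms(1,3,4,6)]]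
  show ?thesis by metis
qed

lemma trans_deriv_self:
  assumes "c \<in> A" "q \<in> fst c"
  shows "trans_deriv c c (snd c q) u = u"
proof -
  have "(transition c c has_derivative (\<lambda>u. u)) (at (snd c q))"
    by (rule has_derivative_transform_within_open[OF has_derivative_ident chart_open(2)[OF assms(1)]])
       (use assms in auto)
  from has_derivative_unique[OF this transition_has_derivative[OF assms(1,1,2,2)]]
  show ?thesis by metis
qed

lemma coord_vec_tangent:
  assumes "c \<in> A" "q \<in> fst c"
  shows "coord_vec A c q u \<in> TM q"
  unfolding tangent_space_def coord_vec_def mem_Collect_eq
proof (intro conjI ballI allI impI)
  fix d e assume "d \<in> A" "e \<in> A" and q: "q \<in> fst d \<and> q \<in> fst e"
  then show "(if e \<in> A \<and> q \<in> fst e then trans_deriv c e (snd c q) u else 0)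
      = trans_deriv d e (snd d q) (if d \<in> A \<and> q \<in> fst d then trans_deriv c d (snd c q) u else 0)"
    using trans_deriv_compose[of c d e q u] assms by (simp only: if_True simp_thms)
qed auto

lemma coord_vec_coord [simp]: "c \<in> A \<Longrightarrow> q \<in> fst c \<Longrightarrow> coord_vec A c q u c = u"
  by (simp add: coord_vec_def trans_deriv_self)

lemma tangent_transform:
  "v \<in> TM q \<Longrightarrow> c \<in> A \<Longrightarrow> d \<in> A \<Longrightarrow> q \<in> fst c \<Longrightarrow> q \<in> fst d \<Longrightarrow> v d = trans_deriv c d (snd c q) (v c)"
  unfolding tangent_space_def by blast

lemma coord_vec_of_coord:
  assumes "v \<in> TM q" "c \<in> A" "q \<in> fst c"
  shows "coord_vec A c q (v c) = v"
proof
  fix d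
  show "coord_vec A c q (v c) d = v d"
  proof (cases "d \<in> A \<and> q \<in> fst d")
    case True
    then show ?thesis using tangent_transform[OF assms(1,2), of d] assms(3) by (simp add: coord_vec_def)
  next
    case False
    then have "v d = 0" using assms(1) unfolding tangent_space_def by blast
    then show ?thesis using False by (auto simp: coord_vec_def)
  qed
qed

lemma tangent_eqI:
  "v \<in> TM q \<Longrightarrow> w \<in> TM q \<Longrightarrow> c \<in> A \<Longrightarrow> q \<in> fst c \<Longrightarrow> v c = w c \<Longrightarrow> v = w"
  by (metis coord_vec_of_coord)

lemma coord_vec_linear:
  assumes "c \<in> A" "q \<in> fst c"
  shows "coord_vec A c q (r *\<^sub>R u + s *\<^sub>R w) = (\<lambda>d. r *\<^sub>R coord_vec A c q u d + s *\<^sub>R coord_vec A c q w d)"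
  using trans_deriv_linear[OF assms(1) _ assms(2)]
  by (auto simp: coord_vec_def fun_eq_iff linear_add linear_scale)

lemma tangent_combination:
  assumes "u \<in> TM q" "w \<in> TM q"
  shows "(\<lambda>c. r *\<^sub>R u c + s *\<^sub>R w c) \<in> TM q"
proof -
  obtain c where c: "c \<in> A" "q \<in> fst c" by (rule chart_at)
  then show ?thesis
    using coord_vec_tangent[OF c, of "r *\<^sub>R u c + s *\<^sub>R w c"] assms
    by (simp add: coord_vec_linear coord_vec_of_coord)
qed

lemma tangent_scale: "v \<in> TM q \<Longrightarrow> (\<lambda>c. s *\<^sub>R v c) \<in> TM q"
  using tangent_combination[of v q v s 0] by simp

lemma tangent_zero: "(\<lambda>_. 0) \<in> TM q"
proof -
  obtain c where c: "c \<in> A" "q \<in> fst c" by (rule chart_at)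
  show ?thesis using tangent_scale[OF coord_vec_tangent[OF c], where s = 0] by simp
qed

lemma tangent_minus: "v \<in> TM q \<Longrightarrow> (\<lambda>c. - v c) \<in> TM q"
  using tangent_scale[of v q "-1"] by simp

section \<open>The metric in coordinates\<close>

definition coord_metric where
  "coord_metric c x u w = (\<Sum>i\<in>UNIV. \<Sum>j\<in>UNIV. metric_coeff A g c x i j * u $ i * w $ j)"

definition gram :: "('m, 'n) chart \<Rightarrow> real ^ 'n \<Rightarrow> real ^ 'n ^ 'n" where
  "gram c x = (\<chi> i j. metric_coeff A g c x i j)"

lemma g_sym: "v \<in> TM q \<Longrightarrow> w \<in> TM q \<Longrightarrow> g q v w = g q w v"
  using metric unfolding C11_lorentzian_metric_def lorentzian_form_def by blast

lemma g_combination_left: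
  "u \<in> TM q \<Longrightarrow> v \<in> TM q \<Longrightarrow> w \<in> TM q \<Longrightarrow>
    g q (\<lambda>c. r *\<^sub>R u c + s *\<^sub>R v c) w = r * g q u w + s * g q v w"
  using metric unfolding C11_lorentzian_metric_def lorentzian_form_def by blast

lemma g_scale_left: "u \<in> TM q \<Longrightarrow> w \<in> TM q \<Longrightarrow> g q (\<lambda>c. r *\<^sub>R u c) w = r * g q u w"
  using g_combination_left[of u q u w r 0] by simp

lemma g_minus_left: "u \<in> TM q \<Longrightarrow> w \<in> TM q \<Longrightarrow> g q (\<lambda>c. - u c) w = - g q u w"
  using g_scale_left[of u q w "-1"] by simp

lemma g_scale_right: "u \<in> TM q \<Longrightarrow> w \<in> TM q \<Longrightarrow> g q w (\<lambda>c. r *\<^sub>R u c) = r * g q w u"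
  by (metis g_scale_left g_sym tangent_scale)

lemma g_minus_right: "u \<in> TM q \<Longrightarrow> w \<in> TM q \<Longrightarrow> g q w (\<lambda>c. - u c) = - g q w u"
  using g_scale_right[of u q w "-1"] by simp

lemma g_coord:
  assumes v: "v \<in> TM q" and w: "w \<in> TM q" and c: "c \<in> A" "q \<in> fst c"
  shows "g q v w = coord_metric c (snd c q) (v c) (w c)"
proof -
  let ?e = "coord_vec A c q"
  have lin: "linear (\<lambda>u. g q (?e u) z)" if "z \<in> TM q" for z
  proof (rule linearI)
    show "g q (?e (x + y)) z = g q (?e x) z + g q (?e y) z" for x y
      using coord_vec_linear[OF c, of 1 x 1 y] g_combination_left[OF coord_vec_tangent[OF c] coord_vec_tangent[OF c] that, of 1 x 1 y]
      by simp
    show "g q (?e (r *\<^sub>R x)) z = r *\<^sub>R g q (?e x) z" for r x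
      using coord_vec_linear[OF c, of r x 0 x] g_combination_left[OF coord_vec_tangent[OF c] coord_vec_tangent[OF c] that, of r x 0 x]
      by simp
  qed
  have expand: "g q (?e u) z = (\<Sum>i\<in>UNIV. u $ i * g q (?e (axis i 1)) z)" if "z \<in> TM q" for u z
    using linear_axis_expansion[OF lin[OF that], of u] by simp
  have "g q v w = g q (?e (v c)) (?e (w c))"
    by (simp add: coord_vec_of_coord v w c)
  also have "\<dots> = (\<Sum>i\<in>UNIV. v c $ i * g q (?e (axis i 1)) (?e (w c)))"
    by (rule expand[OF coord_vec_tangent[OF c]])
  also have "\<dots> = (\<Sum>i\<in>UNIV. v c $ i * g q (?e (w c)) (?e (axis i 1)))"
    by (intro sum.cong refl) (simp add: g_sym coord_vec_tangent c)
  also have "\<dots> = (\<Sum>i\<in>UNIV. v c $ i * (\<Sum>j\<in>UNIV. w c $ j * g q (?e (axis j 1)) (?e (axis i 1))))"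
    by (subst expand[OF coord_vec_tangent[OF c], of "w c"]) (rule refl)
  also have "\<dots> = (\<Sum>i\<in>UNIV. v c $ i * (\<Sum>j\<in>UNIV. w c $ j * g q (?e (axis i 1)) (?e (axis j 1))))"
    by (intro sum.cong refl arg_cong2[where f = "(*)"]) (simp add: g_sym coord_vec_tangent c)
  finally show ?thesis
    using c by (simp add: coord_metric_def metric_coeff_def sum_distrib_left mult_ac)
qed

lemma metric_coeff_sym:
  assumes "c \<in> A" "x \<in> snd c ` fst c"
  shows "metric_coeff A g c x i j = metric_coeff A g c x j i"
  using assms unfolding metric_coeff_def by (auto intro!: g_sym coord_vec_tangent)

lemma metric_coeff_Ck1: "c \<in> A \<Longrightarrow> Ck1_on 1 (\<lambda>x. metric_coeff A g c x i j) (snd c ` fst c)"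
  using metric by (auto simp: C11_lorentzian_metric_def)

lemma metric_coeff_locally_lipschitz:
  "c \<in> A \<Longrightarrow> locally_lipschitz_on (\<lambda>x. metric_coeff A g c x i j) (snd c ` fst c)"
  by (intro Ck1_imp_locally_lipschitz metric_coeff_Ck1 chart_open)

lemma coord_metric_sym:
  assumes "c \<in> A" "x \<in> snd c ` fst c"
  shows "coord_metric c x u w = coord_metric c x w u"
proof -
  have "coord_metric c x u w = (\<Sum>i\<in>UNIV. \<Sum>j\<in>UNIV. metric_coeff A g c x j i * u $ i * w $ j)"
    unfolding coord_metric_def by (intro sum.cong refl) (metis metric_coeff_sym[OF assms])
  also have "\<dots> = coord_metric c x w u"
    unfolding coord_metric_def by (subst sum.swap) (simp add: mult_ac)
  finally show ?thesis .
qed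

lemma coord_metric_bilinear: "bounded_bilinear (coord_metric c x)"
  unfolding coord_metric_def
  by (intro bilinear_conv_bounded_bilinear[THEN iffD1])
     (auto simp: bilinear_def intro!: linearI simp: algebra_simps sum.distrib sum_distrib_left)

lemma coord_metric_gram: "coord_metric c x u w = u \<bullet> (gram c x *v w)"
  by (simp add: coord_metric_def gram_def inner_vec_def matrix_vector_mult_def sum_distrib_left mult_ac)

text \<open>An orthonormal frame identifies each tangent space with Minkowski space. That the frame is a
  basis and that the matrix of the metric is invertible both follow from the determinant of
  \<open>E\<^sup>T G E = diag (-1, 1, \<dots>, 1)\<close>.\<close>

lemma orthonormal_frame:
  assumes c: "c \<in> A" "q \<in> fst c"
  obtains k :: 'n and E :: "real ^ 'n ^ 'n" where
    "det E \<noteq> 0" "det (gram c (snd c q)) \<noteq> 0"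
    "\<And>a b. coord_metric c (snd c q) (E *v a) (E *v b) = a \<bullet> b - 2 * (a $ k * b $ k)"
proof -
  have "lorentzian_form A q (g q)"
    using metric by (auto simp: C11_lorentzian_metric_def)
  then obtain k :: 'n and e where e: "\<And>i. e i \<in> TM q"
    and ee: "\<And>i j. g q (e i) (e j) = (if i \<noteq> j then 0 else if i = k then -1 else 1)"
    unfolding lorentzian_form_def by metis
  let ?G = "gram c (snd c q)"
  define E :: "real ^ 'n ^ 'n" where "E = (\<chi> i j. e j c $ i)"
  define H :: "real ^ 'n ^ 'n" where "H = (\<chi> i j. if i \<noteq> j then 0 else if i = k then -1 else 1)"
  have col: "E *v axis i 1 = e i c" for i
    by (simp add: matrix_vector_mult_basis column_def E_def vec_eq_iff)
  have adj: "a \<bullet> (transpose E *v w) = (E *v a) \<bullet> w" for a w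
    by (metis dot_lmul_matrix inner_commute transpose_matrix_vector)
  have prod: "coord_metric c (snd c q) (E *v a) (E *v b) = a \<bullet> ((transpose E ** ?G ** E) *v b)" for a b
    by (simp only: coord_metric_gram matrix_vector_mul_assoc[symmetric] adj)
  have "(transpose E ** ?G ** E) $ i $ j = H $ i $ j" for i j
  proof -
    have "(transpose E ** ?G ** E) $ i $ j = axis i 1 \<bullet> ((transpose E ** ?G ** E) *v axis j 1)"
      by (simp add: inner_axis' matrix_vector_mult_basis column_def)
    also have "\<dots> = g q (e i) (e j)"
      by (simp only: prod[symmetric] col g_coord[OF e e c])
    finally show ?thesis by (simp add: ee H_def)
  qed
  then have M: "transpose E ** ?G ** E = H"
    by (simp add: vec_eq_iff)
  have "det H \<noteq> 0"
    by (subst det_diagonal) (auto simp: H_def)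
  then have "det E \<noteq> 0" "det ?G \<noteq> 0"
    unfolding M[symmetric] by (auto simp: det_mul)
  moreover have "coord_metric c (snd c q) (E *v a) (E *v b) = a \<bullet> b - 2 * (a $ k * b $ k)" for a b
  proof -
    have "H *v b = b - axis k (2 * b $ k)"
    proof (rule vec_eq_iff[THEN iffD2], rule allI)
      fix i
      have "H $ i $ j * b $ j = (if i = j then (if i = k then - 1 else 1) * b $ j else 0)" for j
        by (simp add: H_def)
      then have "(H *v b) $ i = (\<Sum>j\<in>UNIV. if i = j then (if i = k then - 1 else 1) * b $ j else 0)"
        by (simp only: matrix_vector_mult_def vec_lambda_beta)
      also have "\<dots> = (if i = k then - 1 else 1) * b $ i" by simp
      finally show "(H *v b) $ i = (b - axis k (2 * b $ k)) $ i"
        by (simp add: axis_def)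
    qed
    then show ?thesis
      by (simp add: prod M inner_diff_right inner_axis mult_ac)
  qed
  ultimately show thesis by (rule that)
qed

lemma gram_det: "c \<in> A \<Longrightarrow> x \<in> snd c ` fst c \<Longrightarrow> det (gram c x) \<noteq> 0"
  using orthonormal_frame by (metis imageE)

lemma minkowski_coordinates:
  obtains k :: 'n and a :: "('m, 'n) tvec \<Rightarrow> real ^ 'n" where
    "\<And>v w. v \<in> TM q \<Longrightarrow> w \<in> TM q \<Longrightarrow> g q v w = a v \<bullet> a w - 2 * (a v $ k * a w $ k)"
    "\<And>v. v \<in> TM q \<Longrightarrow> a v = 0 \<longleftrightarrow> v = (\<lambda>_. 0)"
proof -
  obtain c where c: "c \<in> A" "q \<in> fst c" by (rule chart_at)
  obtain k :: 'n and E :: "real ^ 'n ^ 'n" where E: "det E \<noteq> 0"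
    "\<And>a b. coord_metric c (snd c q) (E *v a) (E *v b) = a \<bullet> b - 2 * (a $ k * b $ k)"
    by (rule orthonormal_frame[OF c]) blast
  obtain E' where E': "E ** E' = mat 1"
    using E(1) invertible_det_nz[of E] by (auto simp: invertible_def)
  define a :: "('m, 'n) tvec \<Rightarrow> real ^ 'n" where "a v = E' *v v c" for v
  have Ea: "E *v a v = v c" for v
    by (simp add: a_def matrix_vector_mul_assoc E')
  show thesis
  proof (rule that)
    show "g q v w = a v \<bullet> a w - 2 * (a v $ k * a w $ k)" if "v \<in> TM q" "w \<in> TM q" for v w
      using g_coord[OF that c] E(2)[of "a v" "a w"] by (simp add: Ea)
    show "a v = 0 \<longleftrightarrow> v = (\<lambda>_. 0)" if v: "v \<in> TM q" for v
    proof
      assume "a v = 0"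
      then have "v c = 0" using Ea[of v] by simp
      then show "v = (\<lambda>_. 0)" using tangent_eqI[OF v tangent_zero c] by simp
    qed (simp add: a_def)
  qed
qed

lemma timelike_causal_product:
  assumes "v \<in> TM q" "w \<in> TM q" "g q v v < 0" "g q w w \<le> 0" "w \<noteq> (\<lambda>_. 0)"
  shows "g q v w \<noteq> 0"
proof -
  obtain k :: 'n and a :: "('m, 'n) tvec \<Rightarrow> real ^ 'n" where
    a: "\<And>v w. v \<in> TM q \<Longrightarrow> w \<in> TM q \<Longrightarrow> g q v w = a v \<bullet> a w - 2 * (a v $ k * a w $ k)"
    "\<And>v. v \<in> TM q \<Longrightarrow> a v = 0 \<longleftrightarrow> v = (\<lambda>_. 0)"
    by (rule minkowski_coordinates) blast
  have "(a v \<bullet> a w - 2 * (a v $ k * a w $ k)) * (a v $ k * a w $ k) < 0"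
    using assms a(2)[of w] by (intro minkowski_product_sign) (auto simp: a(1))
  then show ?thesis using assms by (auto simp: a(1))
qed

text \<open>With respect to an orthonormal frame, the sign of the product of a timelike with a causal vector is
  opposite to that of the product of their time components, so \<open>g q t v < 0\<close> means that \<open>t\<close> and \<open>v\<close> lie
  in the same half-cone.\<close>

lemma same_cone_product:
  assumes tm: "t \<in> TM q" "v \<in> TM q" "w \<in> TM q"
    and neg: "g q t t < 0" "g q v v < 0" "g q w w \<le> 0" "g q t v < 0" "g q t w < 0"
  shows "g q v w < 0"
proof -
  obtain k :: 'n and a :: "('m, 'n) tvec \<Rightarrow> real ^ 'n" where
    a: "\<And>v w. v \<in> TM q \<Longrightarrow> w \<in> TM q \<Longrightarrow> g q v w = a v \<bullet> a w - 2 * (a v $ k * a w $ k)"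
    "\<And>v. v \<in> TM q \<Longrightarrow> a v = 0 \<longleftrightarrow> v = (\<lambda>_. 0)"
    by (rule minkowski_coordinates) blast
  have "a w \<noteq> 0" "a v \<noteq> 0" using neg by (auto simp: a(1) tm)
  then have "g q t v * (a t $ k * a v $ k) < 0" "g q t w * (a t $ k * a w $ k) < 0"
    "g q v w * (a v $ k * a w $ k) < 0"
    using neg unfolding a(1)[OF tm(1) tm(2)] a(1)[OF tm(1) tm(3)] a(1)[OF tm(2) tm(3)]
    by (auto intro!: minkowski_product_sign simp: a(1) tm)
  then show ?thesis using neg
    by (auto simp: mult_less_0_iff zero_less_mult_iff)
qed

text \<open>The base point may vary with the vectors, which covers both products along a curve and products in
  a single tangent space.\<close>

lemma tendsto_metric:
  assumes c: "c \<in> A" "q \<in> fst c" and p: "(p \<longlongrightarrow> q) F"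
    and V: "\<forall>\<^sub>F i in F. V i \<in> TM (p i)" "((\<lambda>i. V i c) \<longlongrightarrow> v c) F" "v \<in> TM q"
    and W: "\<forall>\<^sub>F i in F. W i \<in> TM (p i)" "((\<lambda>i. W i c) \<longlongrightarrow> w c) F" "w \<in> TM q"
  shows "((\<lambda>i. g (p i) (V i) (W i)) \<longlongrightarrow> g q v w) F"
proof -
  have conv: "((\<lambda>i. snd c (p i)) \<longlongrightarrow> snd c q) F"
    using chart_continuous[OF c(1)] chart_open(1)[OF c(1)] c(2) p
    by (metis continuous_on_eq_continuous_at isCont_tendsto_compose)
  have "isCont (\<lambda>x. metric_coeff A g c x i j) (snd c q)" for i j
    using locally_lipschitz_imp_continuous_on[OF metric_coeff_locally_lipschitz[OF c(1)]] chart_open(2)[OF c(1)] c(2)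
    by (metis continuous_on_eq_continuous_at imageI)
  then have "((\<lambda>n. metric_coeff A g c (snd c (p n)) i j) \<longlongrightarrow> metric_coeff A g c (snd c q) i j) F" for i j
    by (rule isCont_tendsto_compose[OF _ conv])
  then have "((\<lambda>i. coord_metric c (snd c (p i)) (V i c) (W i c)) \<longlongrightarrow> coord_metric c (snd c q) (v c) (w c)) F"
    unfolding coord_metric_def by (intro tendsto_intros V W)
  moreover have "\<forall>\<^sub>F i in F. coord_metric c (snd c (p i)) (V i c) (W i c) = g (p i) (V i) (W i)"
    using V(1) W(1) topological_tendstoD[OF p chart_open(1)[OF c(1)] c(2)]
    by eventually_elim (rule g_coord[symmetric]; (assumption | rule c))
  ultimately show ?thesis
    unfolding g_coord[OF V(3) W(3) c] by (rule Lim_transform_eventually)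
qed

end


context spacetime
begin

section \<open>Velocities of curves\<close>

abbreviation "vel \<equiv> velocity A"

definition differentiable_curve :: "(real \<Rightarrow> 'm) \<Rightarrow> bool" where
  "differentiable_curve \<gamma> \<longleftrightarrow> path \<gamma> \<and>
     (\<forall>c\<in>A. \<forall>t\<in>{0..1}. \<gamma> t \<in> fst c \<longrightarrow> (snd c \<circ> \<gamma>) differentiable (at t within {0..1}))"

lemma path_stays_near:
  assumes "path \<gamma>" "t \<in> {0..1}" "open U" "\<gamma> t \<in> U"
  obtains e where "e > 0" "\<And>s. s \<in> {0..1} \<Longrightarrow> \<bar>s - t\<bar> < e \<Longrightarrow> \<gamma> s \<in> U"
proof -
  have "(\<gamma> \<longlongrightarrow> \<gamma> t) (at t within {0..1})"
    using assms(1,2) by (auto simp: path_def continuous_on_def)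
  then have "\<forall>\<^sub>F s in at t within {0..1}. \<gamma> s \<in> U"
    using assms(3,4) by (rule topological_tendstoD)
  then obtain e where "e > 0" "\<forall>s\<in>{0..1}. s \<noteq> t \<and> dist s t < e \<longrightarrow> \<gamma> s \<in> U"
    unfolding eventually_at by auto
  then show thesis
    using assms(4) by (intro that[of e]) (auto simp: dist_real_def)
qed

lemma velocity_has_vector_derivative:
  assumes "differentiable_curve \<gamma>" "c \<in> A" "t \<in> {0..1}" "\<gamma> t \<in> fst c"
  shows "((snd c \<circ> \<gamma>) has_vector_derivative vel \<gamma> t c) (at t within {0..1})"
  using assms by (simp add: differentiable_curve_def velocity_def vector_derivative_works[symmetric])

lemma vector_derivative_unit_unique:
  fixes f :: "real \<Rightarrow> 'a::real_normed_vector"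
  assumes "t \<in> {0..1}" "(f has_vector_derivative v) (at t within {0..1})"
    "(f has_vector_derivative w) (at t within {0..1})"
  shows "v = w"
  by (rule vector_derivative_unique_within_closed_interval[of 0 1 t]) (use assms in auto)

lemma velocity_unique:
  assumes "c \<in> A" "t \<in> {0..1}" "\<gamma> t \<in> fst c" "((snd c \<circ> \<gamma>) has_vector_derivative v) (at t within {0..1})"
  shows "vel \<gamma> t c = v"
proof -
  have "((snd c \<circ> \<gamma>) has_vector_derivative vector_derivative (snd c \<circ> \<gamma>) (at t within {0..1})) (at t within {0..1})"
    using assms(4) differentiableI_vector vector_derivative_works by blast
  then show ?thesis
    using assms vector_derivative_unit_unique by (auto simp: velocity_def)
qed

lemma velocity_tangent:
  assumes \<gamma>: "differentiable_curve \<gamma>" and t: "t \<in> {0..1}"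
  shows "vel \<gamma> t \<in> TM (\<gamma> t)"
  unfolding tangent_space_def mem_Collect_eq
proof (intro conjI ballI allI impI)
  fix c d assume cd: "c \<in> A" "d \<in> A" "\<gamma> t \<in> fst c \<and> \<gamma> t \<in> fst d"
  obtain e where e: "e > 0" "\<And>s. s \<in> {0..1} \<Longrightarrow> \<bar>s - t\<bar> < e \<Longrightarrow> \<gamma> s \<in> fst c"
    using path_stays_near[of \<gamma> t "fst c"] \<gamma> t cd chart_open by (metis differentiable_curve_def)
  have "((snd c \<circ> \<gamma>) has_vector_derivative vel \<gamma> t c) (at t within {0..1})"
    using velocity_has_vector_derivative \<gamma> t cd by blast
  moreover have "(transition c d has_derivative trans_deriv c d (snd c (\<gamma> t))) (at ((snd c \<circ> \<gamma>) t) within (snd c \<circ> \<gamma>) ` {0..1})"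
    using transition_has_derivative[OF cd(1,2)] cd(3) by (auto intro: has_derivative_at_withinI)
  ultimately have "((transition c d \<circ> (snd c \<circ> \<gamma>)) has_vector_derivative trans_deriv c d (snd c (\<gamma> t)) (vel \<gamma> t c)) (at t within {0..1})"
    by (rule vector_derivative_diff_chain_within)
  then have "((snd d \<circ> \<gamma>) has_vector_derivative trans_deriv c d (snd c (\<gamma> t)) (vel \<gamma> t c)) (at t within {0..1})"
    by (rule has_vector_derivative_transform_within[OF _ e(1) t]) (use e(2) cd in \<open>auto simp: dist_real_def\<close>)
  then show "vel \<gamma> t d = trans_deriv c d (snd c (\<gamma> t)) (vel \<gamma> t c)"
    using velocity_unique cd t by blast
qed (auto simp: velocity_def)


section \<open>The geodesic equation as a first-order system\<close>

abbreviation "geod \<equiv> geodesic_solution A g"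

definition geodesic_field :: "('m, 'n) chart \<Rightarrow> (real ^ 'n) \<times> (real ^ 'n) \<Rightarrow> (real ^ 'n) \<times> (real ^ 'n)" where
  "geodesic_field c z = (snd z, \<chi> k. - (\<Sum>i\<in>UNIV. \<Sum>j\<in>UNIV. christoffel A g c (fst z) k i j * snd z $ i * snd z $ j))"

definition phase :: "('m, 'n) chart \<Rightarrow> (real \<Rightarrow> 'm) \<Rightarrow> real \<Rightarrow> (real ^ 'n) \<times> (real ^ 'n)" where
  "phase c \<gamma> t = (snd c (\<gamma> t), vel \<gamma> t c)"

abbreviation phase_domain :: "('m, 'n) chart \<Rightarrow> ((real ^ 'n) \<times> (real ^ 'n)) set" where
  "phase_domain c \<equiv> snd c ` fst c \<times> UNIV"

lemma phase_domain_open: "c \<in> A \<Longrightarrow> open (phase_domain c)"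
  by (simp add: open_Times chart_open)

lemma geod_differentiable: "geod \<gamma> \<Longrightarrow> differentiable_curve \<gamma>"
  by (auto simp: geodesic_solution_def differentiable_curve_def)

lemma geod_path: "geod \<gamma> \<Longrightarrow> path \<gamma>"
  by (auto simp: geodesic_solution_def)

lemma phase_derivative:
  assumes "geod \<gamma>" "c \<in> A" "t \<in> {0..1}" "\<gamma> t \<in> fst c"
  shows "(phase c \<gamma> has_vector_derivative geodesic_field c (phase c \<gamma> t)) (at t within {0..1})"
proof -
  have "((\<lambda>s. snd c (\<gamma> s)) has_vector_derivative vel \<gamma> t c) (at t within {0..1})"
    using velocity_has_vector_derivative[OF geod_differentiable[OF assms(1)] assms(2-4)] by (simp add: o_def)
  moreover have "((\<lambda>s. vel \<gamma> s c) has_vector_derivative snd (geodesic_field c (phase c \<gamma> t))) (at t within {0..1})"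
    using assms by (simp add: geodesic_solution_def geodesic_field_def phase_def)
  ultimately show ?thesis
    using has_vector_derivative_Pair by (fastforce simp: phase_def[abs_def] geodesic_field_def)
qed

lemma phase_stays_near:
  assumes "geod \<gamma>" "c \<in> A" "t \<in> {0..1}" "\<gamma> t \<in> fst c" "r > 0"
  obtains e where "e > 0"
    "\<And>s. s \<in> {0..1} \<Longrightarrow> \<bar>s - t\<bar> < e \<Longrightarrow> \<gamma> s \<in> fst c"
    "\<And>s. s \<in> {0..1} \<Longrightarrow> \<bar>s - t\<bar> < e \<Longrightarrow> phase c \<gamma> s \<in> cball (phase c \<gamma> t) r"
proof -
  obtain e1 where e1: "e1 > 0" "\<And>s. s \<in> {0..1} \<Longrightarrow> \<bar>s - t\<bar> < e1 \<Longrightarrow> \<gamma> s \<in> fst c"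
    using path_stays_near[OF geod_path[OF assms(1)] assms(3) chart_open(1)[OF assms(2)] assms(4)] by metis
  have "continuous (at t within {0..1}) (phase c \<gamma>)"
    using phase_derivative[OF assms(1-4)] has_vector_derivative_continuous by blast
  then obtain e2 where "e2 > 0" "\<forall>s\<in>{0..1}. dist s t < e2 \<longrightarrow> dist (phase c \<gamma> s) (phase c \<gamma> t) < r"
    unfolding continuous_within_eps_delta using \<open>r > 0\<close> by blast
  with e1 show thesis
    by (intro that[of "min e1 e2"]) (auto simp: dist_real_def dist_commute less_imp_le)
qed

lemma christoffel_locally_lipschitz:
  assumes c: "c \<in> A"
  shows "locally_lipschitz_on (\<lambda>x. christoffel A g c x k i j) (snd c ` fst c)"
proof -
  have dG: "locally_lipschitz_on (\<lambda>x. frechet_derivative (\<lambda>y. metric_coeff A g c y a b) (at x) v) (snd c ` fst c)" for a b v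
    using metric_coeff_Ck1[OF c, of a b] by (simp add: One_nat_def)
  have inv: "locally_lipschitz_on (\<lambda>x. matrix_inv (gram c x) $ k $ l) (snd c ` fst c)" for l
    by (rule locally_lipschitz_matrix_inv)
       (auto simp: gram_def metric_coeff_locally_lipschitz c gram_det[unfolded gram_def])
  show ?thesis
    unfolding christoffel_def Let_def gram_def[symmetric]
    by (intro locally_lipschitz_divide locally_lipschitz_sum locally_lipschitz_mult
        locally_lipschitz_diff locally_lipschitz_add dG inv locally_lipschitz_const) auto
qed

lemma geodesic_field_locally_lipschitz:
  assumes c: "c \<in> A"
  shows "locally_lipschitz_on (geodesic_field c) (phase_domain c)"
proof -
  have id: "locally_lipschitz_on (\<lambda>z. z) (phase_domain c)"
    by (rule bounded_linear.locally_lipschitz[OF bounded_linear_ident])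
  have \<Gamma>: "locally_lipschitz_on (\<lambda>z. christoffel A g c (fst z) k i j) (phase_domain c)" for k i j
    by (rule locally_lipschitz_compose[OF locally_lipschitz_fst[OF id] christoffel_locally_lipschitz[OF c]]) auto
  show ?thesis
    unfolding geodesic_field_def[abs_def]
    by (intro locally_lipschitz_pair locally_lipschitz_vec_lambda locally_lipschitz_minus
        locally_lipschitz_sum locally_lipschitz_mult \<Gamma> locally_lipschitz_vec_nth locally_lipschitz_snd id)
qed

lemma geodesic_field_lipschitz_near:
  assumes c: "c \<in> A" and z: "z \<in> phase_domain c"
  obtains r K where "r > 0" "cball z (2 * r) \<subseteq> phase_domain c" "K-lipschitz_on (cball z (2 * r)) (geodesic_field c)"
proof -
  obtain r1 K where r1: "r1 > 0" "K-lipschitz_on (cball z r1 \<inter> phase_domain c) (geodesic_field c)"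
    using geodesic_field_locally_lipschitz[OF c] z unfolding locally_lipschitz_on_def by blast
  obtain r2 where r2: "r2 > 0" "cball z r2 \<subseteq> phase_domain c"
    using phase_domain_open[OF c] z open_contains_cball by metis
  show thesis
  proof (rule that)
    show "min r1 r2 / 2 > 0" using r1 r2 by simp
    show "cball z (2 * (min r1 r2 / 2)) \<subseteq> phase_domain c" using r2 by auto
    show "K-lipschitz_on (cball z (2 * (min r1 r2 / 2))) (geodesic_field c)"
      using r2 by (intro lipschitz_on_subset[OF r1(2)]) auto
  qed
qed

lemma unit_affine:
  assumes "a \<in> {0..1}" "a + b \<in> {0..1}" "s \<in> {0..1::real}"
  shows "a + b * s \<in> {0..1}"
proof -
  have "a + b * s = (1 - s) * a + s * (a + b)" by (simp add: algebra_simps)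
  moreover have "(1 - s) * a + s * (a + b) \<le> (1 - s) * 1 + s * 1"
    using assms by (intro add_mono mult_left_mono) auto
  ultimately show ?thesis using assms by auto
qed

lemma has_vector_derivative_affine:
  fixes f :: "real \<Rightarrow> 'b::real_normed_vector"
  assumes ab: "a \<in> {0..1}" "a + b \<in> {0..1}"
    and f: "(f has_vector_derivative D) (at (a + b * s) within {0..1})"
  shows "((\<lambda>s. f (a + b * s)) has_vector_derivative b *\<^sub>R D) (at s within {0..1})"
proof -
  have "((\<lambda>s. a + b * s) has_vector_derivative b) (at s within {0..1})"
    by (auto intro!: derivative_eq_intros)
  moreover have "(f has_vector_derivative D) (at (a + b * s) within (\<lambda>s. a + b * s) ` {0..1})"
    by (rule has_vector_derivative_within_subset[OF f]) (use unit_affine[OF ab] in auto)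
  ultimately show ?thesis
    using vector_diff_chain_within[of "\<lambda>s. a + b * s" b s "{0..1}" f D] by (simp add: o_def)
qed

text \<open>Restriction to subintervals, reversal and rescaling of curves are all instances of
  affine reparametrisation.\<close>

lemma differentiable_curve_affine:
  assumes \<gamma>: "differentiable_curve \<gamma>" and ab: "a \<in> {0..1}" "a + b \<in> {0..1}"
  shows "differentiable_curve (\<lambda>s. \<gamma> (a + b * s))"
    and "\<And>s. s \<in> {0..1} \<Longrightarrow> vel (\<lambda>s. \<gamma> (a + b * s)) s = (\<lambda>c. b *\<^sub>R vel \<gamma> (a + b * s) c)"
proof -
  let ?\<beta> = "\<lambda>s. \<gamma> (a + b * s)"
  note unit = unit_affine[OF ab]
  have der: "((snd c \<circ> ?\<beta>) has_vector_derivative b *\<^sub>R vel \<gamma> (a + b * s) c) (at s within {0..1})"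
    if "c \<in> A" "s \<in> {0..1}" "?\<beta> s \<in> fst c" for c s
    using has_vector_derivative_affine[OF ab velocity_has_vector_derivative[OF \<gamma> that(1) unit[OF that(2)] that(3)]]
    by (simp add: o_def)
  show "vel ?\<beta> s = (\<lambda>c. b *\<^sub>R vel \<gamma> (a + b * s) c)" if "s \<in> {0..1}" for s
  proof
    fix c
    show "vel ?\<beta> s c = b *\<^sub>R vel \<gamma> (a + b * s) c"
    proof (cases "c \<in> A \<and> ?\<beta> s \<in> fst c")
      case True
      then show ?thesis using velocity_unique[of c s ?\<beta>] der that by blast
    next
      case False
      then show ?thesis by (auto simp: velocity_def)
    qed
  qed
  have "continuous_on {0..1} (\<lambda>s. \<gamma> (a + b * s))"
    using \<gamma> unit
    by (intro continuous_on_compose2[of "{0..1}" \<gamma> "{0..1}" "\<lambda>s. a + b * s"])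
       (auto intro!: continuous_intros simp: differentiable_curve_def path_def)
  then show "differentiable_curve ?\<beta>"
    using der differentiableI_vector unfolding differentiable_curve_def path_def by blast
qed

lemma C1_curve_differentiable: "C1_curve A \<gamma> \<Longrightarrow> differentiable_curve \<gamma>"
  by (auto simp: C1_curve_def differentiable_curve_def)

lemma C1_curve_reverse:
  assumes "C1_curve A \<gamma>"
  shows "C1_curve A (\<lambda>s. \<gamma> (1 - s))"
    and "s \<in> {0..1} \<Longrightarrow> vel (\<lambda>s. \<gamma> (1 - s)) s = (\<lambda>c. - vel \<gamma> (1 - s) c)"
proof -
  let ?\<beta> = "\<lambda>s. \<gamma> (1 - s)"
  note \<beta> = differentiable_curve_affine[OF C1_curve_differentiable[OF assms], of 1 "-1", simplified]
  show vel: "vel ?\<beta> s = (\<lambda>c. - vel \<gamma> (1 - s) c)" if "s \<in> {0..1}" for s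
    using \<beta>(2) that by simp
  show "C1_curve A ?\<beta>"
    unfolding C1_curve_def
  proof (intro conjI ballI impI)
    show "path ?\<beta>" using \<beta>(1) by (simp add: differentiable_curve_def)
    fix c assume c: "c \<in> A"
    show "(snd c \<circ> ?\<beta>) differentiable (at t within {0..1})" if "t \<in> {0..1}" "?\<beta> t \<in> fst c" for t
      using \<beta>(1) c that by (simp add: differentiable_curve_def)
    have "continuous_on {t \<in> {0..1}. \<gamma> t \<in> fst c} (\<lambda>t. vel \<gamma> t c)"
      using assms c by (simp add: C1_curve_def)
    then have "continuous_on {t \<in> {0..1}. ?\<beta> t \<in> fst c} (\<lambda>t. vel \<gamma> (1 - t) c)"
      by (rule continuous_on_compose2) (auto intro!: continuous_intros)
    then have "continuous_on {t \<in> {0..1}. ?\<beta> t \<in> fst c} (\<lambda>t. - vel \<gamma> (1 - t) c)"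
      by (rule continuous_on_minus)
    then show "continuous_on {t \<in> {0..1}. ?\<beta> t \<in> fst c} (\<lambda>t. vel ?\<beta> t c)"
      using vel by (subst continuous_on_cong[OF refl]) auto
  qed
qed

lemma geod_affine:
  assumes \<gamma>: "geod \<gamma>" and ab: "a \<in> {0..1}" "a + b \<in> {0..1}"
  shows "geod (\<lambda>s. \<gamma> (a + b * s))"
    and "\<And>s. s \<in> {0..1} \<Longrightarrow> vel (\<lambda>s. \<gamma> (a + b * s)) s = (\<lambda>c. b *\<^sub>R vel \<gamma> (a + b * s) c)"
proof -
  let ?\<beta> = "\<lambda>s. \<gamma> (a + b * s)"
  note unit = unit_affine[OF ab] and \<beta> = differentiable_curve_affine[OF geod_differentiable[OF \<gamma>] ab]
  show vel: "vel ?\<beta> s = (\<lambda>c. b *\<^sub>R vel \<gamma> (a + b * s) c)" if "s \<in> {0..1}" for s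
    by (rule \<beta>(2)[OF that])
  show "geod ?\<beta>"
    unfolding geodesic_solution_def
  proof (intro conjI ballI impI)
    show "path ?\<beta>" using \<beta>(1) by (simp add: differentiable_curve_def)
    fix c t assume c: "c \<in> A" "t \<in> {0..1}" "?\<beta> t \<in> fst c"
    show "(snd c \<circ> ?\<beta>) differentiable (at t within {0..1})"
      using \<beta>(1) c by (simp add: differentiable_curve_def)
    define acc where "acc \<tau> u = (\<chi> k. - (\<Sum>i\<in>UNIV. \<Sum>j\<in>UNIV. christoffel A g c (snd c (\<gamma> \<tau>)) k i j * u $ i * u $ j))" for \<tau> u
    have "((\<lambda>s. vel \<gamma> s c) has_vector_derivative acc (a + b * t) (vel \<gamma> (a + b * t) c)) (at (a + b * t) within {0..1})"
      using \<gamma> c unit[OF c(2)] by (simp add: geodesic_solution_def acc_def)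
    then have "((\<lambda>s. vel \<gamma> (a + b * s) c) has_vector_derivative b *\<^sub>R acc (a + b * t) (vel \<gamma> (a + b * t) c)) (at t within {0..1})"
      by (rule has_vector_derivative_affine[OF ab])
    then have "((\<lambda>s. b *\<^sub>R vel \<gamma> (a + b * s) c) has_vector_derivative b *\<^sub>R b *\<^sub>R acc (a + b * t) (vel \<gamma> (a + b * t) c)) (at t within {0..1})"
      by (rule bounded_linear.has_vector_derivative[OF bounded_linear_scaleR_right])
    then have "((\<lambda>s. vel ?\<beta> s c) has_vector_derivative b *\<^sub>R b *\<^sub>R acc (a + b * t) (vel \<gamma> (a + b * t) c)) (at t within {0..1})"
      by (rule has_vector_derivative_transform[rotated 2]) (use c vel in auto)
    moreover have "b *\<^sub>R b *\<^sub>R acc (a + b * t) (vel \<gamma> (a + b * t) c) = acc (a + b * t) (vel ?\<beta> t c)"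
      unfolding vel[OF c(2)] by (simp add: acc_def vec_eq_iff sum_distrib_left mult_ac)
    ultimately show "((\<lambda>s. vel ?\<beta> s c) has_vector_derivative
      (\<chi> k. - (\<Sum>i\<in>UNIV. \<Sum>j\<in>UNIV. christoffel A g c (snd c (?\<beta> t)) k i j * vel ?\<beta> t c $ i * vel ?\<beta> t c $ j)))
      (at t within {0..1})"
      by (simp only: acc_def)
  qed
qed

lemma geod_reverse:
  assumes "geod \<gamma>"
  shows "geod (\<lambda>s. \<gamma> (1 - s))" "s \<in> {0..1} \<Longrightarrow> vel (\<lambda>s. \<gamma> (1 - s)) s = (\<lambda>c. - vel \<gamma> (1 - s) c)"
  using geod_affine[OF assms, of 1 "-1"] by simp_all

text \<open>Two geodesics with the same initial data can only separate at a point where they agree;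
  there the comparison lemma for the first-order system applies in a chart.\<close>

lemma geod_unique:
  assumes \<gamma>: "geod \<gamma>" and \<beta>: "geod \<beta>" and init: "\<gamma> 0 = \<beta> 0" "vel \<gamma> 0 = vel \<beta> 0" and t: "t \<in> {0..1}"
  shows "\<gamma> t = \<beta> t" and "vel \<gamma> t = vel \<beta> t"
proof -
  define P where "P a b \<longleftrightarrow> (0 \<le> a \<and> b \<le> 1 \<and> \<gamma> a = \<beta> a \<and> vel \<gamma> a = vel \<beta> a \<longrightarrow> \<gamma> b = \<beta> b \<and> vel \<gamma> b = vel \<beta> b)"
    for a b
  have "0 \<le> t" using t by simp
  then have "P 0 t"
  proof (induction rule: Bolzano)
    case (trans a b c)
    then show ?case by (auto simp: P_def)
  next
    case (local x)
    then have x: "x \<in> {0..1}" using t by auto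
    show ?case
    proof (cases "\<gamma> x = \<beta> x")
      case False
      then obtain U V where UV: "open U" "open V" "\<gamma> x \<in> U" "\<beta> x \<in> V" "U \<inter> V = {}"
        using hausdorff[OF False] by blast
      obtain e1 where e1: "e1 > 0" "\<And>s. s \<in> {0..1} \<Longrightarrow> \<bar>s - x\<bar> < e1 \<Longrightarrow> \<gamma> s \<in> U"
        using path_stays_near[OF geod_path[OF \<gamma>] x UV(1,3)] by metis
      obtain e2 where e2: "e2 > 0" "\<And>s. s \<in> {0..1} \<Longrightarrow> \<bar>s - x\<bar> < e2 \<Longrightarrow> \<beta> s \<in> V"
        using path_stays_near[OF geod_path[OF \<beta>] x UV(2,4)] by metis
      have "\<gamma> a \<noteq> \<beta> a" if "a \<le> x" "x \<le> b" "b - a < min e1 e2" "0 \<le> a" "b \<le> 1" for a b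
        using that e1(2)[of a] e2(2)[of a] UV(5) by auto
      then have "\<forall>a b. a \<le> x \<and> x \<le> b \<and> b - a < min e1 e2 \<longrightarrow> P a b"
        by (auto simp: P_def)
      then show ?thesis using e1 e2 by (intro exI[of _ "min e1 e2"]) auto
    next
      case True
      obtain c where c: "c \<in> A" "\<gamma> x \<in> fst c" by (rule chart_at)
      have "phase c \<gamma> x \<in> phase_domain c" using c by (auto simp: phase_def)
      then obtain r K where r: "r > 0" "K-lipschitz_on (cball (phase c \<gamma> x) (2 * r)) (geodesic_field c)"
        using geodesic_field_lipschitz_near[OF c(1)] by metis
      obtain e1 where e1: "e1 > 0" "\<And>s. s \<in> {0..1} \<Longrightarrow> \<bar>s - x\<bar> < e1 \<Longrightarrow> \<gamma> s \<in> fst c"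
        "\<And>s. s \<in> {0..1} \<Longrightarrow> \<bar>s - x\<bar> < e1 \<Longrightarrow> phase c \<gamma> s \<in> cball (phase c \<gamma> x) r"
        using phase_stays_near[OF \<gamma> c(1) x c(2) r(1)] by metis
      have "\<beta> x \<in> fst c" using True c by simp
      then obtain e2 where e2: "e2 > 0" "\<And>s. s \<in> {0..1} \<Longrightarrow> \<bar>s - x\<bar> < e2 \<Longrightarrow> \<beta> s \<in> fst c"
        using phase_stays_near[OF \<beta> c(1) x _ r(1)] by metis
      have "P a b" if ab: "a \<le> x" "x \<le> b" "b - a < min e1 e2" for a b
        unfolding P_def
      proof (intro impI)
        assume asm: "0 \<le> a \<and> b \<le> 1 \<and> \<gamma> a = \<beta> a \<and> vel \<gamma> a = vel \<beta> a"
        have near: "s \<in> {0..1}" "\<bar>s - x\<bar> < e1" "\<bar>s - x\<bar> < e2" if "s \<in> {a..b}" for s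
          using that ab asm by auto
        have 0: "dist (phase c \<beta> a) (phase c \<gamma> a) = 0"
          using asm by (simp add: phase_def)
        have "dist (phase c \<beta> b) (phase c \<gamma> b) \<le> dist (phase c \<beta> a) (phase c \<gamma> a) * exp (K * (b - a))"
        proof (rule ode_comparison[OF r(2)])
          fix s assume s: "s \<in> {a..b}"
          show "(phase c \<gamma> has_vector_derivative geodesic_field c (phase c \<gamma> s)) (at s within {a..b})"
            using near[OF s] e1 asm by (intro has_vector_derivative_within_subset[OF phase_derivative[OF \<gamma> c(1)]]) auto
          show "(phase c \<beta> has_vector_derivative geodesic_field c (phase c \<beta> s)) (at s within {a..b})"
            using near[OF s] e2 asm by (intro has_vector_derivative_within_subset[OF phase_derivative[OF \<beta> c(1)]]) auto
          show "phase c \<gamma> s \<in> cball (phase c \<gamma> x) r"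
            using near[OF s] e1 by auto
        qed (use 0 r ab in auto)
        then have "phase c \<beta> b = phase c \<gamma> b"
          using 0 by simp
        then have eq: "snd c (\<beta> b) = snd c (\<gamma> b)" "vel \<beta> b c = vel \<gamma> b c"
          by (auto simp: phase_def)
        have b: "b \<in> {0..1}" "\<gamma> b \<in> fst c" "\<beta> b \<in> fst c"
          using near[of b] ab e1(2) e2(2) by auto
        have "\<gamma> b = \<beta> b"
          using eq(1) b c(1) by (metis chart_inv_coord)
        moreover have "vel \<gamma> b = vel \<beta> b"
          using tangent_eqI[OF velocity_tangent[OF geod_differentiable[OF \<gamma>] b(1)] _ c(1) b(2)]
            velocity_tangent[OF geod_differentiable[OF \<beta>] b(1)] eq(2) \<open>\<gamma> b = \<beta> b\<close> by metis
        ultimately show "\<gamma> b = \<beta> b \<and> vel \<gamma> b = vel \<beta> b" ..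
      qed
      then show ?thesis using e1(1) e2(1) by (intro exI[of _ "min e1 e2"]) auto
    qed
  qed
  then show "\<gamma> t = \<beta> t" "vel \<gamma> t = vel \<beta> t"
    using init t by (auto simp: P_def)
qed

text \<open>Rescaled to the interval between \<open>s\<close> and \<open>t\<close>, in whichever order, the geodesic has the initial data of a
  constant one.\<close>

lemma geod_velocity_zero:
  assumes \<gamma>: "geod \<gamma>" and s: "s \<in> {0..1}" and t: "t \<in> {0..1}" and 0: "vel \<gamma> s = (\<lambda>_. 0)"
  shows "\<gamma> t = \<gamma> s" "vel \<gamma> t = (\<lambda>_. 0)"
proof -
  let ?\<beta> = "\<lambda>u. \<gamma> (s + (t - s) * u)" and ?\<delta> = "\<lambda>u. \<gamma> (s + 0 * u)"
  have ab: "s + (t - s) \<in> {0..1}" "s + 0 \<in> {0..1}" using s t by auto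
  note \<beta> = geod_affine[OF \<gamma> s ab(1)] and \<delta> = geod_affine[OF \<gamma> s ab(2)]
  have v\<beta>: "vel ?\<beta> 0 = (\<lambda>_. 0)"
    by (subst \<beta>(2)) (simp_all add: 0)
  have v\<delta>: "vel ?\<delta> u = (\<lambda>_. 0)" if "u \<in> {0..1}" for u
    using that by (subst \<delta>(2)) simp_all
  have v0: "vel ?\<beta> 0 = vel ?\<delta> 0"
    unfolding v\<beta> by (rule v\<delta>[symmetric]) simp
  have "?\<beta> 1 = ?\<delta> 1"
    by (rule geod_unique(1)[OF \<beta>(1) \<delta>(1) _ v0]) simp_all
  then show "\<gamma> t = \<gamma> s" by simp
  have "vel ?\<beta> 1 = vel ?\<delta> 1"
    by (rule geod_unique(2)[OF \<beta>(1) \<delta>(1) _ v0]) simp_all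
  also have "\<dots> = (\<lambda>_. 0)" by (rule v\<delta>) simp
  finally have "(\<lambda>c. (t - s) *\<^sub>R vel \<gamma> t c) = (\<lambda>_. 0)"
    using \<beta>(2)[of 1] by simp
  then show "vel \<gamma> t = (\<lambda>_. 0)"
    using 0 by (cases "t = s") (auto simp: fun_eq_iff)
qed

lemma geod_C1_curve:
  assumes "geod \<gamma>" shows "C1_curve A \<gamma>"
  unfolding C1_curve_def
proof (intro conjI ballI impI)
  show "path \<gamma>" by (rule geod_path[OF assms])
  fix c assume c: "c \<in> A"
  show "(snd c \<circ> \<gamma>) differentiable (at t within {0..1})" if "t \<in> {0..1}" "\<gamma> t \<in> fst c" for t
    using assms c that by (simp add: geodesic_solution_def)
  show "continuous_on {t \<in> {0..1}. \<gamma> t \<in> fst c} (\<lambda>t. vel \<gamma> t c)"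
    unfolding continuous_on_eq_continuous_within
  proof
    fix t assume t: "t \<in> {t \<in> {0..1}. \<gamma> t \<in> fst c}"
    then have "continuous (at t within {0..1}) (\<lambda>t. vel \<gamma> t c)"
      using assms c has_vector_derivative_continuous unfolding geodesic_solution_def by blast
    then show "continuous (at t within {t \<in> {0..1}. \<gamma> t \<in> fst c}) (\<lambda>t. vel \<gamma> t c)"
      by (rule continuous_within_subset) auto
  qed
qed


section \<open>The Lagrangian of the geodesic equation\<close>

definition metric_deriv where
  "metric_deriv c x h u w = (\<Sum>i\<in>UNIV. \<Sum>j\<in>UNIV.
     frechet_derivative (\<lambda>y. metric_coeff A g c y i j) (at x) h * u $ i * w $ j)"

lemma metric_coeff_has_derivative:
  assumes "c \<in> A" "x \<in> snd c ` fst c"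
  shows "((\<lambda>y. metric_coeff A g c y i j) has_derivative
           frechet_derivative (\<lambda>y. metric_coeff A g c y i j) (at x)) (at x)"
  using metric_coeff_Ck1[OF assms(1), of i j] assms(2)
  by (intro has_frechet_derivative) (auto simp: One_nat_def)

lemma coord_metric_has_derivative:
  assumes c: "c \<in> A" and x: "X p \<in> snd c ` fst c"
    and X: "(X has_derivative X') (at p within S)"
    and U: "(U has_derivative U') (at p within S)"
    and W: "(W has_derivative W') (at p within S)"
  shows "((\<lambda>p. coord_metric c (X p) (U p) (W p)) has_derivative
     (\<lambda>h. metric_deriv c (X p) (X' h) (U p) (W p)
        + coord_metric c (X p) (U' h) (W p) + coord_metric c (X p) (U p) (W' h))) (at p within S)"
proof -
  let ?G = "\<lambda>i j y. metric_coeff A g c y i j"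
  have "((\<lambda>p. ?G i j (X p)) has_derivative (\<lambda>h. frechet_derivative (?G i j) (at (X p)) (X' h))) (at p within S)" for i j
    using has_derivative_compose[OF X metric_coeff_has_derivative[OF c x]] by simp
  note this[derivative_intros] bounded_linear.has_derivative[OF bounded_linear_vec_nth U, derivative_intros]
     bounded_linear.has_derivative[OF bounded_linear_vec_nth W, derivative_intros]
  show ?thesis
    unfolding coord_metric_def
    by (auto intro!: derivative_eq_intros simp: fun_eq_iff metric_deriv_def coord_metric_def
        sum.distrib[symmetric] algebra_simps)
qed

text \<open>Multiplying the geodesic equation by the metric removes the inverse metric from the
  Christoffel symbols: this is the Euler-Lagrange equation of the Lagrangian \<open>g(v, v)\<close>.\<close>

lemma geodesic_field_lowered:
  assumes c: "c \<in> A" and x: "x \<in> snd c ` fst c"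
  shows "coord_metric c x u (snd (geodesic_field c (x, v)))
           = metric_deriv c x u v v / 2 - metric_deriv c x v u v"
proof -
  define dG where "dG l a b = frechet_derivative (\<lambda>y. metric_coeff A g c y a b) (at x) (axis l 1)" for l a b
  define \<tau> where "\<tau> = (\<chi> l. \<Sum>i\<in>UNIV. \<Sum>j\<in>UNIV. (dG i l j + dG j l i - dG l i j) * v $ i * v $ j)"
  have dG: "frechet_derivative (\<lambda>y. metric_coeff A g c y a b) (at x) h = (\<Sum>l\<in>UNIV. h $ l * dG l a b)" for a b h
  proof -
    let ?D = "frechet_derivative (\<lambda>y. metric_coeff A g c y a b) (at x)"
    have "linear ?D" using metric_coeff_has_derivative[OF c x] has_derivative_linear by blast
    from linear_axis_expansion[OF this, of h] show ?thesis by (simp add: dG_def)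
  qed
  have inv: "gram c x ** matrix_inv (gram c x) = mat 1"
    by (rule matrix_inv_right_of_det[OF gram_det[OF c x]])
  have "snd (geodesic_field c (x, v)) $ k = (- (1 / 2) *\<^sub>R (matrix_inv (gram c x) *v \<tau>)) $ k" for k
  proof -
    have "snd (geodesic_field c (x, v)) $ k
        = - (\<Sum>i\<in>UNIV. \<Sum>j\<in>UNIV. (\<Sum>l\<in>UNIV. matrix_inv (gram c x) $ k $ l * (dG i l j + dG j l i - dG l i j)) / 2 * v $ i * v $ j)"
      by (simp add: geodesic_field_def christoffel_def Let_def dG_def gram_def)
    also have "\<dots> = - (\<Sum>i\<in>UNIV. \<Sum>j\<in>UNIV. \<Sum>l\<in>UNIV. matrix_inv (gram c x) $ k $ l * ((dG i l j + dG j l i - dG l i j) * v $ i * v $ j)) / 2"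
      by (simp add: sum_divide_distrib sum_distrib_right sum_distrib_left mult_ac)
    also have "(\<Sum>i\<in>UNIV. \<Sum>j\<in>UNIV. \<Sum>l\<in>UNIV. matrix_inv (gram c x) $ k $ l * ((dG i l j + dG j l i - dG l i j) * v $ i * v $ j))
       = (\<Sum>i\<in>UNIV. \<Sum>l\<in>UNIV. \<Sum>j\<in>UNIV. matrix_inv (gram c x) $ k $ l * ((dG i l j + dG j l i - dG l i j) * v $ i * v $ j))"
      by (intro sum.cong refl sum.swap)
    also have "\<dots> = (\<Sum>l\<in>UNIV. \<Sum>i\<in>UNIV. \<Sum>j\<in>UNIV. matrix_inv (gram c x) $ k $ l * ((dG i l j + dG j l i - dG l i j) * v $ i * v $ j))"
      by (rule sum.swap)
    also have "\<dots> = (matrix_inv (gram c x) *v \<tau>) $ k"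
      by (simp only: matrix_vector_mult_def \<tau>_def vec_lambda_beta sum_distrib_left)
    finally show ?thesis by simp
  qed
  then have acc: "snd (geodesic_field c (x, v)) = - (1 / 2) *\<^sub>R (matrix_inv (gram c x) *v \<tau>)"
    by (rule vec_eq_iff[THEN iffD2, OF allI])
  have "gram c x *v snd (geodesic_field c (x, v)) = - (1 / 2) *\<^sub>R (gram c x *v (matrix_inv (gram c x) *v \<tau>))"
    unfolding acc by (rule matrix_vector_mult_scaleR)
  also have "\<dots> = - (1 / 2) *\<^sub>R \<tau>"
    by (simp only: matrix_vector_mul_assoc inv matrix_vector_mul_lid)
  finally have 1: "coord_metric c x u (snd (geodesic_field c (x, v))) = - (u \<bullet> \<tau>) / 2"
    by (simp only: coord_metric_gram) simp
  define S1 S2 S3 where "S1 = (\<Sum>l\<in>UNIV. \<Sum>i\<in>UNIV. \<Sum>j\<in>UNIV. dG i l j * u $ l * v $ i * v $ j)"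
    and "S2 = (\<Sum>l\<in>UNIV. \<Sum>i\<in>UNIV. \<Sum>j\<in>UNIV. dG j l i * u $ l * v $ i * v $ j)"
    and "S3 = (\<Sum>l\<in>UNIV. \<Sum>i\<in>UNIV. \<Sum>j\<in>UNIV. dG l i j * u $ l * v $ i * v $ j)"
  have "u \<bullet> \<tau> = S1 + S2 - S3"
    by (simp add: inner_vec_def \<tau>_def S1_def S2_def S3_def sum_distrib_left sum.distrib[symmetric] sum_subtractf[symmetric] algebra_simps)
  moreover have "S2 = S1"
    unfolding S1_def S2_def by (rule sum.cong[OF refl]) (subst sum.swap, simp add: mult_ac)
  moreover have "metric_deriv c x v u v = S1"
  proof -
    have "metric_deriv c x v u v = (\<Sum>l\<in>UNIV. \<Sum>j\<in>UNIV. \<Sum>i\<in>UNIV. dG i l j * u $ l * v $ i * v $ j)"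
      by (simp add: metric_deriv_def dG sum_distrib_right sum_distrib_left mult_ac)
    also have "\<dots> = S1"
      unfolding S1_def by (intro sum.cong refl sum.swap)
    finally show ?thesis .
  qed
  moreover have "metric_deriv c x u v v = S3"
  proof -
    have "metric_deriv c x u v v = (\<Sum>i\<in>UNIV. \<Sum>j\<in>UNIV. \<Sum>l\<in>UNIV. dG l i j * u $ l * v $ i * v $ j)"
      by (simp add: metric_deriv_def dG sum_distrib_right sum_distrib_left mult_ac)
    also have "\<dots> = (\<Sum>i\<in>UNIV. \<Sum>l\<in>UNIV. \<Sum>j\<in>UNIV. dG l i j * u $ l * v $ i * v $ j)"
      by (intro sum.cong refl sum.swap)
    also have "\<dots> = S3"
      unfolding S3_def by (rule sum.swap)
    finally show ?thesis .
  qed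
  ultimately show ?thesis using 1 by simp
qed

definition lagrangian where "lagrangian c z = coord_metric c (fst z) (snd z) (snd z)"

lemma lagrangian_has_derivative:
  assumes c: "c \<in> A" and z: "z \<in> phase_domain c"
  shows "(lagrangian c has_derivative (\<lambda>h. metric_deriv c (fst z) (fst h) (snd z) (snd z)
           + 2 * coord_metric c (fst z) (snd h) (snd z))) (at z)"
proof -
  have x: "fst z \<in> snd c ` fst c" using z by auto
  have "(lagrangian c has_derivative (\<lambda>h. metric_deriv c (fst z) (fst h) (snd z) (snd z)
           + coord_metric c (fst z) (snd h) (snd z) + coord_metric c (fst z) (snd z) (snd h))) (at z)"
    unfolding lagrangian_def[abs_def]
    using coord_metric_has_derivative[where X = fst and U = snd and W = snd and p = z and S = UNIV
        and X' = fst and U' = snd and W' = snd, OF c x]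
    by (simp add: bounded_linear_fst bounded_linear_snd bounded_linear_imp_has_derivative)
  then show ?thesis
    by (simp add: coord_metric_sym[OF c x, of "snd z"] add.assoc)
qed

lemma lagrangian_frechet:
  assumes c: "c \<in> A" and z: "z \<in> phase_domain c"
  shows "frechet_derivative (lagrangian c) (at z) h
     = metric_deriv c (fst z) (fst h) (snd z) (snd z) + 2 * coord_metric c (fst z) (snd h) (snd z)"
  by (simp add: frechet_derivative_at[OF lagrangian_has_derivative[OF assms], symmetric])

lemma lagrangian_Ck1:
  assumes c: "c \<in> A"
  shows "Ck1_on 1 (lagrangian c) (phase_domain c)"
  unfolding One_nat_def Ck1_on.simps
proof (intro conjI allI ballI)
  show "lagrangian c differentiable at z" if "z \<in> phase_domain c" for z
    using lagrangian_has_derivative[OF c that] differentiableI by blast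
  fix h :: "(real ^ 'n) \<times> (real ^ 'n)"
  have id: "locally_lipschitz_on (\<lambda>z. z) (phase_domain c)"
    by (rule bounded_linear.locally_lipschitz[OF bounded_linear_ident])
  have dG: "locally_lipschitz_on (\<lambda>z. frechet_derivative (\<lambda>y. metric_coeff A g c y a b) (at (fst z)) v) (phase_domain c)" for a b v
    using metric_coeff_Ck1[OF c, of a b]
    by (intro locally_lipschitz_compose[OF locally_lipschitz_fst[OF id]]) (auto simp: One_nat_def)
  have G: "locally_lipschitz_on (\<lambda>z. metric_coeff A g c (fst z) a b) (phase_domain c)" for a b
    by (intro locally_lipschitz_compose[OF locally_lipschitz_fst[OF id] metric_coeff_locally_lipschitz[OF c]]) auto
  have "locally_lipschitz_on (\<lambda>z. metric_deriv c (fst z) (fst h) (snd z) (snd z)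
     + 2 * coord_metric c (fst z) (snd h) (snd z)) (phase_domain c)"
    unfolding metric_deriv_def coord_metric_def
    by (intro locally_lipschitz_add locally_lipschitz_mult locally_lipschitz_sum dG G
        locally_lipschitz_const locally_lipschitz_vec_nth locally_lipschitz_snd id)
  then show "locally_lipschitz_on (\<lambda>z. frechet_derivative (lagrangian c) (at z) h) (phase_domain c)"
    by (subst locally_lipschitz_on_cong[OF lagrangian_frechet[OF c]])
qed

lemma lagrangian_phase:
  assumes "differentiable_curve \<gamma>" "c \<in> A" "t \<in> {0..1}" "\<gamma> t \<in> fst c"
  shows "lagrangian c (phase c \<gamma> t) = g (\<gamma> t) (vel \<gamma> t) (vel \<gamma> t)"
  using g_coord[OF velocity_tangent[OF assms(1,3)] velocity_tangent[OF assms(1,3)] assms(2,4)]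
  by (simp add: lagrangian_def phase_def)

text \<open>The lowered geodesic equation cancels the derivative of the Lagrangian along the solution.\<close>

lemma geod_energy_constant:
  assumes \<gamma>: "geod \<gamma>" and t: "t \<in> {0..1}"
  shows "g (\<gamma> t) (vel \<gamma> t) (vel \<gamma> t) = g (\<gamma> 0) (vel \<gamma> 0) (vel \<gamma> 0)"
proof -
  let ?E = "\<lambda>t. g (\<gamma> t) (vel \<gamma> t) (vel \<gamma> t)"
  have "(?E has_derivative (\<lambda>h. 0)) (at s within {0..1})" if s: "s \<in> {0..1}" for s
  proof -
    obtain c where c: "c \<in> A" "\<gamma> s \<in> fst c" by (rule chart_at)
    obtain e where e: "e > 0" "\<And>u. u \<in> {0..1} \<Longrightarrow> \<bar>u - s\<bar> < e \<Longrightarrow> \<gamma> u \<in> fst c"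
      using path_stays_near[OF geod_path[OF \<gamma>] s chart_open(1)[OF c(1)] c(2)] by metis
    let ?z = "phase c \<gamma> s"
    have z: "?z \<in> phase_domain c" and x: "fst ?z \<in> snd c ` fst c" using c by (auto simp: phase_def)
    have "(phase c \<gamma> has_derivative (\<lambda>h. h *\<^sub>R geodesic_field c ?z)) (at s within {0..1})"
      using phase_derivative[OF \<gamma> c(1) s c(2)] by (simp add: has_vector_derivative_def)
    from has_derivative_compose[OF this lagrangian_has_derivative[OF c(1) z]]
    have "((\<lambda>u. lagrangian c (phase c \<gamma> u)) has_derivative (\<lambda>h. metric_deriv c (fst ?z) (h *\<^sub>R snd ?z) (snd ?z) (snd ?z)
         + 2 * coord_metric c (fst ?z) (h *\<^sub>R snd (geodesic_field c ?z)) (snd ?z))) (at s within {0..1})"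
      by (simp add: geodesic_field_def)
    moreover have "metric_deriv c (fst ?z) (h *\<^sub>R snd ?z) (snd ?z) (snd ?z)
         + 2 * coord_metric c (fst ?z) (h *\<^sub>R snd (geodesic_field c ?z)) (snd ?z) = 0" for h
    proof -
      have lin: "linear (\<lambda>h. metric_deriv c (fst ?z) h (snd ?z) (snd ?z) + 2 * coord_metric c (fst ?z) 0 (snd ?z))"
        using has_derivative_linear[OF metric_coeff_has_derivative[OF c(1) x]]
        unfolding metric_deriv_def
        by (auto intro!: linearI simp: linear_add linear_scale algebra_simps sum.distrib sum_distrib_left coord_metric_def)
      have 0: "coord_metric c (fst ?z) 0 (snd ?z) = 0" by (simp add: coord_metric_def)
      have 1: "metric_deriv c (fst ?z) (h *\<^sub>R snd ?z) (snd ?z) (snd ?z) = h * metric_deriv c (fst ?z) (snd ?z) (snd ?z) (snd ?z)"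
        using linear_scale[OF lin, of h "snd ?z"] 0 by simp
      have 2: "coord_metric c (fst ?z) (h *\<^sub>R w) (snd ?z) = h * coord_metric c (fst ?z) (snd ?z) w" for w
        using coord_metric_sym[OF c(1) x, of w "snd ?z"] bounded_bilinear.scaleR_left[OF coord_metric_bilinear[of c "fst ?z"], of h w "snd ?z"] by simp
      show ?thesis
        using geodesic_field_lowered[OF c(1) x, of "snd ?z" "snd ?z"] unfolding 1 2 by (simp add: algebra_simps)
    qed
    ultimately have "((\<lambda>u. lagrangian c (phase c \<gamma> u)) has_derivative (\<lambda>h. 0)) (at s within {0..1})"
      by simp
    then show ?thesis
      by (rule has_derivative_transform_within[OF _ e(1) s])
         (use e(2) lagrangian_phase[OF geod_differentiable[OF \<gamma>] c(1)] in \<open>auto simp: dist_real_def\<close>)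
  qed
  then show ?thesis
    using has_derivative_zero_unique[of "{0..1}" ?E 0 t] t by auto
qed

end


context spacetime
begin

section \<open>The first variation of the energy\<close>

definition energy :: "(real \<Rightarrow> 'm) \<Rightarrow> real" where
  "energy \<gamma> = g (\<gamma> 0) (vel \<gamma> 0) (vel \<gamma> 0)"

text \<open>The estimate that is carried along the reference geodesic \<open>\<tau>\<close>: the deviation of \<open>\<sigma>\<close> is of first order in
  \<open>\<delta>\<close>, and \<open>s (E(\<sigma>) - E(\<tau>))\<close> agrees with the momentum term \<open>2 g(\<tau>'(s), \<sigma>(s) - \<tau>(s))\<close>, the difference
  being taken in the chart \<open>c\<close>, up to second order. As energy is conserved, the factor \<open>s\<close> replaces an integral over \<open>[0, s]\<close>.\<close>

definition variation_bound where
  "variation_bound c \<sigma> \<tau> s K \<delta> \<longleftrightarrow> \<sigma> s \<in> fst c \<and>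
     dist (phase c \<sigma> s) (phase c \<tau> s) \<le> K * \<delta> \<and>
     \<bar>s * (energy \<sigma> - energy \<tau>)
       - 2 * coord_metric c (snd c (\<tau> s)) (snd c (\<sigma> s) - snd c (\<tau> s)) (vel \<tau> s c)\<bar> \<le> K * \<delta>\<^sup>2"

lemma coord_metric_transition:
  assumes "c \<in> A" "d \<in> A" "q \<in> fst c" "q \<in> fst d"
  shows "coord_metric d (snd d q) (trans_deriv c d (snd c q) u) (trans_deriv c d (snd c q) w)
       = coord_metric c (snd c q) u w"
proof -
  have "coord_vec A c q u d = trans_deriv c d (snd c q) u" for u
    using assms by (simp add: coord_vec_def)
  then show ?thesis
    using g_coord[OF coord_vec_tangent[OF assms(1,3)] coord_vec_tangent[OF assms(1,3)] assms(1,3), of u w]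
      g_coord[OF coord_vec_tangent[OF assms(1,3)] coord_vec_tangent[OF assms(1,3)] assms(2,4), of u w]
    by (simp add: assms)
qed

text \<open>The tangent map of a change of charts.\<close>

definition phase_transition where
  "phase_transition c d z = (transition c d (fst z), trans_deriv c d (fst z) (snd z))"

lemma phase_transition_locally_lipschitz:
  assumes "c \<in> A" "d \<in> A"
  shows "locally_lipschitz_on (phase_transition c d) (snd c ` (fst c \<inter> fst d) \<times> UNIV)"
proof -
  let ?S = "snd c ` (fst c \<inter> fst d) \<times> (UNIV :: (real ^ 'n) set)"
  have open_S: "open (snd c ` (fst c \<inter> fst d))"
    by (rule chart_overlap_open[OF assms])
  have id: "locally_lipschitz_on (\<lambda>z. z) ?S"
    by (rule bounded_linear.locally_lipschitz[OF bounded_linear_ident])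
  have 1: "locally_lipschitz_on (\<lambda>z. transition c d (fst z)) ?S"
    by (rule locally_lipschitz_compose[OF locally_lipschitz_fst[OF id]
          Ck1_imp_locally_lipschitz[OF transition_Ck1(1)[OF assms] open_S]]) auto
  have 2: "locally_lipschitz_on (\<lambda>z. trans_deriv c d (fst z) u) ?S" for u
    by (rule locally_lipschitz_compose[OF locally_lipschitz_fst[OF id]
          Ck1_imp_locally_lipschitz[OF transition_Ck1(2)[OF assms] open_S]]) auto
  have 3: "locally_lipschitz_on (\<lambda>z. \<Sum>i\<in>UNIV. snd z $ i *\<^sub>R trans_deriv c d (fst z) (axis i 1)) ?S"
    by (intro locally_lipschitz_sum locally_lipschitz_scaleR 2 locally_lipschitz_vec_nth locally_lipschitz_snd id)
  have "trans_deriv c d (fst z) (snd z) = (\<Sum>i\<in>UNIV. snd z $ i *\<^sub>R trans_deriv c d (fst z) (axis i 1))"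
    if "z \<in> ?S" for z
  proof -
    have "fst z \<in> snd c ` (fst c \<inter> fst d)" using that by auto
    then obtain q where q: "fst z = snd c q" "q \<in> fst c" "q \<in> fst d" by blast
    have "linear (trans_deriv c d (fst z))"
      using trans_deriv_linear[OF assms q(2,3)] q(1) by simp
    then show ?thesis by (rule linear_axis_expansion)
  qed
  with 3 have "locally_lipschitz_on (\<lambda>z. trans_deriv c d (fst z) (snd z)) ?S"
    by (subst locally_lipschitz_on_cong) auto
  with 1 show ?thesis
    unfolding phase_transition_def[abs_def] by (rule locally_lipschitz_pair)
qed

lemma phase_transition_phase:
  assumes "differentiable_curve \<gamma>" "c \<in> A" "d \<in> A" "t \<in> {0..1}" "\<gamma> t \<in> fst c" "\<gamma> t \<in> fst d"
  shows "phase d \<gamma> t = phase_transition c d (phase c \<gamma> t)"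
  using tangent_transform[OF velocity_tangent[OF assms(1,4)] assms(2,3,5,6)] assms
  by (simp add: phase_transition_def phase_def)

text \<open>The variation bound does not depend on the chart: the momentum term is invariant up to the
  second-order error of the transition map.\<close>

lemma variation_bound_transition:
  assumes \<tau>: "differentiable_curve \<tau>" and s: "s \<in> {0..1}"
    and cd: "c \<in> A" "d \<in> A" "\<tau> s \<in> fst c" "\<tau> s \<in> fst d"
  obtains K' \<eta> where "\<eta> > 0"
    "\<And>\<sigma> \<delta>. differentiable_curve \<sigma> \<Longrightarrow> \<sigma> s \<in> fst d \<Longrightarrow> 0 \<le> \<delta> \<Longrightarrow> \<delta> < \<eta> \<Longrightarrow>
       variation_bound c \<sigma> \<tau> s K \<delta> \<Longrightarrow> variation_bound d \<sigma> \<tau> s K' \<delta>"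
proof -
  let ?zo = "phase c \<tau> s" and ?xo = "snd c (\<tau> s)" and ?O = "snd c ` (fst c \<inter> fst d)"
  have z0: "?zo \<in> ?O \<times> UNIV" and x0: "?xo \<in> ?O" using cd by (auto simp: phase_def)
  obtain r1 L where r1: "r1 > 0" "L \<ge> 0" and L: "\<And>y z. y \<in> ?O \<times> UNIV \<Longrightarrow> z \<in> ?O \<times> UNIV \<Longrightarrow>
      dist y ?zo \<le> r1 \<Longrightarrow> dist z ?zo \<le> r1 \<Longrightarrow> dist (phase_transition c d y) (phase_transition c d z) \<le> L * dist y z"
    using locally_lipschitz_onE[OF phase_transition_locally_lipschitz[OF cd(1,2)] z0] by metis
  obtain r2 Q where r2: "r2 > 0" "Q \<ge> 0" and Q: "\<And>y z. y \<in> cball ?xo r2 \<Longrightarrow> z \<in> cball ?xo r2 \<Longrightarrow>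
      norm (transition c d z - transition c d y - trans_deriv c d y (z - y)) \<le> Q * (norm (z - y))\<^sup>2"
    using Ck1_quadratic_remainder[OF transition_Ck1(1)[OF cd(1,2)] chart_overlap_open[OF cd(1,2)] x0] by metis
  let ?v = "vel \<tau> s d" and ?yo = "snd d (\<tau> s)"
  obtain B where B: "B > 0" "\<And>u w. \<bar>coord_metric d ?yo u w\<bar> \<le> norm u * norm w * B"
    using bounded_bilinear.pos_bounded[OF coord_metric_bilinear[of d ?yo]] by auto
  define M where "M = \<bar>K\<bar>"
  define K' where "K' = L * M + (M + 2 * (Q * M\<^sup>2 * norm ?v * B))"
  have M: "M \<ge> 0" by (simp add: M_def)
  show thesis
  proof (rule that)
    show "min r1 r2 / (M + 1) > 0" using r1 r2 M by simp
    fix \<sigma> \<delta> assume \<sigma>: "differentiable_curve \<sigma>" "\<sigma> s \<in> fst d" and \<delta>: "0 \<le> \<delta>" "\<delta> < min r1 r2 / (M + 1)"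
      and vb: "variation_bound c \<sigma> \<tau> s K \<delta>"
    let ?z = "phase c \<sigma> s" and ?x = "snd c (\<sigma> s)"
    have c: "\<sigma> s \<in> fst c" and dz: "dist ?z ?zo \<le> M * \<delta>" and mom: "\<bar>s * (energy \<sigma> - energy \<tau>)
       - 2 * coord_metric c ?xo (?x - ?xo) (vel \<tau> s c)\<bar> \<le> M * \<delta>\<^sup>2"
      using vb \<delta>(1) order_trans[OF _ mult_right_mono[OF abs_ge_self[of K]]]
      unfolding variation_bound_def M_def by auto
    have "M * \<delta> \<le> (M + 1) * \<delta>" using \<delta> by (simp add: algebra_simps)
    also have "\<dots> < min r1 r2" using \<delta>(2) M by (simp add: field_simps)
    finally have small: "M * \<delta> < r1" "M * \<delta> < r2" by auto
    have "norm (?x - ?xo) \<le> norm (?z - ?zo)"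
      by (simp add: phase_def norm_fst_le)
    also have "\<dots> \<le> M * \<delta>" using dz by (simp add: dist_norm)
    finally have dx: "norm (?x - ?xo) \<le> M * \<delta>" .
    define R where "R = snd d (\<sigma> s) - ?yo - trans_deriv c d ?xo (?x - ?xo)"
    have "norm R \<le> Q * (norm (?x - ?xo))\<^sup>2"
      using Q[of ?xo ?x] dx small r2 cd c by (simp add: R_def dist_norm norm_minus_commute)
    also have "\<dots> \<le> Q * (M * \<delta>)\<^sup>2"
      using dx r2 by (intro mult_left_mono power_mono) auto
    finally have R: "norm R \<le> Q * M\<^sup>2 * \<delta>\<^sup>2" by (simp add: power_mult_distrib mult_ac)
    have "coord_metric d ?yo (snd d (\<sigma> s) - ?yo) ?v
        = coord_metric d ?yo (trans_deriv c d ?xo (?x - ?xo)) ?v + coord_metric d ?yo R ?v"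
      by (simp add: R_def bounded_bilinear.diff_left[OF coord_metric_bilinear])
    also have "coord_metric d ?yo (trans_deriv c d ?xo (?x - ?xo)) ?v = coord_metric c ?xo (?x - ?xo) (vel \<tau> s c)"
      using tangent_transform[OF velocity_tangent[OF \<tau> s] cd] coord_metric_transition[OF cd] by simp
    finally have split: "coord_metric d ?yo (snd d (\<sigma> s) - ?yo) ?v
      = coord_metric c ?xo (?x - ?xo) (vel \<tau> s c) + coord_metric d ?yo R ?v" .
    have "\<bar>coord_metric d ?yo R ?v\<bar> \<le> norm R * norm ?v * B" by (rule B)
    also have "\<dots> \<le> Q * M\<^sup>2 * \<delta>\<^sup>2 * norm ?v * B"
      using R B by (intro mult_right_mono) auto
    finally have "\<bar>s * (energy \<sigma> - energy \<tau>) - 2 * coord_metric d ?yo (snd d (\<sigma> s) - ?yo) ?v\<bar>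
        \<le> M * \<delta>\<^sup>2 + 2 * (Q * M\<^sup>2 * \<delta>\<^sup>2 * norm ?v * B)"
      unfolding split
      using mom order_trans[OF abs_triangle_ineq4[of "s * (energy \<sigma> - energy \<tau>) - 2 * coord_metric c ?xo (?x - ?xo) (vel \<tau> s c)" "2 * coord_metric d ?yo R ?v"]]
      by (simp add: abs_mult algebra_simps)
    also have "\<dots> = (M + 2 * (Q * M\<^sup>2 * norm ?v * B)) * \<delta>\<^sup>2"
      by (simp add: algebra_simps)
    also have "\<dots> \<le> K' * \<delta>\<^sup>2"
      using r1 M by (intro mult_right_mono) (auto simp: K'_def)
    finally have m: "\<bar>s * (energy \<sigma> - energy \<tau>) - 2 * coord_metric d ?yo (snd d (\<sigma> s) - ?yo) ?v\<bar> \<le> K' * \<delta>\<^sup>2" .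
    have "dist (phase d \<sigma> s) (phase d \<tau> s) = dist (phase_transition c d ?z) (phase_transition c d ?zo)"
      using phase_transition_phase[OF \<sigma>(1) cd(1,2) s c \<sigma>(2)] phase_transition_phase[OF \<tau> cd(1,2) s cd(3,4)] by simp
    also have "\<dots> \<le> L * dist ?z ?zo"
      using dz small r1 z0 c \<sigma>(2) by (intro L) (auto simp: phase_def)
    also have "\<dots> \<le> L * (M * \<delta>)" using dz r1 by (intro mult_left_mono) auto
    also have "\<dots> = L * M * \<delta>" by simp
    also have "\<dots> \<le> K' * \<delta>"
      using \<delta> r2 M B by (intro mult_right_mono) (auto simp: K'_def)
    finally show "variation_bound d \<sigma> \<tau> s K' \<delta>"
      using m \<sigma>(2) by (simp add: variation_bound_def)
  qed
qed

text \<open>Along two neighbouring geodesics, the Euler-Lagrange equation makes the derivative of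
  \<open>s (E(\<sigma>) - E(\<tau>)) - 2 g(\<tau>', \<sigma> - \<tau>)\<close> equal to the remainder of the first-order Taylor formula of the
  Lagrangian.\<close>

lemma variation_derivative:
  assumes \<sigma>: "geod \<sigma>" and \<tau>: "geod \<tau>" and c: "c \<in> A" and t: "t \<in> {0..1}" "\<sigma> t \<in> fst c" "\<tau> t \<in> fst c"
  shows "((\<lambda>s. s * (energy \<sigma> - energy \<tau>)
       - 2 * coord_metric c (snd c (\<tau> s)) (snd c (\<sigma> s) - snd c (\<tau> s)) (vel \<tau> s c)) has_derivative
     (\<lambda>h. h * (lagrangian c (phase c \<sigma> t) - lagrangian c (phase c \<tau> t)
        - frechet_derivative (lagrangian c) (at (phase c \<tau> t)) (phase c \<sigma> t - phase c \<tau> t))))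
     (at t within {0..1})"
proof -
  let ?xo = "snd c (\<tau> t)" and ?vo = "vel \<tau> t c" and ?x = "snd c (\<sigma> t)" and ?v = "vel \<sigma> t c"
  let ?a = "snd (geodesic_field c (?xo, ?vo))"
  have x0: "?xo \<in> snd c ` fst c" and z0: "phase c \<tau> t \<in> phase_domain c" using t by (auto simp: phase_def)
  have X0: "((\<lambda>s. snd c (\<tau> s)) has_derivative (\<lambda>h. h *\<^sub>R ?vo)) (at t within {0..1})"
    using velocity_has_vector_derivative[OF geod_differentiable[OF \<tau>] c t(1,3)]
    by (simp add: o_def has_vector_derivative_def)
  have X: "((\<lambda>s. snd c (\<sigma> s)) has_derivative (\<lambda>h. h *\<^sub>R ?v)) (at t within {0..1})"
    using velocity_has_vector_derivative[OF geod_differentiable[OF \<sigma>] c t(1,2)]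
    by (simp add: o_def has_vector_derivative_def)
  have V0: "((\<lambda>s. vel \<tau> s c) has_derivative (\<lambda>h. h *\<^sub>R ?a)) (at t within {0..1})"
    using \<tau> c t by (simp add: geodesic_solution_def geodesic_field_def has_vector_derivative_def)
  note B = coord_metric_bilinear[of c ?xo]
  have mlin: "metric_deriv c ?xo (h *\<^sub>R u) w y = h * metric_deriv c ?xo u w y" for h u w y
    using has_derivative_linear[OF metric_coeff_has_derivative[OF c x0]]
    by (simp add: metric_deriv_def linear_scale sum_distrib_left mult_ac)
  have "((\<lambda>s. s * (energy \<sigma> - energy \<tau>)
       - 2 * coord_metric c (snd c (\<tau> s)) (snd c (\<sigma> s) - snd c (\<tau> s)) (vel \<tau> s c)) has_derivative
     (\<lambda>h. h * (energy \<sigma> - energy \<tau>) - 2 * (metric_deriv c ?xo (h *\<^sub>R ?vo) (?x - ?xo) ?vo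
        + coord_metric c ?xo (h *\<^sub>R ?v - h *\<^sub>R ?vo) ?vo + coord_metric c ?xo (?x - ?xo) (h *\<^sub>R ?a))))
     (at t within {0..1})"
    using t by (intro has_derivative_diff has_derivative_mult_right has_derivative_mult_left has_derivative_ident
        coord_metric_has_derivative[OF c] x0 X0 X V0)
  moreover have "h * (energy \<sigma> - energy \<tau>) - 2 * (metric_deriv c ?xo (h *\<^sub>R ?vo) (?x - ?xo) ?vo
        + coord_metric c ?xo (h *\<^sub>R ?v - h *\<^sub>R ?vo) ?vo + coord_metric c ?xo (?x - ?xo) (h *\<^sub>R ?a))
      = h * (lagrangian c (phase c \<sigma> t) - lagrangian c (phase c \<tau> t)
        - frechet_derivative (lagrangian c) (at (phase c \<tau> t)) (phase c \<sigma> t - phase c \<tau> t))" for h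
  proof -
    have e: "energy \<sigma> = lagrangian c (phase c \<sigma> t)" "energy \<tau> = lagrangian c (phase c \<tau> t)"
      using lagrangian_phase[OF geod_differentiable[OF \<sigma>] c t(1,2)] geod_energy_constant[OF \<sigma> t(1)]
        lagrangian_phase[OF geod_differentiable[OF \<tau>] c t(1,3)] geod_energy_constant[OF \<tau> t(1)]
      by (simp_all add: energy_def)
    have f: "frechet_derivative (lagrangian c) (at (phase c \<tau> t)) (phase c \<sigma> t - phase c \<tau> t)
       = metric_deriv c ?xo (?x - ?xo) ?vo ?vo + 2 * coord_metric c ?xo (?v - ?vo) ?vo"
      using lagrangian_frechet[OF c z0] by (simp add: phase_def)
    have v: "coord_metric c ?xo (h *\<^sub>R ?v - h *\<^sub>R ?vo) ?vo = h * coord_metric c ?xo (?v - ?vo) ?vo"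
      by (simp add: bounded_bilinear.scaleR_left[OF B] flip: scaleR_diff_right)
    show ?thesis
      unfolding e f v mlin bounded_bilinear.scaleR_right[OF B] geodesic_field_lowered[OF c x0] real_scaleR_def
      by (simp add: algebra_simps)
  qed
  ultimately show ?thesis by simp
qed

text \<open>Within a single chart, the comparison lemma transports the first-order bound, and integrating the
  Taylor remainder of the Lagrangian transports the second-order bound.\<close>

lemma variation_bound_propagates:
  assumes \<tau>: "geod \<tau>" and x: "x \<in> {0..1}"
  obtains c e where "c \<in> A" "e > 0" "\<tau> x \<in> fst c"
    "\<And>a b. 0 \<le> a \<Longrightarrow> a \<le> x \<Longrightarrow> x \<le> b \<Longrightarrow> b \<le> 1 \<Longrightarrow> b - a < e \<Longrightarrow> \<tau> a \<in> fst c \<and> \<tau> b \<in> fst c"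
    "\<And>a b K. 0 \<le> a \<Longrightarrow> a \<le> x \<Longrightarrow> x \<le> b \<Longrightarrow> b \<le> 1 \<Longrightarrow> b - a < e \<Longrightarrow>
       \<exists>K' \<eta>. \<eta> > 0 \<and> (\<forall>\<sigma> \<delta>. geod \<sigma> \<longrightarrow> (\<forall>u\<in>{a..b}. \<sigma> u \<in> fst c) \<longrightarrow> 0 \<le> \<delta> \<longrightarrow> \<delta> < \<eta> \<longrightarrow>
         variation_bound c \<sigma> \<tau> a K \<delta> \<longrightarrow> variation_bound c \<sigma> \<tau> b K' \<delta>)"
proof -
  obtain c where c: "c \<in> A" "\<tau> x \<in> fst c" by (rule chart_at)
  let ?zo = "phase c \<tau> x"
  have z0: "?zo \<in> phase_domain c" using c by (auto simp: phase_def)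
  obtain r1 K1 where r1: "r1 > 0" "K1-lipschitz_on (cball ?zo (2 * r1)) (geodesic_field c)"
    using geodesic_field_lipschitz_near[OF c(1) z0] by metis
  have K1: "K1 \<ge> 0" using r1(2) by (rule lipschitz_on_nonneg)
  obtain r2 K2 where r2: "r2 > 0" "K2 \<ge> 0" and K2: "\<And>y z. y \<in> cball ?zo r2 \<Longrightarrow> z \<in> cball ?zo r2 \<Longrightarrow>
       norm (lagrangian c z - lagrangian c y - frechet_derivative (lagrangian c) (at y) (z - y)) \<le> K2 * (norm (z - y))\<^sup>2"
    using Ck1_quadratic_remainder[OF lagrangian_Ck1[OF c(1)] phase_domain_open[OF c(1)] z0] by metis
  \<comment> \<open>The reference geodesic will stay within distance \<open>r\<close> of its phase at \<open>x\<close> and the other one within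
    \<open>2 * r\<close>, where both the Lipschitz bound of the field and the Taylor estimate are valid.\<close>
  define r where "r = min r1 (r2 / 2)"
  have r: "r > 0" "2 * r \<le> r2" "2 * r \<le> 2 * r1" using r1 r2 by (auto simp: r_def)
  have lip: "K1-lipschitz_on (cball ?zo (2 * r)) (geodesic_field c)"
    using r by (intro lipschitz_on_subset[OF r1(2)] subset_cball) auto
  obtain e where e: "e > 0" "\<And>s. s \<in> {0..1} \<Longrightarrow> \<bar>s - x\<bar> < e \<Longrightarrow> \<tau> s \<in> fst c"
    "\<And>s. s \<in> {0..1} \<Longrightarrow> \<bar>s - x\<bar> < e \<Longrightarrow> phase c \<tau> s \<in> cball ?zo r"
    using phase_stays_near[OF \<tau> c(1) x c(2) r(1)] by metis
  show thesis
  proof (rule that[OF c(1) e(1) c(2)])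
    fix a b :: real assume "0 \<le> a" "a \<le> x" "x \<le> b" "b \<le> 1" "b - a < e"
    then show "\<tau> a \<in> fst c \<and> \<tau> b \<in> fst c" using e(2)[of a] e(2)[of b] by auto
  next
    fix a b K :: real assume ab: "0 \<le> a" "a \<le> x" "x \<le> b" "b \<le> 1" "b - a < e"
    define M where "M = \<bar>K\<bar> * exp (K1 * (b - a))"
    have M: "M \<ge> 0" by (simp add: M_def)
    have near: "s \<in> {0..1}" "\<bar>s - x\<bar> < e" if "s \<in> {a..b}" for s using that ab by auto
    show "\<exists>K' \<eta>. \<eta> > 0 \<and> (\<forall>\<sigma> \<delta>. geod \<sigma> \<longrightarrow> (\<forall>u\<in>{a..b}. \<sigma> u \<in> fst c) \<longrightarrow> 0 \<le> \<delta> \<longrightarrow> \<delta> < \<eta> \<longrightarrow>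
         variation_bound c \<sigma> \<tau> a K \<delta> \<longrightarrow> variation_bound c \<sigma> \<tau> b K' \<delta>)"
    proof (intro exI conjI allI impI)
      show "r / (M + 1) > 0" using r M by simp
      fix \<sigma> \<delta> assume \<sigma>: "geod \<sigma>" and \<sigma>c: "\<forall>u\<in>{a..b}. \<sigma> u \<in> fst c" and \<delta>: "0 \<le> \<delta>" "\<delta> < r / (M + 1)"
        and vb: "variation_bound c \<sigma> \<tau> a K \<delta>"
      define \<psi> where "\<psi> s = s * (energy \<sigma> - energy \<tau>)
       - 2 * coord_metric c (snd c (\<tau> s)) (snd c (\<sigma> s) - snd c (\<tau> s)) (vel \<tau> s c)" for s
      let ?d = "\<lambda>s. dist (phase c \<sigma> s) (phase c \<tau> s)"
      have da: "?d a \<le> \<bar>K\<bar> * \<delta>" and \<psi>a: "\<bar>\<psi> a\<bar> \<le> \<bar>K\<bar> * \<delta>\<^sup>2"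
        using vb \<delta>(1) order_trans[OF _ mult_right_mono[OF abs_ge_self[of K]]]
        unfolding variation_bound_def \<psi>_def by auto
      have "?d a * exp (K1 * (b - a)) \<le> \<bar>K\<bar> * \<delta> * exp (K1 * (b - a))"
        using da by (intro mult_right_mono) auto
      then have dM: "?d a * exp (K1 * (b - a)) \<le> M * \<delta>"
        by (simp add: M_def mult_ac)
      have "M * \<delta> \<le> (M + 1) * \<delta>" using \<delta> by (simp add: algebra_simps)
      also have "\<dots> < r" using \<delta>(2) M by (simp add: field_simps)
      finally have small: "M * \<delta> < r" .
      have d: "?d s \<le> M * \<delta>" if s: "s \<in> {a..b}" for s
      proof -
        have "?d s \<le> ?d a * exp (K1 * (b - a))"
        proof (rule ode_comparison[OF lip])
          fix u assume u: "u \<in> {a..b}"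
          show "(phase c \<tau> has_vector_derivative geodesic_field c (phase c \<tau> u)) (at u within {a..b})"
            using near[OF u] e ab by (intro has_vector_derivative_within_subset[OF phase_derivative[OF \<tau> c(1)]]) auto
          show "(phase c \<sigma> has_vector_derivative geodesic_field c (phase c \<sigma> u)) (at u within {a..b})"
            using near[OF u] u \<sigma>c ab by (intro has_vector_derivative_within_subset[OF phase_derivative[OF \<sigma> c(1)]]) auto
          show "phase c \<tau> u \<in> cball ?zo r" using near[OF u] e by auto
        qed (use dM small s in auto)
        with dM show ?thesis by linarith
      qed
      have "norm (\<psi> b - \<psi> a) \<le> K2 * (M * \<delta>)\<^sup>2 * norm (b - a)"
      proof (rule differentiable_bound[where S = "{a..b}"])
        fix s assume s: "s \<in> {a..b}"
        let ?D = "lagrangian c (phase c \<sigma> s) - lagrangian c (phase c \<tau> s)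
          - frechet_derivative (lagrangian c) (at (phase c \<tau> s)) (phase c \<sigma> s - phase c \<tau> s)"
        have "(\<psi> has_derivative (\<lambda>h. h * ?D)) (at s within {0..1})"
          unfolding \<psi>_def[abs_def] using variation_derivative[OF \<sigma> \<tau> c(1) near(1)[OF s]] s \<sigma>c e(2) near[OF s] by blast
        then show "(\<psi> has_derivative (\<lambda>h. h * ?D)) (at s within {a..b})"
          by (rule has_derivative_subset) (use ab in auto)
        have z: "phase c \<tau> s \<in> cball ?zo r" using e near[OF s] by blast
        have "phase c \<sigma> s \<in> cball ?zo (2 * r)"
          using z d[OF s] small dist_triangle[of ?zo "phase c \<sigma> s" "phase c \<tau> s"] by (auto simp: dist_commute)
        then have "\<bar>?D\<bar> \<le> K2 * (?d s)\<^sup>2"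
          using K2[of "phase c \<tau> s" "phase c \<sigma> s"] z r by (auto simp: dist_norm)
        also have "\<dots> \<le> K2 * (M * \<delta>)\<^sup>2"
          using d[OF s] r2 by (intro mult_left_mono power_mono) auto
        finally have "\<bar>?D\<bar> \<le> K2 * (M * \<delta>)\<^sup>2" .
        then have "norm (h * ?D) \<le> K2 * (M * \<delta>)\<^sup>2 * norm h" for h
          using mult_right_mono[of "\<bar>?D\<bar>" "K2 * (M * \<delta>)\<^sup>2" "\<bar>h\<bar>"] by (simp add: abs_mult mult_ac)
        then show "onorm (\<lambda>h. h * ?D) \<le> K2 * (M * \<delta>)\<^sup>2"
          by (rule onorm_le)
      qed (use ab in auto)
      also have "\<dots> \<le> K2 * (M * \<delta>)\<^sup>2 * 1"
        using ab r2 by (intro mult_left_mono) auto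
      finally have "\<bar>\<psi> b - \<psi> a\<bar> \<le> K2 * M\<^sup>2 * \<delta>\<^sup>2" by (simp add: power_mult_distrib mult_ac)
      then have "\<bar>\<psi> b\<bar> \<le> (\<bar>K\<bar> + K2 * M\<^sup>2) * \<delta>\<^sup>2" using \<psi>a by (simp add: algebra_simps)
      also have "\<dots> \<le> (M + (\<bar>K\<bar> + K2 * M\<^sup>2)) * \<delta>\<^sup>2" using M by (intro mult_right_mono) auto
      finally have \<psi>b: "\<bar>\<psi> b\<bar> \<le> (M + (\<bar>K\<bar> + K2 * M\<^sup>2)) * \<delta>\<^sup>2" .
      have "?d b \<le> M * \<delta>" using d ab by auto
      also have "\<dots> \<le> (M + (\<bar>K\<bar> + K2 * M\<^sup>2)) * \<delta>" using \<delta> r2 by (intro mult_right_mono) auto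
      finally show "variation_bound c \<sigma> \<tau> b (M + (\<bar>K\<bar> + K2 * M\<^sup>2)) \<delta>"
        using \<psi>b \<sigma>c ab by (auto simp: variation_bound_def \<psi>_def)
    qed
  qed
qed

text \<open>A geodesic need not lie in one chart, so the variation bound is carried from \<open>0\<close> to \<open>1\<close> through
  finitely many charts, which the bisection principle for intervals does implicitly. In the limit
  \<open>\<delta> \<rightarrow> 0\<close> the resulting estimate says that the energy, as a function of the end point, has derivative
  \<open>2 g(\<tau>'(1), \<cdot>)\<close>.\<close>

lemma first_variation:
  fixes \<sigma> :: "'i \<Rightarrow> real \<Rightarrow> 'm"
  assumes \<sigma>: "\<And>i. geod (\<sigma> i)" and \<tau>: "geod \<tau>"
    and \<delta>: "(\<delta> \<longlongrightarrow> 0) F" "\<And>i. \<delta> i \<ge> 0"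
    and unif: "\<And>s U. s \<in> {0..1} \<Longrightarrow> open U \<Longrightarrow> \<tau> s \<in> U \<Longrightarrow>
        \<exists>e>0. \<forall>\<^sub>F i in F. \<forall>u\<in>{0..1}. \<bar>u - s\<bar> < e \<longrightarrow> \<sigma> i u \<in> U"
    and start: "\<And>i. \<sigma> i 0 = \<tau> 0"
    and c0: "c0 \<in> A" "\<tau> 0 \<in> fst c0"
    and vel0: "\<forall>\<^sub>F i in F. dist (vel (\<sigma> i) 0 c0) (vel \<tau> 0 c0) \<le> K0 * \<delta> i"
    and c: "c \<in> A" "\<tau> 1 \<in> fst c"
  obtains K where "\<forall>\<^sub>F i in F. \<bar>energy (\<sigma> i) - energy \<tau>
       - 2 * coord_metric c (snd c (\<tau> 1)) (snd c (\<sigma> i 1) - snd c (\<tau> 1)) (vel \<tau> 1 c)\<bar> \<le> K * (\<delta> i)\<^sup>2"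
proof -
  define G where "G s \<longleftrightarrow> (\<forall>c\<in>A. \<tau> s \<in> fst c \<longrightarrow> (\<exists>K. \<forall>\<^sub>F i in F. variation_bound c (\<sigma> i) \<tau> s K (\<delta> i)))" for s
  have \<delta>small: "\<forall>\<^sub>F i in F. \<delta> i < \<eta>" if "\<eta> > 0" for \<eta>
    using \<delta>(1) that by (rule order_tendstoD)
  have in_chart: "\<forall>\<^sub>F i in F. \<sigma> i s \<in> fst d" if sd: "s \<in> {0..1}" "d \<in> A" "\<tau> s \<in> fst d" for s d
  proof -
    obtain e where "e > 0" "\<forall>\<^sub>F i in F. \<forall>u\<in>{0..1}. \<bar>u - s\<bar> < e \<longrightarrow> \<sigma> i u \<in> fst d"
      using unif[OF sd(1) chart_open(1)[OF sd(2)] sd(3)] by auto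
    then show ?thesis using sd(1) by (auto elim!: eventually_mono)
  qed
  have GI: "G s" if s: "s \<in> {0..1}" "d \<in> A" "\<tau> s \<in> fst d"
    and K: "\<forall>\<^sub>F i in F. variation_bound d (\<sigma> i) \<tau> s K (\<delta> i)" for s d K
    unfolding G_def
  proof (intro ballI impI)
    fix d' assume d': "d' \<in> A" "\<tau> s \<in> fst d'"
    obtain K' \<eta> where "\<eta> > 0" and K': "\<And>\<sigma> \<delta>. differentiable_curve \<sigma> \<Longrightarrow> \<sigma> s \<in> fst d' \<Longrightarrow> 0 \<le> \<delta> \<Longrightarrow> \<delta> < \<eta> \<Longrightarrow>
       variation_bound d \<sigma> \<tau> s K \<delta> \<Longrightarrow> variation_bound d' \<sigma> \<tau> s K' \<delta>"
      using variation_bound_transition[OF geod_differentiable[OF \<tau>] s(1,2) d'(1) s(3) d'(2)] by metis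
    have "\<forall>\<^sub>F i in F. variation_bound d' (\<sigma> i) \<tau> s K' (\<delta> i)"
      using K \<delta>small[OF \<open>\<eta> > 0\<close>] in_chart[OF s(1) d']
      by eventually_elim (rule K'; (assumption | rule geod_differentiable[OF \<sigma>] \<delta>(2)))
    then show "\<exists>K. \<forall>\<^sub>F i in F. variation_bound d' (\<sigma> i) \<tau> s K (\<delta> i)" ..
  qed
  have "\<forall>\<^sub>F i in F. variation_bound c0 (\<sigma> i) \<tau> 0 \<bar>K0\<bar> (\<delta> i)"
    using vel0
  proof eventually_elim
    case (elim i)
    also have "K0 * \<delta> i \<le> \<bar>K0\<bar> * \<delta> i" using \<delta>(2) by (intro mult_right_mono) auto
    finally show ?case
      using start[of i] c0 by (simp add: variation_bound_def phase_def dist_Pair_Pair bounded_bilinear.zero_left[OF coord_metric_bilinear])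
  qed
  then have G0: "G 0" using c0 by (intro GI) auto
  define P where "P a b \<longleftrightarrow> (0 \<le> a \<and> b \<le> 1 \<and> G a \<longrightarrow> G b)" for a b
  have "P 0 1"
  proof (induction rule: Bolzano[OF zero_le_one, case_names trans local])
    case (trans a b c)
    then show ?case by (auto simp: P_def)
  next
    case (local x)
    then have x: "x \<in> {0..1}" by auto
    obtain d e where d: "d \<in> A" "(e::real) > 0" "\<tau> x \<in> fst d"
      and in_d: "\<And>a b. 0 \<le> a \<Longrightarrow> a \<le> x \<Longrightarrow> x \<le> b \<Longrightarrow> b \<le> 1 \<Longrightarrow> b - a < e \<Longrightarrow> \<tau> a \<in> fst d \<and> \<tau> b \<in> fst d"
      and step: "\<And>a b K. 0 \<le> a \<Longrightarrow> a \<le> x \<Longrightarrow> x \<le> b \<Longrightarrow> b \<le> 1 \<Longrightarrow> b - a < e \<Longrightarrow>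
       \<exists>K' \<eta>. \<eta> > 0 \<and> (\<forall>\<sigma> \<delta>. geod \<sigma> \<longrightarrow> (\<forall>u\<in>{a..b}. \<sigma> u \<in> fst d) \<longrightarrow> 0 \<le> \<delta> \<longrightarrow> \<delta> < \<eta> \<longrightarrow>
         variation_bound d \<sigma> \<tau> a K \<delta> \<longrightarrow> variation_bound d \<sigma> \<tau> b K' \<delta>)"
    proof (rule variation_bound_propagates[OF \<tau> x], goal_cases)
      case (1 c e)
      show ?case by (rule 1(1)[OF 1(2-6)])
    qed
    obtain e' where e': "e' > 0" "\<forall>\<^sub>F i in F. \<forall>u\<in>{0..1}. \<bar>u - x\<bar> < e' \<longrightarrow> \<sigma> i u \<in> fst d"
      using unif[OF x chart_open(1)[OF d(1)] d(3)] by auto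
    have "P a b" if ab: "a \<le> x" "x \<le> b" "b - a < min e e'" for a b
      unfolding P_def
    proof (intro impI)
      assume asm: "0 \<le> a \<and> b \<le> 1 \<and> G a"
      then have \<sigma>d: "\<tau> a \<in> fst d" "\<tau> b \<in> fst d" using in_d[of a b] ab by auto
      then obtain K where K: "\<forall>\<^sub>F i in F. variation_bound d (\<sigma> i) \<tau> a K (\<delta> i)"
        using asm d(1) by (auto simp: G_def)
      have "\<exists>K' \<eta>. \<eta> > 0 \<and> (\<forall>\<sigma> \<delta>. geod \<sigma> \<longrightarrow> (\<forall>u\<in>{a..b}. \<sigma> u \<in> fst d) \<longrightarrow> 0 \<le> \<delta> \<longrightarrow> \<delta> < \<eta> \<longrightarrow>
         variation_bound d \<sigma> \<tau> a K \<delta> \<longrightarrow> variation_bound d \<sigma> \<tau> b K' \<delta>)"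
        by (rule step) (use ab asm in auto)
      then obtain K' \<eta> where "\<eta> > 0" and K': "\<And>\<sigma> \<delta>. geod \<sigma> \<Longrightarrow> (\<forall>u\<in>{a..b}. \<sigma> u \<in> fst d) \<Longrightarrow> 0 \<le> \<delta> \<Longrightarrow> \<delta> < \<eta> \<Longrightarrow>
         variation_bound d \<sigma> \<tau> a K \<delta> \<Longrightarrow> variation_bound d \<sigma> \<tau> b K' \<delta>"
        by blast
      have "\<forall>\<^sub>F i in F. variation_bound d (\<sigma> i) \<tau> b K' (\<delta> i)"
        using K \<delta>small[OF \<open>\<eta> > 0\<close>] e'(2)
      proof eventually_elim
        case (elim i)
        then show ?case using ab asm by (intro K' \<sigma> \<delta>(2)) auto
      qed
      then show "G b" using \<sigma>d ab asm d(1) x by (intro GI) auto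
    qed
    then show ?case using d(2) e'(1) by (intro exI[of _ "min e e'"]) auto
  qed
  then have "G 1" using G0 by (auto simp: P_def)
  then obtain K where "\<forall>\<^sub>F i in F. variation_bound c (\<sigma> i) \<tau> 1 K (\<delta> i)"
    using c by (auto simp: G_def)
  then show thesis
    by (intro that[of K]) (auto simp: variation_bound_def elim!: eventually_mono)
qed

end


section \<open>Geodesics in a convex normal set\<close>

locale convex_normal_set = spacetime A g
  for A :: "('m::t2_space, 'n::finite) chart set" and g :: "('m, 'n) metric_field" +
  fixes C :: "'m set"
  assumes convex: "convex_normal A g C"
begin

lemma C_open: "open C"
  using convex by (auto simp: convex_normal_def)

text \<open>The data that convexity provides at \<open>q\<close>: the domain \<open>N\<close> of the exponential map and its inverse \<open>h\<close>.\<close>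

definition normal_chart where
  "normal_chart q N h \<longleftrightarrow>
     openin (top_of_set (TM q)) N \<and>
     (\<forall>v\<in>N. \<forall>s\<in>{0..1}. (\<lambda>c. s *\<^sub>R v c) \<in> N) \<and>
     N \<subseteq> exp_domain A g q \<and>
     homeomorphism N C (exp_map A g q) h \<and>
     loc_lipschitz_to_tangent A q C h"

lemma normal_chart_exists:
  assumes "q \<in> C" obtains N h where "normal_chart q N h"
  using convex assms unfolding convex_normal_def normal_chart_def by blast

lemma exp_map_eq:
  assumes "geod \<gamma>"
  shows "exp_map A g (\<gamma> 0) (vel \<gamma> 0) = \<gamma> 1"
  unfolding exp_map_def
proof (rule the_equality)
  show "\<exists>\<beta>. geod \<beta> \<and> \<beta> 0 = \<gamma> 0 \<and> vel \<beta> 0 = vel \<gamma> 0 \<and> \<beta> 1 = \<gamma> 1"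
    using assms by blast
  show "p = \<gamma> 1" if "\<exists>\<beta>. geod \<beta> \<and> \<beta> 0 = \<gamma> 0 \<and> vel \<beta> 0 = vel \<gamma> 0 \<and> \<beta> 1 = p" for p
    using that geod_unique(1)[OF assms, of _ 1] by force
qed

lemma exp_map_scaled:
  assumes \<gamma>: "geod \<gamma>" and s: "s \<in> {0..1}"
  shows "exp_map A g (\<gamma> 0) (\<lambda>c. s *\<^sub>R vel \<gamma> 0 c) = \<gamma> s"
proof -
  have s': "0 \<in> {0..1::real}" "0 + s \<in> {0..1}" using s by auto
  note \<beta> = geod_affine[OF \<gamma> s']
  show ?thesis
    using exp_map_eq[OF \<beta>(1)] \<beta>(2)[of 0] by simp
qed

context
  fixes q N h
  assumes q: "q \<in> C" and nc: "normal_chart q N h"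
begin

lemma N_facts:
  "openin (top_of_set (TM q)) N" "\<And>v s. v \<in> N \<Longrightarrow> s \<in> {0..1} \<Longrightarrow> (\<lambda>c. s *\<^sub>R v c) \<in> N"
  "N \<subseteq> exp_domain A g q" "homeomorphism N C (exp_map A g q) h" "loc_lipschitz_to_tangent A q C h"
  using nc by (auto simp: normal_chart_def)

lemma N_subset: "N \<subseteq> TM q"
  using N_facts(1) openin_imp_subset by blast

lemma h_in_N: "y \<in> C \<Longrightarrow> h y \<in> N"
  using N_facts(4) by (auto simp: homeomorphism_def)

lemma exp_h: "y \<in> C \<Longrightarrow> exp_map A g q (h y) = y"
  using N_facts(4) by (auto simp: homeomorphism_def)

lemma h_exp: "v \<in> N \<Longrightarrow> h (exp_map A g q v) = v"
  using N_facts(4) by (auto simp: homeomorphism_def)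

lemma exp_in_C: "v \<in> N \<Longrightarrow> exp_map A g q v \<in> C"
  using N_facts(4) by (auto simp: homeomorphism_def)

lemma zero_in_N: "(\<lambda>_. 0) \<in> N"
  using N_facts(2)[OF h_in_N[OF q], of 0] by simp

lemma radial_geodesic:
  assumes "v \<in> N"
  obtains \<gamma> where "geod \<gamma>" "\<gamma> 0 = q" "vel \<gamma> 0 = v" "\<gamma> ` {0..1} \<subseteq> C"
proof -
  obtain \<gamma> where \<gamma>: "geod \<gamma>" "\<gamma> 0 = q" "vel \<gamma> 0 = v"
    using N_facts(3) assms by (auto simp: exp_domain_def)
  have "\<gamma> s \<in> C" if "s \<in> {0..1}" for s
    using exp_map_scaled[OF \<gamma>(1) that] exp_in_C[OF N_facts(2)[OF assms that]] \<gamma> by simp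
  then show thesis using \<gamma> that by blast
qed

text \<open>Along a geodesic from \<open>q\<close> inside \<open>C\<close>, the parameters \<open>s\<close> for which \<open>s v\<close> lies in the domain
  of the normal chart form an open set, as the domain is open, and a closed set, as they are those
  with \<open>h (\<gamma> s) = s v\<close>. So the domain consists of all initial velocities of such geodesics.\<close>

lemma geodesic_in_C_initial:
  assumes \<gamma>: "geod \<gamma>" "\<gamma> 0 = q" "\<gamma> ` {0..1} \<subseteq> C"
  shows "vel \<gamma> 0 \<in> N" "h (\<gamma> 1) = vel \<gamma> 0"
proof -
  obtain c where c: "c \<in> A" "q \<in> fst c" by (rule chart_at)
  let ?f = "\<lambda>s c. s *\<^sub>R vel \<gamma> 0 c"
  have v: "vel \<gamma> 0 \<in> TM q"
    using velocity_tangent[OF geod_differentiable[OF \<gamma>(1)], of 0] \<gamma>(2) by simp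
  have f: "?f s \<in> TM q" for s by (rule tangent_scale[OF v])
  have hf: "h (\<gamma> s) = ?f s" if "s \<in> {0..1}" "?f s \<in> N" for s
    using exp_map_scaled[OF \<gamma>(1) that(1)] h_exp[OF that(2)] \<gamma>(2) by simp
  define S where "S = {s \<in> {0..1::real}. ?f s \<in> N}"
  have "continuous_on {0..1} ?f"
    by (intro continuous_on_coordinatewise_then_product continuous_intros)
  then have "openin (top_of_set {0..1}) ({0..1} \<inter> ?f -` N)"
    by (rule continuous_openin_preimage[OF _ _ N_facts(1)]) (use f in auto)
  then have "openin (top_of_set {0..1}) S"
    by (simp add: S_def Int_def vimage_def)
  moreover have "S = {s \<in> {0..1}. h (\<gamma> s) c - s *\<^sub>R vel \<gamma> 0 c = 0}"
  proof -
    have "?f s \<in> N \<longleftrightarrow> h (\<gamma> s) c - s *\<^sub>R vel \<gamma> 0 c = 0" if s: "s \<in> {0..1}" for s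
    proof
      assume "?f s \<in> N"
      then have "h (\<gamma> s) = ?f s" using hf s by blast
      then have "h (\<gamma> s) c = s *\<^sub>R vel \<gamma> 0 c" by (rule fun_cong)
      then show "h (\<gamma> s) c - s *\<^sub>R vel \<gamma> 0 c = 0" by simp
    next
      assume "h (\<gamma> s) c - s *\<^sub>R vel \<gamma> 0 c = 0"
      moreover have hN: "h (\<gamma> s) \<in> N" using \<gamma>(3) s by (intro h_in_N) auto
      ultimately have "h (\<gamma> s) = ?f s"
        using N_subset f c by (intro tangent_eqI[of _ q]) auto
      then show "?f s \<in> N" using hN by simp
    qed
    then show ?thesis by (auto simp: S_def)
  qed
  moreover have "continuous_on {0..1} (\<lambda>s. h (\<gamma> s) c - s *\<^sub>R vel \<gamma> 0 c)"
  proof -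
    have "continuous_on C h" using N_facts(4) by (auto simp: homeomorphism_def)
    moreover have "continuous_on {0..1} \<gamma>" using geod_path[OF \<gamma>(1)] by (simp add: path_def)
    ultimately have "continuous_on {0..1} (\<lambda>s. h (\<gamma> s))"
      using \<gamma>(3) by (rule continuous_on_compose2)
    then have "continuous_on {0..1} (\<lambda>s. h (\<gamma> s) c)"
      by (rule continuous_on_product_then_coordinatewise)
    then show ?thesis by (intro continuous_intros)
  qed
  ultimately have "openin (top_of_set {0..1}) S" "closedin (top_of_set {0..1}) S"
    using continuous_closedin_preimage_constant[of "{0..1}" "\<lambda>s. h (\<gamma> s) c - s *\<^sub>R vel \<gamma> 0 c" 0]
    by simp_all
  moreover have "0 \<in> S" using zero_in_N by (simp add: S_def)
  ultimately have "S = {0..1}"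
    using connected_Icc[of "0::real" 1] unfolding connected_clopen by blast
  then have "1 \<in> S" by simp
  then show "vel \<gamma> 0 \<in> N" "h (\<gamma> 1) = vel \<gamma> 0"
    using hf[of 1] by (auto simp: S_def)
qed

end

definition connector :: "'m \<Rightarrow> 'm \<Rightarrow> real \<Rightarrow> 'm" where
  "connector q y = (SOME \<gamma>. geod \<gamma> \<and> \<gamma> 0 = q \<and> \<gamma> 1 = y \<and> \<gamma> ` {0..1} \<subseteq> C)"

text \<open>The inverse of the exponential map at \<open>q\<close>, written as the initial velocity of the geodesic inside \<open>C\<close>
  from \<open>q\<close> to \<open>y\<close>. This form avoids a choice of normal charts and shows what happens when \<open>q\<close> and \<open>y\<close>
  are exchanged.\<close>

definition exp_inv :: "'m \<Rightarrow> 'm \<Rightarrow> ('m, 'n) tvec" where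
  "exp_inv q y = vel (connector q y) 0"

lemma connector:
  assumes "q \<in> C" "y \<in> C"
  shows "geod (connector q y)" "connector q y 0 = q" "connector q y 1 = y" "connector q y ` {0..1} \<subseteq> C"
proof -
  obtain N h where nc: "normal_chart q N h" using normal_chart_exists[OF assms(1)] by blast
  obtain \<gamma> where \<gamma>: "geod \<gamma>" "\<gamma> 0 = q" "vel \<gamma> 0 = h y" "\<gamma> ` {0..1} \<subseteq> C"
    using radial_geodesic[OF assms(1) nc h_in_N[OF assms(1) nc assms(2)]] by metis
  have "\<gamma> 1 = y" using exp_map_eq[OF \<gamma>(1)] exp_h[OF assms(1) nc assms(2)] \<gamma> by simp
  with \<gamma> have "\<exists>\<gamma>. geod \<gamma> \<and> \<gamma> 0 = q \<and> \<gamma> 1 = y \<and> \<gamma> ` {0..1} \<subseteq> C" by blast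
  from someI_ex[OF this] show "geod (connector q y)" "connector q y 0 = q" "connector q y 1 = y" "connector q y ` {0..1} \<subseteq> C"
    unfolding connector_def by blast+
qed

lemma exp_inv_normal_chart:
  assumes "q \<in> C" "y \<in> C" "normal_chart q N h"
  shows "exp_inv q y = h y"
  using geodesic_in_C_initial(2)[OF assms(1,3) connector(1,2,4)[OF assms(1,2)]] connector(3)[OF assms(1,2)]
  by (simp add: exp_inv_def)

lemma exp_inv_unique:
  assumes "q \<in> C" "geod \<gamma>" "\<gamma> 0 = q" "\<gamma> ` {0..1} \<subseteq> C"
  shows "exp_inv q (\<gamma> 1) = vel \<gamma> 0"
proof -
  obtain N h where nc: "normal_chart q N h" using normal_chart_exists[OF assms(1)] by blast
  have "\<gamma> 1 \<in> C" using assms(4) by auto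
  then show ?thesis
    using geodesic_in_C_initial(2)[OF assms(1) nc assms(2-4)] exp_inv_normal_chart[OF assms(1) _ nc] by simp
qed

lemma exp_inv_tangent: "q \<in> C \<Longrightarrow> y \<in> C \<Longrightarrow> exp_inv q y \<in> TM q"
  using velocity_tangent[OF geod_differentiable[OF connector(1)], of q y 0] connector(2)[of q y]
  by (simp add: exp_inv_def)

lemma exp_inv_connector_end:
  assumes "q \<in> C" "y \<in> C"
  shows "exp_inv y q = (\<lambda>c. - vel (connector q y) 1 c)"
proof -
  note \<gamma> = connector[OF assms]
  have "exp_inv y (connector q y (1 - 1)) = vel (\<lambda>s. connector q y (1 - s)) 0"
    using \<gamma> by (intro exp_inv_unique assms geod_reverse(1)) auto
  then show ?thesis
    using geod_reverse(2)[OF \<gamma>(1), of 0] \<gamma>(2) by simp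
qed

lemma exp_inv_zero:
  assumes "q \<in> C" "y \<in> C" "exp_inv q y = (\<lambda>_. 0)"
  shows "y = q"
  using geod_velocity_zero(1)[OF connector(1)[OF assms(1,2)], of 0 1] assms connector(2,3)[OF assms(1,2)]
  by (simp add: exp_inv_def)

lemma exp_inv_initial_segment:
  assumes "q \<in> C" "y \<in> C" "s \<in> {0..1}"
  shows "exp_inv q (connector q y s) = (\<lambda>c. s *\<^sub>R exp_inv q y c)"
proof -
  note \<gamma> = connector[OF assms(1,2)]
  have s': "0 \<in> {0..1::real}" "0 + s \<in> {0..1}" using assms by auto
  note \<beta> = geod_affine[OF \<gamma>(1) s']
  have "exp_inv q (connector q y (0 + s * 1)) = vel (\<lambda>u. connector q y (0 + s * u)) 0"
    using \<gamma> unit_affine[OF s'] by (intro exp_inv_unique assms \<beta>(1)) auto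
  then show ?thesis
    using \<beta>(2)[of 0] by (simp add: exp_inv_def)
qed

lemma exp_inv_continuous:
  assumes "q \<in> C" shows "continuous_on C (exp_inv q)"
proof -
  obtain N h where nc: "normal_chart q N h" using normal_chart_exists[OF assms] by blast
  then have "continuous_on C h" by (auto simp: normal_chart_def homeomorphism_def)
  then show ?thesis
    using exp_inv_normal_chart[OF assms _ nc] by (subst continuous_on_cong[OF refl]) auto
qed

lemma exp_inv_locally_lipschitz:
  assumes "q \<in> C" "c \<in> A" "d \<in> A" "q \<in> fst c"
  shows "locally_lipschitz_on (\<lambda>x. exp_inv q (chart_inv d x) c) (snd d ` (C \<inter> fst d))"
proof -
  obtain N h where nc: "normal_chart q N h" using normal_chart_exists[OF assms(1)] by blast
  then have "locally_lipschitz_on (\<lambda>x. h (chart_inv d x) c) (snd d ` (C \<inter> fst d))"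
    using assms by (auto simp: normal_chart_def loc_lipschitz_to_tangent_def)
  then show ?thesis
    using exp_inv_normal_chart[OF assms(1) _ nc] assms(3) by (subst locally_lipschitz_on_cong) auto
qed

lemma connector_continuous:
  assumes q: "q \<in> C"
  shows "continuous_on ({0..1} \<times> C) (\<lambda>p. connector q (snd p) (fst p))"
proof -
  obtain N h where nc: "normal_chart q N h" using normal_chart_exists[OF q] by blast
  have "continuous_on ({0..1} \<times> C) (\<lambda>p c. fst p *\<^sub>R exp_inv q (snd p) c)"
  proof (rule continuous_on_coordinatewise_then_product)
    fix c
    have "continuous_on C (\<lambda>y. exp_inv q y c)"
      using exp_inv_continuous[OF q] by (rule continuous_on_product_then_coordinatewise)
    then have "continuous_on ({0..1} \<times> C) (\<lambda>p. exp_inv q (snd p) c)"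
      by (rule continuous_on_compose2) (auto intro!: continuous_intros)
    then show "continuous_on ({0..1} \<times> C) (\<lambda>p. fst p *\<^sub>R exp_inv q (snd p) c)"
      by (intro continuous_intros)
  qed
  moreover have "continuous_on N (exp_map A g q)"
    using nc by (auto simp: normal_chart_def homeomorphism_def)
  moreover have "(\<lambda>p c. fst p *\<^sub>R exp_inv q (snd p) c) ` ({0..1} \<times> C) \<subseteq> N"
    using N_facts(2)[OF q nc] h_in_N[OF q nc] exp_inv_normal_chart[OF q _ nc] by auto
  ultimately have "continuous_on ({0..1} \<times> C) (\<lambda>p. exp_map A g q (\<lambda>c. fst p *\<^sub>R exp_inv q (snd p) c))"
    by (intro continuous_on_compose2[of N "exp_map A g q" "{0..1} \<times> C" "\<lambda>p c. fst p *\<^sub>R exp_inv q (snd p) c"])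
  moreover have "connector q y s = exp_map A g q (\<lambda>c. s *\<^sub>R exp_inv q y c)" if "s \<in> {0..1}" "y \<in> C" for s y
    using exp_map_scaled[OF connector(1)[OF q that(2)] that(1)] connector(2)[OF q that(2)]
    by (simp add: exp_inv_def)
  ultimately show ?thesis
    by (subst continuous_on_cong[OF refl]) auto
qed

lemma exp_small:
  assumes p: "p \<in> C" and X: "X \<in> TM p"
  defines "\<beta> \<equiv> \<lambda>\<epsilon>. exp_map A g p (\<lambda>c. \<epsilon> *\<^sub>R X c)"
  shows "(\<beta> \<longlongrightarrow> p) (at_right 0)"
    and "\<forall>\<^sub>F \<epsilon> in at_right 0. \<beta> \<epsilon> \<in> C \<and> exp_inv p (\<beta> \<epsilon>) = (\<lambda>c. \<epsilon> *\<^sub>R X c)"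
proof -
  obtain N h where nc: "normal_chart p N h" using normal_chart_exists[OF p] by blast
  let ?f = "\<lambda>\<epsilon> c. \<epsilon> *\<^sub>R X c"
  have "continuous_on UNIV ?f"
    by (intro continuous_on_coordinatewise_then_product continuous_intros)
  then have "openin (top_of_set UNIV) (UNIV \<inter> ?f -` N)"
    by (rule continuous_openin_preimage[OF _ _ N_facts(1)[OF p nc]]) (use tangent_scale[OF X] in auto)
  then have S: "open (?f -` N)" by simp
  have 0: "0 \<in> ?f -` N" using zero_in_N[OF p nc] by simp
  have "continuous_on (?f -` N) (\<lambda>\<epsilon>. exp_map A g p (?f \<epsilon>))"
  proof (rule continuous_on_compose2[of N "exp_map A g p" _ ?f])
    show "continuous_on N (exp_map A g p)"
      using nc by (auto simp: normal_chart_def homeomorphism_def)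
    show "continuous_on (?f -` N) ?f"
      using \<open>continuous_on UNIV ?f\<close> by (rule continuous_on_subset) simp
  qed simp
  then have "isCont \<beta> 0"
    using S 0 continuous_on_eq_continuous_at unfolding \<beta>_def by blast
  moreover have "\<beta> 0 = p"
  proof -
    obtain \<gamma> where \<gamma>: "geod \<gamma>" "\<gamma> 0 = p" "vel \<gamma> 0 = (\<lambda>_. 0)" "\<gamma> ` {0..1} \<subseteq> C"
      using radial_geodesic[OF p nc zero_in_N[OF p nc]] by metis
    then show ?thesis
      using exp_map_eq[OF \<gamma>(1)] geod_velocity_zero(1)[OF \<gamma>(1), of 0 1] by (simp add: \<beta>_def)
  qed
  ultimately show "(\<beta> \<longlongrightarrow> p) (at_right 0)"
    unfolding isCont_def by (metis filterlim_at_split)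
  have "\<forall>\<^sub>F \<epsilon> in nhds 0. \<epsilon> \<in> ?f -` N"
    using S 0 by (rule eventually_nhds_in_open)
  then have "\<forall>\<^sub>F \<epsilon> in at_right 0. \<epsilon> \<in> ?f -` N"
    unfolding at_within_def by (rule filter_leD[rotated]) simp
  then show "\<forall>\<^sub>F \<epsilon> in at_right 0. \<beta> \<epsilon> \<in> C \<and> exp_inv p (\<beta> \<epsilon>) = (\<lambda>c. \<epsilon> *\<^sub>R X c)"
  proof eventually_elim
    case (elim \<epsilon>)
    then have "?f \<epsilon> \<in> N" by simp
    then show ?case
      using exp_in_C[OF p nc] h_exp[OF p nc] exp_inv_normal_chart[OF p _ nc] by (simp add: \<beta>_def)
  qed
qed

end


section \<open>Causal character of curves and geodesics\<close>

context spacetime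
begin

definition future_timelike where
  "future_timelike T q v \<longleftrightarrow> g q v v < 0 \<and> g q (T q) v < 0"

definition future_cone where
  "future_cone T q v \<longleftrightarrow> g q v v \<le> 0 \<and> g q (T q) v \<le> 0"

text \<open>Statements about the past are statements about the future for the reversed time orientation.\<close>

abbreviation opposite :: "('m \<Rightarrow> ('m, 'n) tvec) \<Rightarrow> 'm \<Rightarrow> ('m, 'n) tvec" where
  "opposite T \<equiv> (\<lambda>q c. - T q c)"

lemma g_zero: "w \<in> TM q \<Longrightarrow> g q w (\<lambda>_. 0) = 0"
  using g_scale_right[of w q w 0] by simp

lemma orientation_tangent: "time_orientation A g T \<Longrightarrow> T q \<in> TM q"
  by (simp add: time_orientation_def)

lemma orientation_timelike: "time_orientation A g T \<Longrightarrow> g q (T q) (T q) < 0"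
  by (simp add: time_orientation_def timelike_vec_def)

lemma orientation_opposite:
  assumes "time_orientation A g T" shows "time_orientation A g (opposite T)"
proof -
  have "opposite T q \<in> TM q \<and> timelike_vec g q (opposite T q)" for q
  proof -
    have T: "T q \<in> TM q" "g q (T q) (T q) < 0"
      using assms by (auto simp: orientation_tangent orientation_timelike)
    have "g q (opposite T q) (opposite T q) < 0"
      using T by (simp add: g_minus_left g_minus_right tangent_minus)
    moreover from this have "opposite T q \<noteq> (\<lambda>_. 0)"
      using g_zero[OF tangent_zero, of q] by auto
    ultimately show ?thesis using T by (simp add: timelike_vec_def tangent_minus)
  qed
  moreover have "continuous_on (fst c) (\<lambda>q. opposite T q c)" if "c \<in> A" for c
    using assms that by (auto simp: time_orientation_def intro: continuous_on_minus)
  ultimately show ?thesis by (simp add: time_orientation_def)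
qed

lemma future_timelike_imp_cone: "future_timelike T q v \<Longrightarrow> future_cone T q v"
  by (simp add: future_timelike_def future_cone_def)

lemma future_cone_strict:
  assumes "time_orientation A g T" "v \<in> TM q" "future_cone T q v" "v \<noteq> (\<lambda>_. 0)"
  shows "g q (T q) v < 0"
  using timelike_causal_product[of "T q" q v] assms
  by (auto simp: future_cone_def orientation_tangent orientation_timelike)

lemma future_past_cone_zero:
  assumes T: "time_orientation A g T" and v: "v \<in> TM q" "future_cone T q v" "future_cone (opposite T) q v"
  shows "v = (\<lambda>_. 0)"
proof (rule ccontr)
  assume "v \<noteq> (\<lambda>_. 0)"
  then have "g q (T q) v < 0" by (rule future_cone_strict[OF T v(1,2)])
  moreover have "g q (opposite T q) v \<le> 0" using v(3) by (simp add: future_cone_def)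
  ultimately show False
    using g_minus_left[OF orientation_tangent[OF T, of q] v(1)] by simp
qed

lemma negative_of_nonzero:
  fixes f :: "real \<Rightarrow> real"
  assumes "continuous_on {a..b} f" "\<And>t. t \<in> {a..b} \<Longrightarrow> f t \<noteq> 0" "f a < 0" "a \<le> b"
  shows "f b < 0"
proof (rule ccontr)
  assume "\<not> f b < 0"
  then obtain t where "a \<le> t" "t \<le> b" "f t = 0"
    using IVT'[of f a 0 b] assms by auto
  then show False using assms(2)[of t] by auto
qed

text \<open>The velocity is only continuous chart by chart; its product with the orientation field does not
  depend on a chart, so it is continuous on the whole interval and cannot change sign without vanishing.\<close>

lemma orientation_product_continuous:
  assumes T: "time_orientation A g T" and \<gamma>: "C1_curve A \<gamma>"
  shows "continuous_on {0..1} (\<lambda>t. g (\<gamma> t) (T (\<gamma> t)) (vel \<gamma> t))"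
  unfolding continuous_on_def
proof
  fix t :: real assume t: "t \<in> {0..1}"
  note d = C1_curve_differentiable[OF \<gamma>]
  have path: "path \<gamma>" using \<gamma> by (simp add: C1_curve_def)
  obtain c where c: "c \<in> A" "\<gamma> t \<in> fst c" by (rule chart_at)
  obtain e where e: "e > 0" "\<And>s. s \<in> {0..1} \<Longrightarrow> \<bar>s - t\<bar> < e \<Longrightarrow> \<gamma> s \<in> fst c"
    using path_stays_near[OF path t chart_open(1)[OF c(1)] c(2)] by metis
  have lim: "(\<gamma> \<longlongrightarrow> \<gamma> t) (at t within {0..1})"
    using path t by (auto simp: path_def continuous_on_def)
  have within: "\<forall>\<^sub>F s in at t within {0..1}. s \<in> {0..1}"
    unfolding eventually_at by (intro exI[of _ 1]) auto
  show "((\<lambda>t. g (\<gamma> t) (T (\<gamma> t)) (vel \<gamma> t)) \<longlongrightarrow> g (\<gamma> t) (T (\<gamma> t)) (vel \<gamma> t)) (at t within {0..1})"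
  proof (rule tendsto_metric[OF c lim])
    have "isCont (\<lambda>q. T q c) (\<gamma> t)"
      using T c chart_open(1)[OF c(1)] by (auto simp: time_orientation_def continuous_on_eq_continuous_at)
    then show "((\<lambda>s. T (\<gamma> s) c) \<longlongrightarrow> T (\<gamma> t) c) (at t within {0..1})"
      using lim by (rule isCont_tendsto_compose)
    let ?S = "{t \<in> {0..1}. \<gamma> t \<in> fst c}"
    have "((\<lambda>s. vel \<gamma> s c) \<longlongrightarrow> vel \<gamma> t c) (at t within ?S)"
      using \<gamma> c t by (auto simp: C1_curve_def continuous_on_def)
    moreover have "at t within ?S = at t within {0..1}"
      by (rule at_within_nhd[of _ "ball t e"]) (use e in \<open>auto simp: dist_real_def abs_minus_commute\<close>)
    ultimately show "((\<lambda>s. vel \<gamma> s c) \<longlongrightarrow> vel \<gamma> t c) (at t within {0..1})" by simp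
    show "\<forall>\<^sub>F s in at t within {0..1}. vel \<gamma> s \<in> TM (\<gamma> s)"
      using within by eventually_elim (rule velocity_tangent[OF d])
  qed (use T velocity_tangent[OF d t] in \<open>auto simp: orientation_tangent\<close>)
qed

lemma causal_curve_oriented:
  assumes T: "time_orientation A g T" and \<gamma>: "causal_curve A g \<gamma>"
  shows "g (\<gamma> 0) (T (\<gamma> 0)) (vel \<gamma> 0) < 0 \<Longrightarrow> future_causal_curve A g T \<gamma>"
    and "future_causal_curve A g T \<gamma> \<or> future_causal_curve A g (opposite T) \<gamma>"
proof -
  have C1: "C1_curve A \<gamma>" using \<gamma> by (simp add: causal_curve_def)
  note tan = velocity_tangent[OF C1_curve_differentiable[OF C1]]
  have nz: "g (\<gamma> t) (S (\<gamma> t)) (vel \<gamma> t) \<noteq> 0" if "t \<in> {0..1}" "time_orientation A g S" for t S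
    using \<gamma> that tan[OF that(1)]
    by (intro timelike_causal_product) (auto simp: causal_curve_def causal_vec_def orientation_tangent orientation_timelike)
  have *: "future_causal_curve A g S \<gamma>" if S: "time_orientation A g S" and 0: "g (\<gamma> 0) (S (\<gamma> 0)) (vel \<gamma> 0) < 0" for S
    unfolding future_causal_curve_def
  proof (intro conjI \<gamma> ballI)
    fix t :: real assume t: "t \<in> {0..1}"
    show "g (\<gamma> t) (S (\<gamma> t)) (vel \<gamma> t) < 0"
      by (rule negative_of_nonzero[of 0 t])
         (use t nz[OF _ S] 0 in \<open>auto intro: continuous_on_subset[OF orientation_product_continuous[OF S C1]]\<close>)
  qed
  show "g (\<gamma> 0) (T (\<gamma> 0)) (vel \<gamma> 0) < 0 \<Longrightarrow> future_causal_curve A g T \<gamma>" by (rule *[OF T])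
  have "g (\<gamma> 0) (opposite T (\<gamma> 0)) (vel \<gamma> 0) = - g (\<gamma> 0) (T (\<gamma> 0)) (vel \<gamma> 0)"
    using g_minus_left[OF orientation_tangent[OF T] tan[of 0]] by simp
  then show "future_causal_curve A g T \<gamma> \<or> future_causal_curve A g (opposite T) \<gamma>"
    using *[OF T] *[OF orientation_opposite[OF T]] nz[of 0 T] T by fastforce
qed

lemma future_causal_curve_reverse:
  assumes T: "time_orientation A g T" and \<gamma>: "future_causal_curve A g T \<gamma>"
  shows "future_causal_curve A g (opposite T) (\<lambda>s. \<gamma> (1 - s))"
proof -
  have C1: "C1_curve A \<gamma>" using \<gamma> by (simp add: causal_curve_def future_causal_curve_def)
  note tan = velocity_tangent[OF C1_curve_differentiable[OF C1]]
  note r = C1_curve_reverse[OF C1]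
  have "causal_vec g (\<gamma> (1 - s)) (\<lambda>c. - vel \<gamma> (1 - s) c)
      \<and> g (\<gamma> (1 - s)) (opposite T (\<gamma> (1 - s))) (\<lambda>c. - vel \<gamma> (1 - s) c) < 0" if "s \<in> {0..1}" for s
  proof -
    have s: "1 - s \<in> {0..1}" using that by auto
    have "causal_vec g (\<gamma> (1 - s)) (vel \<gamma> (1 - s))" "g (\<gamma> (1 - s)) (T (\<gamma> (1 - s))) (vel \<gamma> (1 - s)) < 0"
      using \<gamma> s by (auto simp: future_causal_curve_def causal_curve_def)
    then show ?thesis
      using tan[OF s] orientation_tangent[OF T]
      by (auto simp: causal_vec_def g_minus_left g_minus_right tangent_minus fun_eq_iff)
  qed
  then show ?thesis
    using r by (simp add: future_causal_curve_def causal_curve_def)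
qed

lemma geod_future_causal:
  assumes T: "time_orientation A g T" and \<gamma>: "geod \<gamma>"
    and v: "future_cone T (\<gamma> 0) (vel \<gamma> 0)" "vel \<gamma> 0 \<noteq> (\<lambda>_. 0)"
  shows "future_causal_curve A g T \<gamma>"
proof (rule causal_curve_oriented(1)[OF T])
  show "causal_curve A g \<gamma>"
    unfolding causal_curve_def causal_vec_def
  proof (intro conjI ballI geod_C1_curve[OF \<gamma>])
    fix t :: real assume t: "t \<in> {0..1}"
    show "vel \<gamma> t \<noteq> (\<lambda>_. 0)" using geod_velocity_zero(2)[OF \<gamma> t, of 0] v(2) by auto
    show "g (\<gamma> t) (vel \<gamma> t) (vel \<gamma> t) \<le> 0"
      using geod_energy_constant[OF \<gamma> t] v(1) by (simp add: future_cone_def)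
  qed
  show "g (\<gamma> 0) (T (\<gamma> 0)) (vel \<gamma> 0) < 0"
    using velocity_tangent[OF geod_differentiable[OF \<gamma>], of 0] v by (intro future_cone_strict[OF T]) auto
qed

end


section \<open>Causal cones under the exponential map\<close>

lemma has_vector_derivative_imp_lipschitz_at:
  assumes "(f has_vector_derivative v) (at t within S)"
  shows "\<forall>\<^sub>F s in at t within S. norm (f s - f t) \<le> (norm v + 1) * \<bar>s - t\<bar>"
proof -
  have "\<exists>d>0. \<forall>s\<in>S. norm (s - t) < d \<longrightarrow> norm (f s - f t - (s - t) *\<^sub>R v) \<le> 1 * norm (s - t)"
    using assms unfolding has_vector_derivative_def has_derivative_within_alt by (metis zero_less_one)
  then obtain d where d: "d > 0" "\<And>s. s \<in> S \<Longrightarrow> \<bar>s - t\<bar> < d \<Longrightarrow> norm (f s - f t - (s - t) *\<^sub>R v) \<le> \<bar>s - t\<bar>"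
    by auto
  have "norm (f s - f t) \<le> (norm v + 1) * \<bar>s - t\<bar>" if "s \<in> S" "\<bar>s - t\<bar> < d" for s
  proof -
    have "norm (f s - f t) \<le> norm (f s - f t - (s - t) *\<^sub>R v) + norm ((s - t) *\<^sub>R v)"
      by (metis diff_add_cancel norm_triangle_ineq)
    also have "\<dots> \<le> \<bar>s - t\<bar> + \<bar>s - t\<bar> * norm v" using d(2)[OF that] by simp
    finally show ?thesis by (simp add: algebra_simps)
  qed
  then show ?thesis
    using d(1) unfolding eventually_at by (auto simp: dist_real_def)
qed

text \<open>The second-order error in the first variation formula does not contribute to the derivative.\<close>

lemma has_real_derivative_zeroI_quadratic:
  fixes h :: "real \<Rightarrow> real"
  assumes "\<forall>\<^sub>F s in at t within S. \<bar>h s - h t\<bar> \<le> K * \<bar>s - t\<bar>\<^sup>2"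
  shows "(h has_real_derivative 0) (at t within S)"
  unfolding has_field_derivative_iff
proof (rule Lim_null_comparison)
  have "\<forall>\<^sub>F s in at t within S. s \<noteq> t" by (simp add: eventually_at_filter)
  with assms show "\<forall>\<^sub>F s in at t within S. norm ((h s - h t) / (s - t)) \<le> K * \<bar>s - t\<bar>"
    by eventually_elim (simp add: divide_simps power2_eq_square mult.assoc)
  have "((\<lambda>s. K * \<bar>s - t\<bar>) \<longlongrightarrow> K * \<bar>t - t\<bar>) (at t within S)" by (intro tendsto_intros)
  then show "((\<lambda>s. K * \<bar>s - t\<bar>) \<longlongrightarrow> 0) (at t within S)" by simp
qed

context convex_normal_set
begin

lemma exp_inv_products_continuous:
  assumes q: "q \<in> C" and X: "X \<in> TM q"
  shows "continuous_on C (\<lambda>u. g q (exp_inv q u) (exp_inv q u))" "continuous_on C (\<lambda>u. g q X (exp_inv q u))"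
proof -
  obtain c where c: "c \<in> A" "q \<in> fst c" by (rule chart_at)
  have cont: "continuous_on C (\<lambda>u. exp_inv q u c)"
    using exp_inv_continuous[OF q] by (rule continuous_on_product_then_coordinatewise)
  have lim: "((\<lambda>u. exp_inv q u c) \<longlongrightarrow> exp_inv q y c) (at y within C)" if "y \<in> C" for y
    using cont that by (simp add: continuous_on_def)
  have ev: "\<forall>\<^sub>F u in at y within C. exp_inv q u \<in> TM q" for y
    using exp_inv_tangent[OF q] by (auto simp: eventually_at_filter intro: always_eventually)
  show "continuous_on C (\<lambda>u. g q (exp_inv q u) (exp_inv q u))"
    unfolding continuous_on_def
    by (intro ballI tendsto_metric[OF c tendsto_const] ev lim exp_inv_tangent[OF q])
  show "continuous_on C (\<lambda>u. g q X (exp_inv q u))"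
    unfolding continuous_on_def
    by (intro ballI tendsto_metric[OF c tendsto_const] ev lim exp_inv_tangent[OF q] tendsto_const always_eventually allI X)
qed

lemma future_timelike_open:
  assumes T: "time_orientation A g T" and q: "q \<in> C"
  shows "open {u \<in> C. future_timelike T q (exp_inv q u)}" "open {u \<in> C. \<not> future_cone T q (exp_inv q u)}"
proof -
  note cont = exp_inv_products_continuous[OF q orientation_tangent[OF T]]
  note o = continuous_open_preimage[OF _ C_open]
  have "{u \<in> C. future_timelike T q (exp_inv q u)} =
    (C \<inter> (\<lambda>u. g q (exp_inv q u) (exp_inv q u)) -` {..<0}) \<inter> (C \<inter> (\<lambda>u. g q (T q) (exp_inv q u)) -` {..<0})"
    by (auto simp: future_timelike_def)
  then show "open {u \<in> C. future_timelike T q (exp_inv q u)}"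
    using o[OF cont(1) open_lessThan] o[OF cont(2) open_lessThan] by (simp add: open_Int)
  have "{u \<in> C. \<not> future_cone T q (exp_inv q u)} =
    (C \<inter> (\<lambda>u. g q (exp_inv q u) (exp_inv q u)) -` {0<..}) \<union> (C \<inter> (\<lambda>u. g q (T q) (exp_inv q u)) -` {0<..})"
    by (auto simp: future_cone_def)
  then show "open {u \<in> C. \<not> future_cone T q (exp_inv q u)}"
    using o[OF cont(1) open_greaterThan] o[OF cont(2) open_greaterThan] by (simp add: open_Un)
qed

text \<open>The geodesic from \<open>q\<close> to \<open>y\<close>, traversed backwards, is the one from \<open>y\<close> to \<open>q\<close>, so relative
  causal position can be read off at either end.\<close>

lemma cone_dual:
  assumes T: "time_orientation A g T" and qy: "q \<in> C" "y \<in> C"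
  shows "future_cone T q (exp_inv q y) \<Longrightarrow> future_cone (opposite T) y (exp_inv y q)"
    and "future_timelike T q (exp_inv q y) \<Longrightarrow> future_timelike (opposite T) y (exp_inv y q)"
proof -
  note \<gamma> = connector[OF qy]
  let ?w = "vel (connector q y) 1"
  have w: "?w \<in> TM y" using velocity_tangent[OF geod_differentiable[OF \<gamma>(1)], of 1] \<gamma>(3) by simp
  have Ty: "T y \<in> TM y" by (rule orientation_tangent[OF T])
  have e: "g y ?w ?w = g q (exp_inv q y) (exp_inv q y)"
    using geod_energy_constant[OF \<gamma>(1), of 1] \<gamma>(2,3) by (simp add: exp_inv_def)
  have gg: "g y (exp_inv y q) (exp_inv y q) = g y ?w ?w" "g y (opposite T y) (exp_inv y q) = g y (T y) ?w"
    unfolding exp_inv_connector_end[OF qy] using w Ty by (simp_all add: g_minus_left g_minus_right tangent_minus)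
  have fc: "g y (T y) ?w < 0" if "future_cone T q (exp_inv q y)" "exp_inv q y \<noteq> (\<lambda>_. 0)"
  proof -
    have "future_causal_curve A g T (connector q y)"
      using that \<gamma>(2) by (intro geod_future_causal[OF T \<gamma>(1)]) (auto simp: exp_inv_def)
    then have "g (connector q y 1) (T (connector q y 1)) ?w < 0"
      by (simp add: future_causal_curve_def)
    then show ?thesis using \<gamma>(3) by simp
  qed
  show "future_cone (opposite T) y (exp_inv y q)" if f: "future_cone T q (exp_inv q y)"
  proof (cases "exp_inv q y = (\<lambda>_. 0)")
    case True
    then have "?w = (\<lambda>_. 0)"
      using geod_velocity_zero(2)[OF \<gamma>(1), of 0 1] by (simp add: exp_inv_def)
    then have "g y (T y) ?w = 0" "g y ?w ?w = 0" using g_zero[OF Ty] g_zero[OF tangent_zero] by simp_all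
    then show ?thesis using gg by (simp add: future_cone_def)
  next
    case False
    then show ?thesis using fc[OF f] e f gg by (simp add: future_cone_def)
  qed
  show "future_timelike (opposite T) y (exp_inv y q)" if f: "future_timelike T q (exp_inv q y)"
  proof -
    have "exp_inv q y \<noteq> (\<lambda>_. 0)"
      using f g_zero[OF tangent_zero, of q] by (auto simp: future_timelike_def)
    then show ?thesis
      using fc[OF future_timelike_imp_cone[OF f]] e f gg by (simp add: future_timelike_def)
  qed
qed

lemma cone_imp_causal_future:
  assumes T: "time_orientation A g T" and qy: "q \<in> C" "y \<in> C" and f: "future_cone T q (exp_inv q y)"
  shows "(q, y) \<in> causal_future A g T C"
proof (cases "exp_inv q y = (\<lambda>_. 0)")
  case True
  then show ?thesis using exp_inv_zero[OF qy] qy by (auto simp: causal_future_def)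
next
  case False
  note \<gamma> = connector[OF qy]
  have "future_causal_curve A g T (connector q y)"
    using f False \<gamma>(2) by (intro geod_future_causal[OF T \<gamma>(1)]) (auto simp: exp_inv_def)
  then show ?thesis
    using \<gamma> by (auto simp: causal_future_def pathstart_def pathfinish_def path_image_def)
qed

text \<open>The Gauss lemma: the function \<open>y \<mapsto> g(exp\<^sub>q\<^sup>-\<^sup>1 y, exp\<^sub>q\<^sup>-\<^sup>1 y)\<close> is differentiable along curves,
  although the exponential map itself is only Lipschitz. The first variation formula applies to the
  geodesics from \<open>q\<close> to the points of the curve: their initial velocities satisfy the required bound
  because \<open>exp\<^sub>q\<^sup>-\<^sup>1\<close> is locally Lipschitz and the curve is differentiable.\<close>

lemma gauss_lemma:
  assumes q: "q \<in> C" and \<gamma>: "differentiable_curve \<gamma>" "\<gamma> ` {0..1} \<subseteq> C" and t: "t \<in> {0..1}"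
  shows "((\<lambda>s. g q (exp_inv q (\<gamma> s)) (exp_inv q (\<gamma> s))) has_real_derivative
           2 * g (\<gamma> t) (vel (connector q (\<gamma> t)) 1) (vel \<gamma> t)) (at t within {0..1})"
proof -
  \<comment> \<open>Outside the unit interval the curve is continued by a constant in \<open>C\<close>, so that every parameter
    value yields a geodesic.\<close>
  define y where "y s = (if s \<in> {0..1} then \<gamma> s else \<gamma> t)" for s
  have yC: "y s \<in> C" for s using \<gamma>(2) t by (auto simp: y_def)
  have yt: "y t = \<gamma> t" by (simp add: y_def)
  define \<sigma> where "\<sigma> s = connector q (y s)" for s
  note \<sigma> = connector[OF q yC, folded \<sigma>_def]
  let ?F = "at t within {0..1}"
  have within: "\<forall>\<^sub>F s in ?F. s \<in> {0..1}"
    unfolding eventually_at by (intro exI[of _ 1]) auto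
  have path: "continuous_on {0..1} \<gamma>" using \<gamma>(1) by (simp add: differentiable_curve_def path_def)
  have ylim: "(y \<longlongrightarrow> \<gamma> t) ?F"
  proof (rule Lim_transform_eventually)
    show "(\<gamma> \<longlongrightarrow> \<gamma> t) ?F" using path t by (simp add: continuous_on_def)
    show "\<forall>\<^sub>F s in ?F. \<gamma> s = y s" using within by eventually_elim (simp add: y_def)
  qed
  obtain c where c: "c \<in> A" "q \<in> fst c" by (rule chart_at)
  obtain d where d: "d \<in> A" "\<gamma> t \<in> fst d" by (rule chart_at)
  have in_d: "\<forall>\<^sub>F s in ?F. y s \<in> fst d"
    by (rule topological_tendstoD[OF ylim chart_open(1)[OF d(1)] d(2)])
  have dv: "((snd d \<circ> \<gamma>) has_vector_derivative vel \<gamma> t d) ?F"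
    by (rule velocity_has_vector_derivative[OF \<gamma>(1) d(1) t d(2)])
  let ?xt = "snd d (\<gamma> t)" and ?P = "vel (\<sigma> t) 1"
  have P: "?P \<in> TM (\<gamma> t)"
    using velocity_tangent[OF geod_differentiable[OF \<sigma>(1)], of 1 t] \<sigma>(3) yt by simp
  have "?xt \<in> snd d ` (C \<inter> fst d)" using yC[of t] d yt by auto
  then obtain r L where r: "r > 0" "L \<ge> 0" and L: "\<And>u w. u \<in> snd d ` (C \<inter> fst d) \<Longrightarrow> w \<in> snd d ` (C \<inter> fst d) \<Longrightarrow>
      dist u ?xt \<le> r \<Longrightarrow> dist w ?xt \<le> r \<Longrightarrow>
      dist (exp_inv q (chart_inv d u) c) (exp_inv q (chart_inv d w) c) \<le> L * dist u w"
    using locally_lipschitz_onE[OF exp_inv_locally_lipschitz[OF q c(1) d(1) c(2)]] by metis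
  have xlim: "((\<lambda>s. snd d (y s)) \<longlongrightarrow> ?xt) ?F"
    using chart_continuous[OF d(1)] chart_open(1)[OF d(1)] d(2) ylim
    by (metis continuous_on_eq_continuous_at isCont_tendsto_compose)
  have "\<forall>\<^sub>F s in ?F. dist (snd d (y s)) ?xt < r"
    using tendstoD[OF xlim r(1)] .
  moreover have "\<forall>\<^sub>F s in ?F. dist (snd d (y s)) ?xt \<le> (norm (vel \<gamma> t d) + 1) * \<bar>s - t\<bar>"
    using has_vector_derivative_imp_lipschitz_at[OF dv] within
    by eventually_elim (simp add: y_def dist_norm)
  ultimately have lip: "\<forall>\<^sub>F s in ?F. dist (vel (\<sigma> s) 0 c) (vel (\<sigma> t) 0 c) \<le> L * (norm (vel \<gamma> t d) + 1) * \<bar>s - t\<bar>"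
    using in_d
  proof eventually_elim
    case (elim s)
    have "dist (exp_inv q (chart_inv d (snd d (y s))) c) (exp_inv q (chart_inv d ?xt) c) \<le> L * dist (snd d (y s)) ?xt"
      using elim yC[of s] yC[of t] yt d r by (intro L) auto
    also have "\<dots> \<le> L * ((norm (vel \<gamma> t d) + 1) * \<bar>s - t\<bar>)"
      using elim r by (intro mult_left_mono) auto
    finally show ?case
      using elim d yt by (simp add: exp_inv_def \<sigma>_def mult.assoc)
  qed
  have unif: "\<exists>e>0. \<forall>\<^sub>F s in ?F. \<forall>u\<in>{0..1}. \<bar>u - w\<bar> < e \<longrightarrow> \<sigma> s u \<in> U"
    if w: "w \<in> {0..1}" "open U" "\<sigma> t w \<in> U" for w U
  proof -
    have "openin (top_of_set ({0..1} \<times> C)) (({0..1} \<times> C) \<inter> (\<lambda>p. connector q (snd p) (fst p)) -` U)"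
      by (rule continuous_openin_preimage_gen[OF connector_continuous[OF q] w(2)])
    then obtain O' where O': "open O'" "({0..1} \<times> C) \<inter> (\<lambda>p. connector q (snd p) (fst p)) -` U = ({0..1} \<times> C) \<inter> O'"
      by (auto simp: openin_open)
    have "(w, \<gamma> t) \<in> O'" using O'(2) w yC[of t] yt by (auto simp: \<sigma>_def)
    then obtain X Y where XY: "open X" "open Y" "w \<in> X" "\<gamma> t \<in> Y" "X \<times> Y \<subseteq> O'"
      using O'(1) by (metis open_prod_elim mem_Sigma_iff)
    obtain e where e: "e > 0" "ball w e \<subseteq> X" using XY open_contains_ball by metis
    have "\<forall>\<^sub>F s in ?F. y s \<in> Y" by (rule topological_tendstoD[OF ylim XY(2,4)])
    then have "\<forall>\<^sub>F s in ?F. \<forall>u\<in>{0..1}. \<bar>u - w\<bar> < e \<longrightarrow> \<sigma> s u \<in> U"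
    proof eventually_elim
      case (elim s)
      show ?case
      proof (intro ballI impI)
        fix u :: real assume u: "u \<in> {0..1}" "\<bar>u - w\<bar> < e"
        then have "u \<in> X" using e(2) by (auto simp: dist_real_def abs_minus_commute)
        then have "(u, y s) \<in> ({0..1} \<times> C) \<inter> O'" using elim u XY(5) yC by auto
        then show "\<sigma> s u \<in> U" unfolding O'(2)[symmetric] by (simp add: \<sigma>_def)
      qed
    qed
    then show ?thesis using e(1) by blast
  qed
  have \<delta>: "((\<lambda>s. \<bar>s - t\<bar>) \<longlongrightarrow> 0) ?F"
  proof -
    have "((\<lambda>s. \<bar>s - t\<bar>) \<longlongrightarrow> \<bar>t - t\<bar>) ?F" by (intro tendsto_intros)
    then show ?thesis by simp
  qed
  obtain K where K: "\<forall>\<^sub>F s in ?F. \<bar>energy (\<sigma> s) - energy (\<sigma> t)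
       - 2 * coord_metric d (snd d (\<sigma> t 1)) (snd d (\<sigma> s 1) - snd d (\<sigma> t 1)) (vel (\<sigma> t) 1 d)\<bar> \<le> K * \<bar>s - t\<bar>\<^sup>2"
    by (rule first_variation[of \<sigma> "\<sigma> t" "\<lambda>s. \<bar>s - t\<bar>" ?F c _ d]) (use \<sigma> \<delta> unif c d lip yt in auto)
  let ?f = "\<lambda>s. g q (exp_inv q (\<gamma> s)) (exp_inv q (\<gamma> s))"
  \<comment> \<open>The energy function and \<open>\<phi>\<close> differ, up to a constant, by a function that is quadratically small
    at \<open>t\<close>, hence they have the same derivative there.\<close>
  define \<phi> where "\<phi> s = 2 * coord_metric d ?xt ((snd d \<circ> \<gamma>) s - ?xt) (?P d)" for s
  have en: "energy (\<sigma> s) = ?f s" if "s \<in> {0..1}" for s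
    using that \<sigma>(2)[of s] by (simp add: energy_def exp_inv_def \<sigma>_def y_def)
  have "\<phi> t = 0" by (simp add: \<phi>_def bounded_bilinear.zero_left[OF coord_metric_bilinear])
  have "\<forall>\<^sub>F s in ?F. \<bar>(?f s - \<phi> s) - (?f t - \<phi> t)\<bar> \<le> K * \<bar>s - t\<bar>\<^sup>2"
    using K within
  proof eventually_elim
    case (elim s)
    have "(?f s - \<phi> s) - (?f t - \<phi> t) = energy (\<sigma> s) - energy (\<sigma> t)
       - 2 * coord_metric d (snd d (\<sigma> t 1)) (snd d (\<sigma> s 1) - snd d (\<sigma> t 1)) (vel (\<sigma> t) 1 d)"
      using elim(2) en t \<sigma>(3) yt \<open>\<phi> t = 0\<close> by (simp add: \<phi>_def y_def)
    then show ?case using elim(1) by simp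
  qed
  then have "((\<lambda>s. ?f s - \<phi> s) has_real_derivative 0) ?F"
    by (rule has_real_derivative_zeroI_quadratic)
  moreover have "(\<phi> has_real_derivative 2 * coord_metric d ?xt (vel \<gamma> t d) (?P d)) ?F"
  proof -
    have "((\<lambda>s. (snd d \<circ> \<gamma>) s - ?xt) has_vector_derivative vel \<gamma> t d) ?F"
      using has_vector_derivative_diff[OF dv has_vector_derivative_const[of ?xt]] by simp
    from bounded_linear.has_vector_derivative[OF bounded_bilinear.bounded_linear_left[OF coord_metric_bilinear[of d ?xt], of "?P d"] this]
    have "((\<lambda>s. coord_metric d ?xt ((snd d \<circ> \<gamma>) s - ?xt) (?P d)) has_real_derivative coord_metric d ?xt (vel \<gamma> t d) (?P d)) ?F"
      by (simp add: has_real_derivative_iff_has_vector_derivative)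
    then show ?thesis unfolding \<phi>_def[abs_def] by (rule DERIV_cmult)
  qed
  ultimately have "((\<lambda>s. (?f s - \<phi> s) + \<phi> s) has_real_derivative 0 + 2 * coord_metric d ?xt (vel \<gamma> t d) (?P d)) ?F"
    by (rule DERIV_add)
  moreover have "coord_metric d ?xt (vel \<gamma> t d) (?P d) = g (\<gamma> t) ?P (vel \<gamma> t)"
    using g_coord[OF P velocity_tangent[OF \<gamma>(1) t] d] coord_metric_sym[OF d(1), of ?xt] d(2) by simp
  ultimately show ?thesis by (simp add: \<sigma>_def yt)
qed

text \<open>A future causal curve cannot leave the image of the open future cone at \<open>q\<close>. As long as it stays
  there, the end velocity of the geodesic from \<open>q\<close> and the velocity of the curve are in the same
  half-cone, so by the Gauss lemma \<open>g(exp\<^sub>q\<^sup>-\<^sup>1, exp\<^sub>q\<^sup>-\<^sup>1)\<close> does not increase; it is therefore bounded by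
  its negative initial value and never reaches \<open>0\<close>.\<close>

lemma future_timelike_invariant:
  assumes T: "time_orientation A g T" and q: "q \<in> C"
    and \<gamma>: "future_causal_curve A g T \<gamma>" "\<gamma> ` {0..1} \<subseteq> C"
    and start: "future_timelike T q (exp_inv q (\<gamma> 0))" and t: "t \<in> {0..1}"
  shows "future_timelike T q (exp_inv q (\<gamma> t))"
proof -
  have C1: "C1_curve A \<gamma>" using \<gamma>(1) by (simp add: future_causal_curve_def causal_curve_def)
  note d = C1_curve_differentiable[OF C1]
  have path: "continuous_on {0..1} \<gamma>" using C1 by (simp add: C1_curve_def path_def)
  define f where "f s = g q (exp_inv q (\<gamma> s)) (exp_inv q (\<gamma> s))" for s
  define k where "k s = g q (T q) (exp_inv q (\<gamma> s))" for s
  have Tq: "T q \<in> TM q" by (rule orientation_tangent[OF T])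
  have \<gamma>C: "\<gamma> s \<in> C" if "s \<in> {0..1}" for s using \<gamma>(2) that by auto
  have cf: "continuous_on {0..1} f" and ck: "continuous_on {0..1} k"
    unfolding f_def k_def
    using continuous_on_compose2[OF exp_inv_products_continuous(1)[OF q Tq] path \<gamma>(2)]
      continuous_on_compose2[OF exp_inv_products_continuous(2)[OF q Tq] path \<gamma>(2)] by auto
  have k_neg: "k s < 0" if s: "s \<in> {0..1}" and neg: "\<And>u. u \<in> {0..s} \<Longrightarrow> f u < 0" for s
  proof (rule negative_of_nonzero[of 0 s])
    show "continuous_on {0..s} k" using ck by (rule continuous_on_subset) (use s in auto)
    show "k u \<noteq> 0" if u: "u \<in> {0..s}" for u
    proof -
      have e: "exp_inv q (\<gamma> u) \<in> TM q" using exp_inv_tangent[OF q \<gamma>C] u s by auto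
      have "g q (exp_inv q (\<gamma> u)) (T q) \<noteq> 0"
      proof (rule timelike_causal_product[OF e Tq])
        show "g q (exp_inv q (\<gamma> u)) (exp_inv q (\<gamma> u)) < 0" using neg[OF u] by (simp add: f_def)
        show "g q (T q) (T q) \<le> 0" using orientation_timelike[OF T, of q] by simp
        show "T q \<noteq> (\<lambda>_. 0)" using T by (simp add: time_orientation_def timelike_vec_def)
      qed
      then show ?thesis using g_sym[OF e Tq] by (simp add: k_def)
    qed
    show "k 0 < 0" using start by (simp add: k_def future_timelike_def)
  qed (use s in auto)
  have f0: "f 0 < 0" using start by (simp add: f_def future_timelike_def)
  have decreasing: "f s \<le> f 0" if s: "s \<in> {0..1}" and neg: "\<And>u. 0 \<le> u \<Longrightarrow> u < s \<Longrightarrow> f u < 0" for s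
  proof (rule DERIV_nonpos_imp_decreasing_open[of 0 s f])
    show "continuous_on {0..s} f" using cf by (rule continuous_on_subset) (use s in auto)
    fix u assume u: "0 < u" "u < s"
    then have u1: "u \<in> {0..1}" "\<gamma> u \<in> C" using s \<gamma>C by auto
    let ?P = "vel (connector q (\<gamma> u)) 1"
    have ft: "future_timelike T q (exp_inv q (\<gamma> u))"
      using k_neg[OF u1(1)] neg u by (auto simp: future_timelike_def f_def k_def)
    note \<sigma> = connector[OF q u1(2)]
    have "vel (connector q (\<gamma> u)) 0 \<noteq> (\<lambda>_. 0)"
      using ft g_zero[OF tangent_zero, of q] by (auto simp: future_timelike_def exp_inv_def)
    then have "future_causal_curve A g T (connector q (\<gamma> u))"
      using future_timelike_imp_cone[OF ft] \<sigma>(2) by (intro geod_future_causal[OF T \<sigma>(1)]) (auto simp: exp_inv_def)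
    then have "g (connector q (\<gamma> u) 1) (T (connector q (\<gamma> u) 1)) ?P < 0"
      by (simp add: future_causal_curve_def)
    then have TP: "g (\<gamma> u) (T (\<gamma> u)) ?P < 0"
      using \<sigma>(3) by simp
    have PP: "g (\<gamma> u) ?P ?P < 0"
      using geod_energy_constant[OF \<sigma>(1), of 1] \<sigma>(2,3) ft by (simp add: future_timelike_def exp_inv_def)
    have "g (\<gamma> u) ?P (vel \<gamma> u) < 0"
    proof (rule same_cone_product[OF orientation_tangent[OF T] _ velocity_tangent[OF d u1(1)] orientation_timelike[OF T] PP _ TP])
      show "?P \<in> TM (\<gamma> u)" using velocity_tangent[OF geod_differentiable[OF \<sigma>(1)], of 1] \<sigma>(3) by simp
      show "g (\<gamma> u) (vel \<gamma> u) (vel \<gamma> u) \<le> 0" "g (\<gamma> u) (T (\<gamma> u)) (vel \<gamma> u) < 0"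
        using \<gamma>(1) u1 by (auto simp: future_causal_curve_def causal_curve_def causal_vec_def)
    qed
    moreover have "(f has_real_derivative 2 * g (\<gamma> u) ?P (vel \<gamma> u)) (at u)"
      using gauss_lemma[OF q d \<gamma>(2) u1(1)] u s unfolding f_def[abs_def] by (simp add: at_within_Icc_at)
    ultimately show "\<exists>y. (f has_real_derivative y) (at u) \<and> y \<le> 0" by (intro exI conjI) auto
  qed (use s in auto)
  have f_neg: "f s < 0" if s01: "s \<in> {0..1}" for s
  proof (rule ccontr)
    assume "\<not> f s < 0"
    then obtain m where m: "m \<in> {0..1}" "0 \<le> f m" "\<And>u. 0 \<le> u \<Longrightarrow> u < m \<Longrightarrow> f u < 0"
      using first_time_at_least[OF cf s01] by (metis linorder_not_less)
    have "f m \<le> f 0"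
      using m(1,3) by (rule decreasing)
    then show False using m(2) f0 by simp
  qed
  show ?thesis
    using f_neg[OF t] k_neg[OF t] f_neg t by (auto simp: future_timelike_def f_def k_def)
qed


section \<open>Closedness of the causal relation\<close>

lemma causal_future_subset: "causal_future A g T C \<subseteq> C \<times> C"
  unfolding causal_future_def using pathstart_in_path_image pathfinish_in_path_image by blast

text \<open>The points \<open>exp\<^sub>p (- \<epsilon> T)\<close> lie in the chronological past of \<open>p\<close> and tend to \<open>p\<close>.\<close>

lemma timelike_approximation:
  assumes T: "time_orientation A g T" and p: "p \<in> C"
  obtains \<beta> where "(\<beta> \<longlongrightarrow> p) (at_right (0::real))"
    "\<forall>\<^sub>F \<epsilon> in at_right 0. \<beta> \<epsilon> \<in> C \<and> future_timelike T (\<beta> \<epsilon>) (exp_inv (\<beta> \<epsilon>) p)"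
proof -
  have Tp: "T p \<in> TM p" by (rule orientation_tangent[OF T])
  let ?X = "opposite T p"
  have X: "?X \<in> TM p" using Tp by (rule tangent_minus)
  let ?\<beta> = "\<lambda>\<epsilon>. exp_map A g p (\<lambda>c. \<epsilon> *\<^sub>R ?X c)"
  have "\<forall>\<^sub>F \<epsilon> in at_right 0. ?\<beta> \<epsilon> \<in> C \<and> future_timelike T (?\<beta> \<epsilon>) (exp_inv (?\<beta> \<epsilon>) p)"
    using exp_small(2)[OF p X] eventually_at_right_less[of 0]
  proof eventually_elim
    case (elim \<epsilon>)
    then have \<beta>: "?\<beta> \<epsilon> \<in> C" and e: "exp_inv p (?\<beta> \<epsilon>) = (\<lambda>c. \<epsilon> *\<^sub>R ?X c)" and \<epsilon>: "\<epsilon> > 0" by blast+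
    have XX: "g p ?X ?X < 0"
      using orientation_timelike[OF orientation_opposite[OF T], of p] .
    have "future_timelike (opposite T) p (exp_inv p (?\<beta> \<epsilon>))"
      unfolding e future_timelike_def using X XX \<epsilon>
      by (simp only: g_scale_left g_scale_right tangent_scale) (simp add: mult_pos_neg)
    from cone_dual(2)[OF orientation_opposite[OF T] p \<beta> this]
    show ?case using \<beta> by simp
  qed
  then show thesis using exp_small(1)[OF p X] that by blast
qed

text \<open>If \<open>z\<close> is in the chronological past of \<open>x\<close>, then all pairs of \<open>J\<^sup>+\<close> near \<open>(x, y)\<close> start, and hence end,
  in the chronological future of \<open>z\<close>; so \<open>exp\<^sub>z\<^sup>-\<^sup>1 y\<close> lies in the closed future cone. Seen from \<open>y\<close>, the
  vector \<open>exp\<^sub>y\<^sup>-\<^sup>1 z\<close> lies in the closed past cone, and one lets \<open>z\<close> tend to \<open>x\<close>. Changing the point of view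
  in the middle is what makes continuity of the exponential map at the fixed point \<open>y\<close> sufficient.\<close>

lemma closure_causal_future_cone:
  assumes T: "time_orientation A g T" and xy: "x \<in> C" "y \<in> C" "(x, y) \<in> closure (causal_future A g T C)"
  shows "future_cone (opposite T) y (exp_inv y x)"
proof -
  obtain \<beta> where \<beta>: "(\<beta> \<longlongrightarrow> x) (at_right (0::real))"
    "\<forall>\<^sub>F \<epsilon> in at_right 0. \<beta> \<epsilon> \<in> C \<and> future_timelike T (\<beta> \<epsilon>) (exp_inv (\<beta> \<epsilon>) x)"
    by (rule timelike_approximation[OF T xy(1)])
  have "future_cone T z (exp_inv z y)" if z: "z \<in> C" "future_timelike T z (exp_inv z x)" for z
  proof (rule ccontr)
    assume not: "\<not> future_cone T z (exp_inv z y)"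
    let ?I = "{u \<in> C. future_timelike T z (exp_inv z u)}" and ?W = "{u \<in> C. \<not> future_cone T z (exp_inv z u)}"
    have "open (?I \<times> ?W)" "(x, y) \<in> ?I \<times> ?W"
      using future_timelike_open[OF T z(1)] z xy not by (auto intro: open_Times)
    then have "causal_future A g T C \<inter> (?I \<times> ?W) \<noteq> {}"
      using xy(3) open_Int_closure_eq_empty by blast
    then obtain x' y' where xy': "(x', y') \<in> causal_future A g T C" "x' \<in> ?I" "y' \<in> ?W" by blast
    have "future_timelike T z (exp_inv z y')"
    proof (cases "x' = y'")
      case False
      then obtain \<gamma> where \<gamma>: "future_causal_curve A g T \<gamma>" "pathstart \<gamma> = x'" "pathfinish \<gamma> = y'" "path_image \<gamma> \<subseteq> C"
        using xy'(1) by (auto simp: causal_future_def)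
      then show ?thesis
        using future_timelike_invariant[OF T z(1) \<gamma>(1), of 1] xy'(2)
        by (auto simp: pathstart_def pathfinish_def path_image_def)
    qed (use xy' in auto)
    then show False using xy'(3) future_timelike_imp_cone by blast
  qed
  with \<beta>(2) have cone: "\<forall>\<^sub>F \<epsilon> in at_right 0. \<beta> \<epsilon> \<in> C \<and> future_cone (opposite T) y (exp_inv y (\<beta> \<epsilon>))"
    by (auto elim!: eventually_mono intro: cone_dual(1)[OF T _ xy(2)])
  have Ty: "opposite T y \<in> TM y" by (rule orientation_tangent[OF orientation_opposite[OF T]])
  note cont = exp_inv_products_continuous[OF xy(2) Ty]
  have lim: "((\<lambda>\<epsilon>. F (\<beta> \<epsilon>)) \<longlongrightarrow> F x) (at_right 0)" if "continuous_on C F" for F :: "'m \<Rightarrow> real"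
    using \<beta>(1) that C_open xy(1) by (metis continuous_on_eq_continuous_at isCont_tendsto_compose)
  have "g y (exp_inv y x) (exp_inv y x) \<le> 0"
    by (rule tendsto_upperbound[OF lim[OF cont(1)]]) (use cone in \<open>auto simp: future_cone_def elim!: eventually_mono\<close>)
  moreover have "g y (opposite T y) (exp_inv y x) \<le> 0"
    by (rule tendsto_upperbound[OF lim[OF cont(2)]]) (use cone in \<open>auto simp: future_cone_def elim!: eventually_mono\<close>)
  ultimately show ?thesis by (simp add: future_cone_def)
qed

lemma causal_future_closed:
  assumes T: "time_orientation A g T"
  shows "closedin (top_of_set (C \<times> C)) (causal_future A g T C)"
proof -
  have "(x, y) \<in> causal_future A g T C" if "x \<in> C" "y \<in> C" "(x, y) \<in> closure (causal_future A g T C)" for x y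
    using cone_dual(1)[OF orientation_opposite[OF T] that(2,1) closure_causal_future_cone[OF T that]]
    by (intro cone_imp_causal_future[OF T that(1,2)]) simp
  then have "causal_future A g T C = (C \<times> C) \<inter> closure (causal_future A g T C)"
    using causal_future_subset[of T] closure_subset[of "causal_future A g T C"] by auto
  then show ?thesis
    unfolding closedin_closed by (metis closed_closure)
qed


section \<open>Strong causality\<close>

definition diamond where
  "diamond T a b = {u \<in> C. future_timelike T a (exp_inv a u) \<and> future_timelike (opposite T) b (exp_inv b u)}"

lemma diamond_open:
  assumes T: "time_orientation A g T" and "a \<in> C" "b \<in> C"
  shows "open (diamond T a b)"
proof -
  have "diamond T a b = {u \<in> C. future_timelike T a (exp_inv a u)} \<inter> {u \<in> C. future_timelike (opposite T) b (exp_inv b u)}"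
    by (auto simp: diamond_def)
  then show ?thesis
    using future_timelike_open(1)[OF T assms(2)] future_timelike_open(1)[OF orientation_opposite[OF T] assms(3)]
    by (simp add: open_Int)
qed

text \<open>A causal curve in \<open>C\<close> is future directed in one of its two directions of traversal. So, whichever its
  orientation, invariance of the future cone at \<open>a\<close> applies from one end point and invariance of the past
  cone at \<open>b\<close> from the other.\<close>

lemma diamond_causally_convex:
  assumes T: "time_orientation A g T" and ab: "a \<in> C" "b \<in> C"
  shows "causally_convex_in A g (diamond T a b) C"
  unfolding causally_convex_in_def
proof (intro conjI allI impI)
  show "diamond T a b \<subseteq> C" by (auto simp: diamond_def)
  fix \<gamma> assume "causal_curve A g \<gamma> \<and> path_image \<gamma> \<subseteq> C \<and> pathstart \<gamma> \<in> diamond T a b \<and> pathfinish \<gamma> \<in> diamond T a b"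
  then have \<gamma>: "causal_curve A g \<gamma>" "\<gamma> ` {0..1} \<subseteq> C" "\<gamma> 0 \<in> diamond T a b" "\<gamma> 1 \<in> diamond T a b"
    by (auto simp: pathstart_def pathfinish_def path_image_def)
  note T' = orientation_opposite[OF T]
  have *: "future_timelike S p (exp_inv p (\<gamma> s))"
    if S: "time_orientation A g S" and p: "p \<in> C" and s: "s \<in> {0..1}"
      and "future_timelike S p (exp_inv p (\<gamma> 0))" "future_timelike S p (exp_inv p (\<gamma> 1))"
      and "future_causal_curve A g S \<gamma> \<or> future_causal_curve A g (opposite S) \<gamma>" for S p s
    using that(6)
  proof
    assume "future_causal_curve A g S \<gamma>"
    then show ?thesis using future_timelike_invariant[OF S p _ \<gamma>(2) that(4) s] by blast
  next
    assume "future_causal_curve A g (opposite S) \<gamma>"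
    from future_causal_curve_reverse[OF orientation_opposite[OF S] this]
    have "future_causal_curve A g S (\<lambda>s. \<gamma> (1 - s))" by simp
    from future_timelike_invariant[OF S p this, of "1 - s"]
    show ?thesis using \<gamma>(2) s that(5) by force
  qed
  have or: "future_causal_curve A g T \<gamma> \<or> future_causal_curve A g (opposite T) \<gamma>"
    by (rule causal_curve_oriented(2)[OF T \<gamma>(1)])
  have "\<gamma> s \<in> diamond T a b" if s: "s \<in> {0..1}" for s
  proof -
    have "future_timelike T a (exp_inv a (\<gamma> s))"
      using \<gamma>(3,4) or by (intro *[OF T ab(1) s]) (auto simp: diamond_def)
    moreover have "future_timelike (opposite T) b (exp_inv b (\<gamma> s))"
      using \<gamma>(3,4) or by (intro *[OF T' ab(2) s]) (auto simp: diamond_def)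
    ultimately show ?thesis using \<gamma>(2) s by (auto simp: diamond_def)
  qed
  then show "path_image \<gamma> \<subseteq> diamond T a b" by (auto simp: path_image_def)
qed

text \<open>The geodesic from \<open>a\<close> to a point of the diamond outside \<open>B\<close> crosses the frontier of \<open>B\<close>. The
  crossing point precedes a point of the diamond, so the invariance of the past cone at \<open>b\<close> places it
  before \<open>b\<close>.\<close>

lemma diamond_meets_frontier:
  assumes T: "time_orientation A g T" and ab: "a \<in> C" "b \<in> C" and "a \<in> B"
    and u: "u \<in> diamond T a b" "u \<notin> B"
  obtains w where "w \<in> C" "w \<in> frontier B" "(a, w) \<in> causal_future A g T C" "(w, b) \<in> causal_future A g T C"
proof -
  have uC: "u \<in> C" and fa: "future_timelike T a (exp_inv a u)" and fb: "future_timelike (opposite T) b (exp_inv b u)"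
    using u by (auto simp: diamond_def)
  let ?\<sigma> = "connector a u"
  note \<sigma> = connector[OF ab(1) uC] and T' = orientation_opposite[OF T]
  have "connected (?\<sigma> ` {0..1})"
    using geod_path[OF \<sigma>(1)] by (intro connected_continuous_image) (auto simp: path_def)
  moreover have "?\<sigma> 0 \<in> B" "?\<sigma> 1 \<notin> B" using \<sigma>(2,3) \<open>a \<in> B\<close> u by simp_all
  moreover have "?\<sigma> 0 \<in> ?\<sigma> ` {0..1}" "?\<sigma> 1 \<in> ?\<sigma> ` {0..1}" by (intro imageI; simp)+
  ultimately have "?\<sigma> ` {0..1} \<inter> frontier B \<noteq> {}"
    using connected_Int_frontier[of "?\<sigma> ` {0..1}" B] by blast
  then obtain s where s: "s \<in> {0..1}" "?\<sigma> s \<in> frontier B" by blast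
  have wC: "?\<sigma> s \<in> C" using \<sigma>(4) s by auto
  have ea: "exp_inv a u \<in> TM a" by (rule exp_inv_tangent[OF ab(1) uC])
  have "future_cone T a (exp_inv a (?\<sigma> s))"
    unfolding exp_inv_initial_segment[OF ab(1) uC s(1)] future_cone_def
    using fa s(1) ea orientation_tangent[OF T, of a]
    by (auto simp: g_scale_left g_scale_right tangent_scale future_timelike_def mult_le_0_iff)
  then have 1: "(a, ?\<sigma> s) \<in> causal_future A g T C"
    by (rule cone_imp_causal_future[OF T ab(1) wC])
  have "vel ?\<sigma> 0 \<noteq> (\<lambda>_. 0)"
    using fa g_zero[OF tangent_zero, of a] by (auto simp: future_timelike_def exp_inv_def)
  then have "future_causal_curve A g T ?\<sigma>"
    using future_timelike_imp_cone[OF fa] \<sigma>(2) by (intro geod_future_causal[OF T \<sigma>(1)]) (auto simp: exp_inv_def)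
  then have "future_causal_curve A g (opposite T) (\<lambda>s. ?\<sigma> (1 - s))"
    by (rule future_causal_curve_reverse[OF T])
  from future_timelike_invariant[OF T' ab(2) this, of "1 - s"]
  have "future_timelike (opposite T) b (exp_inv b (?\<sigma> s))"
    using \<sigma>(3,4) fb s(1) by force
  from cone_dual(1)[OF T' ab(2) wC future_timelike_imp_cone[OF this]]
  have "(?\<sigma> s, b) \<in> causal_future A g T C"
    by (intro cone_imp_causal_future[OF T wC ab(2)]) simp
  with 1 wC s(2) show thesis by (intro that)
qed

text \<open>Diamonds whose vertices tend to \<open>p\<close> shrink to \<open>p\<close>: otherwise their points on a compact
  frontier around \<open>p\<close> would accumulate at a point \<open>w \<noteq> p\<close> with both \<open>(p, w)\<close> and \<open>(w, p)\<close> in the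
  closed relation \<open>J\<^sup>+\<close>, and then \<open>exp\<^sub>p\<^sup>-\<^sup>1 w\<close> is both future and past pointing.\<close>

lemma small_diamond:
  assumes T: "time_orientation A g T" and p: "p \<in> C" and U: "open U" "p \<in> U"
  obtains a b where "a \<in> C" "b \<in> C" "p \<in> diamond T a b" "diamond T a b \<subseteq> U"
proof -
  note T' = orientation_opposite[OF T]
  let ?J = "causal_future A g T C"
  obtain \<alpha> where \<alpha>: "(\<alpha> \<longlongrightarrow> p) (at_right (0::real))"
    "\<forall>\<^sub>F \<epsilon> in at_right 0. \<alpha> \<epsilon> \<in> C \<and> future_timelike T (\<alpha> \<epsilon>) (exp_inv (\<alpha> \<epsilon>) p)"
    by (rule timelike_approximation[OF T p])
  obtain \<beta> where \<beta>: "(\<beta> \<longlongrightarrow> p) (at_right (0::real))"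
    "\<forall>\<^sub>F \<epsilon> in at_right 0. \<beta> \<epsilon> \<in> C \<and> future_timelike (opposite T) (\<beta> \<epsilon>) (exp_inv (\<beta> \<epsilon>) p)"
    by (rule timelike_approximation[OF T' p])
  obtain c where c: "c \<in> A" "p \<in> fst c" by (rule chart_at)
  let ?W = "snd c ` (fst c \<inter> (U \<inter> C))"
  have "?W = snd c ` fst c \<inter> chart_inv c -` (U \<inter> C)" using c by auto
  then have "open ?W"
    using continuous_open_preimage[OF chart_inv_continuous[OF c(1)] chart_open(2)[OF c(1)], of "U \<inter> C"] U C_open
    by (simp add: open_Int)
  moreover have "snd c p \<in> ?W" using c U p by auto
  ultimately obtain r where r: "r > 0" "cball (snd c p) r \<subseteq> ?W"
    using open_contains_cball by metis
  define B where "B = chart_inv c ` ball (snd c p) r"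
  have dom: "cball (snd c p) r \<subseteq> snd c ` fst c" using r(2) by auto
  have B_eq: "B = fst c \<inter> snd c -` ball (snd c p) r"
  proof
    show "B \<subseteq> fst c \<inter> snd c -` ball (snd c p) r"
    proof
      fix w assume "w \<in> B"
      then obtain x where x: "w = chart_inv c x" "x \<in> ball (snd c p) r" by (auto simp: B_def)
      then have "x \<in> snd c ` fst c" using dom by auto
      then show "w \<in> fst c \<inter> snd c -` ball (snd c p) r" using x c(1) by auto
    qed
    show "fst c \<inter> snd c -` ball (snd c p) r \<subseteq> B"
      unfolding B_def using c(1) by (force intro: rev_image_eqI)
  qed
  have "open B"
    unfolding B_eq by (rule continuous_open_preimage[OF chart_continuous[OF c(1)] chart_open(1)[OF c(1)] open_ball])
  have pB: "p \<in> B" using c r by (simp add: B_eq)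
  have cballU: "chart_inv c ` cball (snd c p) r \<subseteq> U \<inter> C" using r(2) c(1) by force
  have "B \<subseteq> U"
    using cballU ball_subset_cball[of "snd c p" r] unfolding B_def by blast
  have cont: "continuous_on (cball (snd c p) r) (chart_inv c)"
    using chart_inv_continuous[OF c(1)] dom by (rule continuous_on_subset)
  have "compact (chart_inv c ` cball (snd c p) r)"
    using cont compact_cball by (rule compact_continuous_image)
  then have "closed (chart_inv c ` cball (snd c p) r)" by (rule compact_imp_closed)
  then have "closure B \<subseteq> chart_inv c ` cball (snd c p) r"
    by (rule closure_minimal[rotated]) (auto simp: B_def)
  then have frontier: "frontier B \<subseteq> chart_inv c ` sphere (snd c p) r"
    unfolding frontier_def interior_open[OF \<open>open B\<close>]
    using cball_diff_sphere[of "snd c p" r] unfolding B_def by blast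
  have good: "\<forall>\<^sub>F \<epsilon> in at_right 0. \<alpha> \<epsilon> \<in> C \<and> \<beta> \<epsilon> \<in> C \<and> p \<in> diamond T (\<alpha> \<epsilon>) (\<beta> \<epsilon>) \<and> \<alpha> \<epsilon> \<in> B"
    using \<alpha>(2) \<beta>(2) topological_tendstoD[OF \<alpha>(1) \<open>open B\<close> pB]
    by eventually_elim (use p in \<open>auto simp: diamond_def\<close>)
  have "\<exists>\<epsilon>. \<alpha> \<epsilon> \<in> C \<and> \<beta> \<epsilon> \<in> C \<and> p \<in> diamond T (\<alpha> \<epsilon>) (\<beta> \<epsilon>) \<and> diamond T (\<alpha> \<epsilon>) (\<beta> \<epsilon>) \<subseteq> B"
  proof (rule ccontr)
    assume no: "\<not> ?thesis"
    have ev: "\<forall>\<^sub>F \<epsilon> in at_right 0. \<exists>x\<in>sphere (snd c p) r. (\<alpha> \<epsilon>, chart_inv c x) \<in> ?J \<and> (chart_inv c x, \<beta> \<epsilon>) \<in> ?J"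
      using good
    proof eventually_elim
      case (elim \<epsilon>)
      then obtain u where u: "u \<in> diamond T (\<alpha> \<epsilon>) (\<beta> \<epsilon>)" "u \<notin> B" using no by blast
      obtain w where "w \<in> frontier B" "(\<alpha> \<epsilon>, w) \<in> ?J" "(w, \<beta> \<epsilon>) \<in> ?J"
        using diamond_meets_frontier[OF T _ _ _ u] elim by metis
      then show ?case using frontier by blast
    qed
    have lim0: "filterlim (\<lambda>n. inverse (real (Suc n))) (at_right 0) sequentially"
      unfolding filterlim_at using LIMSEQ_inverse_real_of_nat by auto
    obtain m where "\<forall>n\<ge>m. \<exists>x\<in>sphere (snd c p) r.
        (\<alpha> (inverse (real (Suc n))), chart_inv c x) \<in> ?J \<and> (chart_inv c x, \<beta> (inverse (real (Suc n)))) \<in> ?J"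
      using eventually_compose_filterlim[OF ev lim0] unfolding eventually_sequentially by blast
    then have "\<forall>n. \<exists>x. x \<in> sphere (snd c p) r \<and> (\<alpha> (inverse (real (Suc (n + m)))), chart_inv c x) \<in> ?J
        \<and> (chart_inv c x, \<beta> (inverse (real (Suc (n + m))))) \<in> ?J"
      by (metis le_add2)
    then obtain x where x: "\<And>n. x n \<in> sphere (snd c p) r"
      "\<And>n. (\<alpha> (inverse (real (Suc (n + m)))), chart_inv c (x n)) \<in> ?J"
      "\<And>n. (chart_inv c (x n), \<beta> (inverse (real (Suc (n + m))))) \<in> ?J"
      by metis
    obtain l \<rho> where l: "l \<in> sphere (snd c p) r" "strict_mono \<rho>" "(x \<circ> \<rho>) \<longlonglongrightarrow> l"
      using compact_sphere[of "snd c p" r] x(1) unfolding compact_def by metis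
    let ?w = "chart_inv c l"
    have l_cball: "l \<in> cball (snd c p) r" and x_cball: "\<And>n. x n \<in> cball (snd c p) r"
      using l(1) x(1) by auto
    have wlim: "(\<lambda>n. chart_inv c (x (\<rho> n))) \<longlonglongrightarrow> ?w"
      by (rule continuous_on_tendsto_compose[OF cont]) (use l x_cball l_cball in \<open>auto simp: o_def\<close>)
    have wC: "?w \<in> C" using cballU l_cball by auto
    have sub: "filterlim (\<lambda>n. \<rho> n + m) sequentially sequentially"
      by (rule filterlim_at_top_mono[OF filterlim_subseq[OF l(2)]]) auto
    have "filterlim (\<lambda>n. inverse (real (Suc (\<rho> n + m)))) (at_right 0) sequentially"
      by (rule filterlim_compose[OF lim0 sub])
    then have \<alpha>lim: "(\<lambda>n. \<alpha> (inverse (real (Suc (\<rho> n + m))))) \<longlonglongrightarrow> p"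
      and \<beta>lim: "(\<lambda>n. \<beta> (inverse (real (Suc (\<rho> n + m))))) \<longlonglongrightarrow> p"
      using filterlim_compose[OF \<alpha>(1)] filterlim_compose[OF \<beta>(1)] by blast+
    have "(p, ?w) \<in> closure ?J"
      by (rule Lim_in_closed_set[OF closed_closure _ _ tendsto_Pair[OF \<alpha>lim wlim]])
         (intro always_eventually allI subsetD[OF closure_subset] x(2), simp)
    then have "future_cone (opposite T) ?w (exp_inv ?w p)"
      by (rule closure_causal_future_cone[OF T p wC])
    from cone_dual(1)[OF T' wC p this] have f: "future_cone T p (exp_inv p ?w)" by simp
    have "(?w, p) \<in> closure ?J"
      by (rule Lim_in_closed_set[OF closed_closure _ _ tendsto_Pair[OF wlim \<beta>lim]])
         (intro always_eventually allI subsetD[OF closure_subset] x(3), simp)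
    then have "future_cone (opposite T) p (exp_inv p ?w)"
      by (rule closure_causal_future_cone[OF T wC p])
    with f have "exp_inv p ?w = (\<lambda>_. 0)"
      by (rule future_past_cone_zero[OF T exp_inv_tangent[OF p wC]])
    then have "?w = p" by (rule exp_inv_zero[OF p wC])
    moreover have "snd c ?w = l"
      using dom l_cball by (intro f_inv_into_f) auto
    ultimately show False using l(1) r(1) by auto
  qed
  then show thesis using \<open>B \<subseteq> U\<close> that by blast
qed

theorem convex_normal_causally_simple:
  assumes T: "time_orientation A g T"
  shows "causally_simple A g T C"
  unfolding causally_simple_def strongly_causal_def
proof (intro conjI C_open causal_future_closed[OF T] ballI allI impI)
  fix p U assume "p \<in> C" and U: "open U \<and> p \<in> U"
  then obtain a b where ab: "a \<in> C" "b \<in> C" "p \<in> diamond T a b" "diamond T a b \<subseteq> U"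
    using small_diamond[OF T] by metis
  then show "\<exists>V. open V \<and> p \<in> V \<and> V \<subseteq> U \<and> causally_convex_in A g V C"
    using diamond_open[OF T ab(1,2)] diamond_causally_convex[OF T ab(1,2)] by blast
qed

end

theorem theorem12:
  fixes A :: "('m::t2_space, 'n::finite) chart set"
    and g :: "('m, 'n) metric_field"
    and T :: "'m \<Rightarrow> ('m, 'n) tvec"
    and C :: "'m set"
  assumes "paracompact_space (euclidean :: 'm topology)"
    and "connected (UNIV :: 'm set)"
    and "C21_atlas A"
    and "C11_lorentzian_metric A g"
    and "time_orientation A g T"
    and "convex_normal A g C"
  shows "causally_simple A g T C"
proof -
  interpret convex_normal_set A g C
    using assms by unfold_locales
  show ?thesis
    using assms(5) by (rule convex_normal_causally_simple)
qed

end
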